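(* There exists a constant $c>0$ such that the following holds. Let $k=k(N)\ge 2$ be any sequence of integers with $k=o(N^{2/3})$ as $N\to\infty$. Then for every $\varepsilon\in(0,1)$, the $\varepsilon$-mixing time $t_{\mathrm{mix}}(\varepsilon)$ of the $S_k$ shuffle on $N$ cards satisfies $$\frac{6}{\pi^2}\le \liminf_{N\to\infty}\frac{k(k^2-1)\,t_{\mathrm{mix}}(\varepsilon)}{N^2\log N}\le \limsup_{N\to\infty}\frac{k(k^2-1)\,t_{\mathrm{mix}}(\varepsilon)}{N^2\log N}\le c .$$
   Context: $\mathcal S_N$ is the symmetric group on $[N]=\{1,\dots,N\}$; a permutation $\eta\in\mathcal S_N$ is viewed as a deck, $\eta(m)$ being the label of the card at position $m$. For $1\le i<j\le N$, $\eta\in\mathcal S_N$ and $\sigma\in\mathcal S_{j-i+1}$, let $\eta^{\sigma,i,j}\in\mathcal S_N$ be the deck obtained by rearranging the cards in positions $i,\dots,j$ according to $\sigma$: $\eta^{\sigma,i,j}(m)=\eta(m)$ for $m\notin[i,j]$ and $\eta^{\sigma,i,j}(m)=\eta(i-1+\sigma(m-i+1))$ for $m\in[i,j]$. The $S_k$ shuffle on $N$ cards ($2\le k\le N$) is the continuous-time Markov chain $(\eta_t)_{t\ge0}$ on $\mathcal S_N$ in which each block of $k$ consecutive positions $\{i,\dots,i+k-1\}$ ($1\le i\le N-k+1$) carries an independent rate-1 Poisson clock; when it rings, the cards of that block are rearranged by a uniformly random $\sigma\in\mathcal S_k$, i.e. the generator is $(\mathcal Lf)(\eta)=\sum_{i}\frac1{k!}\sum_{\sigma\in\mathcal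 S_k}(f(\eta^{\sigma,i,i+k-1})-f(\eta))$. Its stationary law is the uniform measure $\mu_N$ on $\mathcal S_N$. Total variation distance: $\|\nu-\mu\|_{TV}=\frac12\sum_\eta|\nu(\eta)-\mu(\eta)|$. The $\varepsilon$-mixing time is $t_{\mathrm{mix}}(\varepsilon)=\inf\{t\ge0:\max_{\eta\in\mathcal S_N}\|\mathbb P(\eta_t\in\cdot\mid\eta_0=\eta)-\mu_N\|_{TV}<\varepsilon\}$. *)

theory Defs
  imports "HOL-Analysis.Analysis" "HOL-Combinatorics.Permutations" "HOL-Library.Landau_Symbols"
begin

definition decks :: "nat \<Rightarrow> (nat \<Rightarrow> nat) set" where
  "decks N = {\<eta>. \<eta> permutes {1..N}}"

definition rearr :: "(nat \<Rightarrow> nat) \<Rightarrow> (nat \<Rightarrow> nat) \<Rightarrow> nat \<Rightarrow> nat \<Rightarrow> (nat \<Rightarrow> nat)" where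
  "rearr \<eta> \<sigma> i j = (\<lambda>m. if i \<le> m \<and> m \<le> j then \<eta> (i - 1 + \<sigma> (m - i + 1)) else \<eta> m)"

definition shuffle_gen :: "nat \<Rightarrow> nat \<Rightarrow> ((nat \<Rightarrow> nat) \<Rightarrow> real) \<Rightarrow> ((nat \<Rightarrow> nat) \<Rightarrow> real)" where
  "shuffle_gen N k f = (\<lambda>\<eta>. \<Sum>i\<in>{1..N+1-k}.
      (1 / fact k) * (\<Sum>\<sigma>\<in>{\<sigma>. \<sigma> permutes {1..k}}. f (rearr \<eta> \<sigma> i (i + k - 1)) - f \<eta>))"

text \<open>Transition probabilities P(eta_t = zeta | eta_0 = eta) = (e^{tL} 1_{zeta})(eta).\<close>
definition shuffle_heat :: "nat \<Rightarrow> nat \<Rightarrow> real \<Rightarrow> (nat \<Rightarrow> nat) \<Rightarrow> (nat \<Rightarrow> nat) \<Rightarrow> real" where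
  "shuffle_heat N k t \<eta> \<zeta> =
     (\<Sum>n. t ^ n / fact n * ((shuffle_gen N k ^^ n) (\<lambda>\<xi>. if \<xi> = \<zeta> then 1 else 0)) \<eta>)"

definition shuffle_tv :: "nat \<Rightarrow> nat \<Rightarrow> real \<Rightarrow> (nat \<Rightarrow> nat) \<Rightarrow> real" where
  "shuffle_tv N k t \<eta> = (1/2) * (\<Sum>\<zeta>\<in>decks N. \<bar>shuffle_heat N k t \<eta> \<zeta> - 1 / fact N\<bar>)"

definition tmix :: "nat \<Rightarrow> nat \<Rightarrow> real \<Rightarrow> real" where
  "tmix N k \<epsilon> = Inf {t. t \<ge> 0 \<and> (\<forall>\<eta>\<in>decks N. shuffle_tv N k t \<eta> < \<epsilon>)}"

end

theory Submission
  imports Defs "HOL-Real_Asymp.Real_Asymp"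
begin

text \<open>
  A single card performs a reversible walk whose one-step operator averages, over the blocks, the
  operators replacing a function on a block by its mean there.

  Upper bound: two decks are shuffled with the same blocks so that a card lying in both copies of the
  block is sent to the same place. If \<open>H\<close> is monotone on positions, then the average of
  \<open>\<bar>H (x) - H (y)\<bar>\<close> over such a move is exactly the same expression for the averaged \<open>H\<close>, because
  the two copies of a card never cross. So the sum over the cards of these distances is contracted as
  fast as the card operator contracts \<open>H\<close>, and this rate is read off by pairing with an explicit
  supersolution: a cosine plus a correction \<open>1 / x - 1 / k\<close> for the slow positions near the ends.

  Lower bound: \<open>\<Phi> = \<Sum> h (m) w (\<xi> m)\<close> with \<open>w = \<plusminus>1\<close> on the two halves of the labels and \<open>h\<close> a sine whose
  frequency is raised slightly, which makes it a subsolution up to the ends. Given the sequence of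
  blocks, the \<open>w (\<xi> m)\<close> are negatively correlated, and their mean profile is monotone, so the mean of
  \<open>\<Phi>\<close> decays at most at the rate of \<open>h\<close>. The fluctuation coming from the random blocks is paid for by
  the decrease of the squared norm of the mean profile: its total is at most \<open>k\<^sup>3 / N\<close> up to a constant,
  which is negligible against \<open>N\<close> exactly when \<open>k\<close> is below \<open>N\<close> to the power \<open>2/3\<close>.

  Continuous time enters only by Poissonization of the discrete chain.
\<close>

section \<open>Uniform permutations of a block\<close>

text \<open>The obstacle in the lower bound: \<open>h\<close> is only a subsolution, so the mean of
  the statistic is bounded from below but never identified, and negative correlation holds only once
  the blocks are fixed. A two-sided variance estimate is therefore replaced by the functional
  \<open>(max 0 (c - stat))^2\<close>, which asks for nothing but a lower bound on the mean. The
  mean stays above a constant times \<open>N exp (- l t)\<close> while the variance is of order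
  \<open>N\<close>, so equilibrium is excluded until \<open>2 l t\<close> is about
  \<open>ln N\<close>. As \<open>l\<close> is asymptotic to
  \<open>pi^2 k (k^2 - 1) / (12 N^2)\<close>, this gives \<open>6 / pi^2\<close>. The constant of
  the upper bound is not optimized. The initial distance is polynomial, of order \<open>N^3\<close>,
  which costs \<open>3 ln N\<close> at the rate \<open>k (k^2 - 1) / (96 N^2)\<close>: that is 288,
  and 12 more absorb the dependence on the mixing threshold. In both directions oddness about the
  midpoint reduces the spectral input to an inequality for an explicit wave on the left half of the
  positions.\<close>

text \<open>Composing with a transposition shows that the sum does not depend on the choice of
  \<open>m\<close> in \<open>B\<close>; summing over all \<open>m\<close> then counts every
  \<open>g y\<close> once per permutation.\<close>

lemma sum_permutes_point:
  fixes g :: "'a \<Rightarrow> real"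
  assumes B: "finite B" and m: "m \<in> B"
  shows "(\<Sum>\<tau> | \<tau> permutes B. g (\<tau> m)) / fact (card B) = (\<Sum>y\<in>B. g y) / real (card B)"
proof -
  have same: "(\<Sum>\<tau> | \<tau> permutes B. g (\<tau> m')) = (\<Sum>\<tau> | \<tau> permutes B. g (\<tau> m))" if "m' \<in> B" for m'
  proof -
    have "Transposition.transpose m m' permutes B" using m that by (rule permutes_swap_id)
    from sum_permutations_compose_right[OF this, of "\<lambda>\<tau>. g (\<tau> m)"] show ?thesis
      by simp
  qed
  have "real (card B) * (\<Sum>\<tau> | \<tau> permutes B. g (\<tau> m)) = (\<Sum>m'\<in>B. \<Sum>\<tau> | \<tau> permutes B. g (\<tau> m'))"
    using same by simp
  also have "\<dots> = (\<Sum>\<tau> | \<tau> permutes B. \<Sum>m'\<in>B. g (\<tau> m'))"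
    by (rule sum.swap)
  also have "\<dots> = (\<Sum>\<tau> | \<tau> permutes B. \<Sum>y\<in>B. g y)"
    by (rule sum.cong) (auto simp: sum.permute[of _ B g] o_def)
  also have "\<dots> = fact (card B) * (\<Sum>y\<in>B. g y)"
    using card_permutations[OF refl B] by simp
  finally have eq: "real (card B) * (\<Sum>\<tau> | \<tau> permutes B. g (\<tau> m)) = fact (card B) * (\<Sum>y\<in>B. g y)" .
  have "card B > 0" using B m card_gt_0_iff by blast
  with eq show ?thesis by (simp add: field_simps)
qed

lemma permutes_two_points:
  assumes "a \<in> B" "b \<in> B" "m \<in> B" "m' \<in> B" "a \<noteq> b" "m \<noteq> m'"
  obtains q where "q permutes B" "q m = a" "q m' = b"
proof
  \<comment> \<open>\<open>c\<close> is where the first transposition puts \<open>m'\<close>.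
    Neither \<open>c\<close> nor \<open>b\<close> equals \<open>a\<close>, so the second
    transposition sends \<open>c\<close> to \<open>b\<close> without disturbing the image
    \<open>a\<close> of \<open>m\<close>.\<close>
  define c where "c = Transposition.transpose m a m'"
  have cB: "c \<in> B" using assms by (auto simp: c_def Transposition.transpose_def)
  show "Transposition.transpose c b \<circ> Transposition.transpose m a permutes B"
    by (intro permutes_compose permutes_swap_id cB assms)
  show "(Transposition.transpose c b \<circ> Transposition.transpose m a) m = a" "(Transposition.transpose c b \<circ> Transposition.transpose m a) m' = b"
    using assms by (auto simp: c_def Transposition.transpose_def)
qed

text \<open>Double transitivity makes the sum the same for every ordered pair of distinct points;
  adding over all pairs, each permutation only rearranges the right-hand side.\<close>

lemma sum_permutes_pair:
  fixes G :: "'a \<Rightarrow> 'a \<Rightarrow> real"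
  assumes B: "finite B" and m: "m \<in> B" "m' \<in> B" "m \<noteq> m'"
  shows "real (card B * (card B - 1)) * ((\<Sum>\<tau> | \<tau> permutes B. G (\<tau> m) (\<tau> m')) / fact (card B)) 
    = (\<Sum>a\<in>B. \<Sum>b\<in>B - {a}. G a b)"
proof -
  have same: "(\<Sum>\<tau> | \<tau> permutes B. G (\<tau> a) (\<tau> b)) = (\<Sum>\<tau> | \<tau> permutes B. G (\<tau> m) (\<tau> m'))"
    if ab: "a \<in> B" "b \<in> B - {a}" for a b
  proof -
    obtain q where q: "q permutes B" "q m = a" "q m' = b"
      using permutes_two_points[of a B b m m'] ab m by blast
    from sum_permutations_compose_right[OF q(1), of "\<lambda>\<tau>. G (\<tau> m) (\<tau> m')"] show ?thesis
      using q by simp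
  qed
  have "real (card B * (card B - 1)) * (\<Sum>\<tau> | \<tau> permutes B. G (\<tau> m) (\<tau> m'))
      = (\<Sum>a\<in>B. \<Sum>b\<in>B - {a}. \<Sum>\<tau> | \<tau> permutes B. G (\<tau> a) (\<tau> b))"
    using same B by simp
  also have "\<dots> = (\<Sum>\<tau> | \<tau> permutes B. \<Sum>a\<in>B. \<Sum>b\<in>B - {a}. G (\<tau> a) (\<tau> b))"
    by (subst sum.swap[of _ "{\<tau>. \<tau> permutes B}"], subst sum.swap[of _ "{\<tau>. \<tau> permutes B}"]) (rule refl)
  also have "\<dots> = (\<Sum>\<tau> | \<tau> permutes B. \<Sum>a\<in>B. \<Sum>b\<in>B - {a}. G a b)"
  proof (rule sum.cong[OF refl])
    fix \<tau> assume "\<tau> \<in> {\<tau>. \<tau> permutes B}"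
    hence t: "\<tau> permutes B" by simp
    have "(\<Sum>b\<in>B - {a}. G (\<tau> a) (\<tau> b)) = (\<Sum>b\<in>B - {\<tau> a}. G (\<tau> a) b)" if "a \<in> B" for a
    proof (rule sum.reindex_bij_betw[of \<tau> "B - {a}" "B - {\<tau> a}" "G (\<tau> a)"])
      show "bij_betw \<tau> (B - {a}) (B - {\<tau> a})"
        using bij_betw_DiffI[OF permutes_imp_bij[OF t], of "{a}" "{\<tau> a}"] that
          permutes_in_image[OF t] by (auto simp: bij_betw_def)
    qed
    hence "(\<Sum>a\<in>B. \<Sum>b\<in>B - {a}. G (\<tau> a) (\<tau> b)) = (\<Sum>a\<in>B. \<Sum>b\<in>B - {\<tau> a}. G (\<tau> a) b)" by simp
    also have "\<dots> = (\<Sum>a\<in>B. \<Sum>b\<in>B - {a}. G a b)"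
      using sum.reindex_bij_betw[OF permutes_imp_bij[OF t], of "\<lambda>a. \<Sum>b\<in>B - {a}. G a b"] .
    finally show "(\<Sum>a\<in>B. \<Sum>b\<in>B - {a}. G (\<tau> a) (\<tau> b)) = (\<Sum>a\<in>B. \<Sum>b\<in>B - {a}. G a b)" .
  qed
  also have "\<dots> = fact (card B) * (\<Sum>a\<in>B. \<Sum>b\<in>B - {a}. G a b)"
    using card_permutations[OF refl B] by simp
  finally show ?thesis by (auto simp: field_simps)
qed

text \<open>The orthogonal projection onto the functions constant on the block. Read
  probabilistically, it is the mean of \<open>u\<close> at the new position of a card that was at
  \<open>x\<close>.\<close>

definition block_avg :: "nat \<Rightarrow> nat \<Rightarrow> (nat \<Rightarrow> real) \<Rightarrow> nat \<Rightarrow> real" where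
  "block_avg k i u x = (if x \<in> {i..<i+k} then (\<Sum>y\<in>{i..<i+k}. u y) / real k else u x)"

definition card_step :: "nat \<Rightarrow> nat \<Rightarrow> (nat \<Rightarrow> real) \<Rightarrow> nat \<Rightarrow> real" where
  "card_step N k u x = (\<Sum>i\<in>{1..N+1-k}. block_avg k i u x) / real (N+1-k)"

text \<open>Permutations of the block itself replace the relabelled ones of \<open>{1..k}\<close> in
  \<open>rearr\<close>, so that a shuffle is composition on the right and permutations of the block
  can be composed with each other.\<close>

definition block_mix :: "nat \<Rightarrow> nat \<Rightarrow> ((nat \<Rightarrow> nat) \<Rightarrow> real) \<Rightarrow> (nat \<Rightarrow> nat) \<Rightarrow> real" where
  "block_mix k i f \<eta> = (\<Sum>\<tau> | \<tau> permutes {i..<i+k}. f (\<eta> \<circ> \<tau>)) / fact k"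

definition deck_step :: "nat \<Rightarrow> nat \<Rightarrow> ((nat \<Rightarrow> nat) \<Rightarrow> real) \<Rightarrow> (nat \<Rightarrow> nat) \<Rightarrow> real" where
  "deck_step N k f \<eta> = (\<Sum>i\<in>{1..N+1-k}. block_mix k i f \<eta>) / real (N+1-k)"

text \<open>Conjugation with the shift \<open>?s\<close> turns permutations of \<open>{1..k}\<close>
  into permutations of the block. The case \<open>i = 0\<close> is excluded because
  \<open>i - 1\<close> would be truncated.\<close>

lemma sum_rearr:
  assumes "1 \<le> i"
  shows "(1 / fact k) * (\<Sum>\<sigma> | \<sigma> permutes {1..k}. f (rearr \<eta> \<sigma> i (i + k - 1))) = block_mix k i f \<eta>"
proof -
  let ?s = "\<lambda>m. i - 1 + m"
  have b: "bij_betw ?s {1..k} {i..<i+k}"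
    by (rule bij_betw_byWitness[where f' = "\<lambda>m. m - i + 1"]) (use assms in auto)
  let ?T = "\<lambda>\<pi> x. if x \<in> {i..<i+k} then ?s (\<pi> (inv_into {1..k} ?s x)) else x"
  have inv: "inv_into {1..k} ?s x = x - i + 1" if "x \<in> {i..<i+k}" for x
    by (rule inv_into_f_eq) (use b assms that in \<open>auto simp: bij_betw_def\<close>)
  have "(\<Sum>\<tau> | \<tau> permutes {i..<i+k}. f (\<eta> \<circ> \<tau>)) = (\<Sum>\<sigma> | \<sigma> permutes {1..k}. f (\<eta> \<circ> ?T \<sigma>))"
    by (rule sum.reindex_bij_betw[symmetric, OF bij_betw_permutations[OF b]])
  also have "\<dots> = (\<Sum>\<sigma> | \<sigma> permutes {1..k}. f (rearr \<eta> \<sigma> i (i + k - 1)))"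
  proof (rule sum.cong[OF refl])
    fix \<sigma>
    have "(\<eta> \<circ> ?T \<sigma>) x = rearr \<eta> \<sigma> i (i + k - 1) x" for x
    proof (cases "x \<in> {i..<i+k}")
      case True
      hence "i \<le> x \<and> x \<le> i + k - 1" by auto
      thus ?thesis using inv[OF True] True by (simp only: rearr_def o_apply if_True simp_thms)
    next
      case False
      hence "\<not> (i \<le> x \<and> x \<le> i + k - 1)" using assms by auto
      thus ?thesis using False by (simp only: rearr_def o_apply if_False)
    qed
    hence "\<eta> \<circ> ?T \<sigma> = rearr \<eta> \<sigma> i (i + k - 1)" by blast
    thus "f (\<eta> \<circ> ?T \<sigma>) = f (rearr \<eta> \<sigma> i (i + k - 1))" by simp
  qed
  finally show ?thesis by (simp add: block_mix_def)
qed

text \<open>Every block rings at rate 1, so the total rate is \<open>N+1-k\<close> and the jump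
  chain picks its block uniformly.\<close>

lemma shuffle_gen_eq:
  assumes "1 \<le> k" "k \<le> N"
  shows "shuffle_gen N k f = (\<lambda>\<eta>. real (N+1-k) * (deck_step N k f \<eta> - f \<eta>))"
proof
  fix \<eta>
  have c: "card {\<sigma>. \<sigma> permutes {1..k}} = fact k" using card_permutations[of "{1..k}" k] by simp
  have "shuffle_gen N k f \<eta> = (\<Sum>i\<in>{1..N+1-k}. block_mix k i f \<eta> - f \<eta>)"
    unfolding shuffle_gen_def
  proof (rule sum.cong[OF refl])
    fix i assume "i \<in> {1..N+1-k}"
    hence i: "1 \<le> i" by simp
    show "(1 / fact k) * (\<Sum>\<sigma>\<in>{\<sigma>. \<sigma> permutes {1..k}}. f (rearr \<eta> \<sigma> i (i + k - 1)) - f \<eta>) = block_mix k i f \<eta> - f \<eta>"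
      unfolding sum_rearr[OF i, of k f \<eta>, symmetric] by (simp only: sum_subtractf right_diff_distrib sum_constant c) simp
  qed
  also have "\<dots> = real (N+1-k) * (deck_step N k f \<eta> - f \<eta>)"
    using assms by (simp add: deck_step_def sum_subtractf right_diff_distrib)
  finally show "shuffle_gen N k f \<eta> = real (N+1-k) * (deck_step N k f \<eta> - f \<eta>)" .
qed

section \<open>The one-card operator\<close>

lemma block_subset: "i \<in> {1..N+1-k} \<Longrightarrow> {i..<i+k} \<subseteq> {1..N::nat}"
  by auto

lemma sum_block_split:
  fixes F :: "nat \<Rightarrow> real"
  assumes "i \<in> {1..N+1-k}"
  shows "(\<Sum>x\<in>{1..N}. F x) = (\<Sum>x\<in>{1..N} - {i..<i+k}. F x) + (\<Sum>x\<in>{i..<i+k}. F x)"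
  by (rule sum.subset_diff[OF block_subset[OF assms]]) simp

lemma block_avg_adjoint:
  assumes i: "i \<in> {1..N+1-k}"
  shows "(\<Sum>x\<in>{1..N}. h x * block_avg k i u x) = (\<Sum>x\<in>{1..N}. block_avg k i h x * u x)"
proof -
  have "(\<Sum>x\<in>{1..N} - {i..<i+k}. h x * block_avg k i u x) = (\<Sum>x\<in>{1..N} - {i..<i+k}. block_avg k i h x * u x)"
    by (rule sum.cong) (auto simp: block_avg_def)
  moreover have "(\<Sum>x\<in>{i..<i+k}. h x * block_avg k i u x) = (\<Sum>x\<in>{i..<i+k}. block_avg k i h x * u x)"
    by (simp add: block_avg_def sum_distrib_left[symmetric] sum_distrib_right[symmetric] sum_divide_distrib[symmetric])
  ultimately show ?thesis unfolding sum_block_split[OF i] by simp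
qed

text \<open>Not divided by the number of blocks: this is the generator of one card in continuous
  time, and the rates \<open>l\<close> below are per unit of time.\<close>

definition card_gen :: "nat \<Rightarrow> nat \<Rightarrow> (nat \<Rightarrow> real) \<Rightarrow> nat \<Rightarrow> real" where
  "card_gen N k u x = (\<Sum>i\<in>{1..N+1-k}. block_avg k i u x - u x)"

lemma card_step_gen:
  assumes "k \<le> N"
  shows "card_step N k u x = u x + card_gen N k u x / real (N+1-k)"
  using assms by (simp add: card_step_def card_gen_def sum_subtractf field_simps)

lemma card_step_adjoint:
  "(\<Sum>x\<in>{1..N}. h x * card_step N k u x) = (\<Sum>x\<in>{1..N}. card_step N k h x * u x)"
proof -
  have "(\<Sum>x\<in>{1..N}. \<Sum>i\<in>{1..N+1-k}. h x * block_avg k i u x) = (\<Sum>x\<in>{1..N}. \<Sum>i\<in>{1..N+1-k}. block_avg k i h x * u x)"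
    by (subst (1 2) sum.swap) (rule sum.cong[OF refl], rule block_avg_adjoint)
  thus ?thesis
    by (simp add: card_step_def sum_distrib_left sum_distrib_right sum_divide_distrib[symmetric])
qed

text \<open>Pythagoras for an orthogonal projection; the displacement is supported on the
  block.\<close>

lemma block_avg_energy:
  assumes i: "i \<in> {1..N+1-k}" and k: "0 < k"
  shows "(\<Sum>x\<in>{i..<i+k}. (u x - block_avg k i u x)^2)
     = (\<Sum>x\<in>{1..N}. (u x)^2) - (\<Sum>x\<in>{1..N}. (block_avg k i u x)^2)"
proof -
  define S where "S = (\<Sum>y\<in>{i..<i+k}. u y)"
  have "(\<Sum>x\<in>{i..<i+k}. (u x - block_avg k i u x)^2) = (\<Sum>x\<in>{i..<i+k}. (u x)^2 - 2 * (S / k) * u x + (S / k)^2)"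
    by (rule sum.cong) (auto simp: block_avg_def S_def power2_diff)
  also have "\<dots> = (\<Sum>x\<in>{i..<i+k}. (u x)^2) - 2 * (S / k) * S + k * (S / k)^2"
    by (simp add: sum.distrib sum_subtractf sum_distrib_left[symmetric] sum_divide_distrib[symmetric] S_def)
  also have "\<dots> = (\<Sum>x\<in>{i..<i+k}. (u x)^2) - k * (S / k)^2"
    using k by (simp add: power2_eq_square field_simps)
  also have "\<dots> = (\<Sum>x\<in>{i..<i+k}. (u x)^2) - (\<Sum>x\<in>{i..<i+k}. (block_avg k i u x)^2)"
    by (simp add: block_avg_def S_def)
  also have "\<dots> = (\<Sum>x\<in>{1..N}. (u x)^2) - (\<Sum>x\<in>{1..N}. (block_avg k i u x)^2)"
  proof -
    have "(\<Sum>x\<in>{1..N} - {i..<i+k}. (block_avg k i u x)^2) = (\<Sum>x\<in>{1..N} - {i..<i+k}. (u x)^2)"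
      by (rule sum.cong) (auto simp: block_avg_def)
    thus ?thesis unfolding sum_block_split[OF i] by simp
  qed
  finally show ?thesis .
qed

text \<open>The change of \<open>u\<close> lives on the block and has sum zero there, so
  \<open>h\<close> may be recentred by any \<open>c\<close> before Cauchy-Schwarz is applied. The
  squared change of the pairing is thereby charged to the energy that \<open>u\<close>
  loses.\<close>

lemma block_avg_increment:
  assumes i: "i \<in> {1..N+1-k}" and k: "0 < k"
    and R: "(\<Sum>x\<in>{i..<i+k}. (h x - c)^2) \<le> R"
  shows "((\<Sum>x\<in>{1..N}. h x * block_avg k i u x) - (\<Sum>x\<in>{1..N}. h x * u x))^2
     \<le> R * ((\<Sum>x\<in>{1..N}. (u x)^2) - (\<Sum>x\<in>{1..N}. (block_avg k i u x)^2))"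
proof -
  define v where "v = (\<lambda>x. u x - block_avg k i u x)"
  have v0: "(\<Sum>x\<in>{i..<i+k}. v x) = 0"
    using k by (simp add: v_def block_avg_def sum_subtractf)
  have "(\<Sum>x\<in>{1..N}. h x * u x) - (\<Sum>x\<in>{1..N}. h x * block_avg k i u x) = (\<Sum>x\<in>{1..N}. h x * v x)"
    by (simp add: v_def right_diff_distrib sum_subtractf)
  also have "\<dots> = (\<Sum>x\<in>{i..<i+k}. h x * v x)"
    unfolding sum_block_split[OF i] by (auto simp: v_def block_avg_def intro!: sum.neutral)
  also have "\<dots> = (\<Sum>x\<in>{i..<i+k}. (h x - c) * v x)"
    using v0 by (simp add: left_diff_distrib sum_subtractf sum_distrib_left[symmetric])
  finally have "((\<Sum>x\<in>{1..N}. h x * u x) - (\<Sum>x\<in>{1..N}. h x * block_avg k i u x))^2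
      = (\<Sum>x\<in>{i..<i+k}. (h x - c) * v x)^2" by simp
  also have "\<dots> \<le> (\<Sum>x\<in>{i..<i+k}. (h x - c)^2) * (\<Sum>x\<in>{i..<i+k}. (v x)^2)"
    by (rule Cauchy_Schwarz_ineq_sum)
  also have "\<dots> \<le> R * (\<Sum>x\<in>{i..<i+k}. (v x)^2)"
    by (rule mult_right_mono[OF R]) (simp add: sum_nonneg)
  also have "(\<Sum>x\<in>{i..<i+k}. (v x)^2) = (\<Sum>x\<in>{1..N}. (u x)^2) - (\<Sum>x\<in>{1..N}. (block_avg k i u x)^2)"
    unfolding v_def by (rule block_avg_energy[OF i k])
  finally show ?thesis by (simp add: power2_commute)
qed

section \<open>Decreasing and odd profiles\<close>

definition decr :: "nat \<Rightarrow> (nat \<Rightarrow> real) \<Rightarrow> bool" where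
  "decr N u \<longleftrightarrow> (\<forall>x y. 1 \<le> x \<longrightarrow> x \<le> y \<longrightarrow> y \<le> N \<longrightarrow> u y \<le> u x)"

definition odd_fun :: "nat \<Rightarrow> (nat \<Rightarrow> real) \<Rightarrow> bool" where
  "odd_fun N u \<longleftrightarrow> (\<forall>x\<in>{1..N}. u (N + 1 - x) = - u x)"

lemma decrD: "decr N u \<Longrightarrow> 1 \<le> x \<Longrightarrow> x \<le> y \<Longrightarrow> y \<le> N \<Longrightarrow> u y \<le> u x"
  by (simp add: decr_def)

text \<open>The mean over the block lies between the values to its left and those to its right, so
  the order survives across both edges.\<close>

lemma decr_block_avg:
  assumes u: "decr N u" and i: "i \<in> {1..N+1-k}" and k: "0 < k"
  shows "decr N (block_avg k i u)"
  unfolding decr_def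
proof (intro allI impI)
  fix x y assume xy: "1 \<le> x" "x \<le> y" "y \<le> N"
  note d = decrD[OF u]
  have sub: "{i..<i+k} \<subseteq> {1..N}" using block_subset[OF i] .
  have up: "(\<Sum>z\<in>{i..<i+k}. u z) / k \<le> u x" if "1 \<le> x" "x < i" for x
  proof -
    have "(\<Sum>z\<in>{i..<i+k}. u z) \<le> real (card {i..<i+k}) * u x"
      by (rule sum_bounded_above) (use that sub in \<open>auto intro!: d\<close>)
    thus ?thesis using k by (simp add: field_simps)
  qed
  have lo: "u y \<le> (\<Sum>z\<in>{i..<i+k}. u z) / k" if "i + k \<le> y" "y \<le> N" for y
  proof -
    have "real (card {i..<i+k}) * u y \<le> (\<Sum>z\<in>{i..<i+k}. u z)"
      by (rule sum_bounded_below) (use that sub in \<open>auto intro!: d\<close>)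
    thus ?thesis using k by (simp add: field_simps)
  qed
  show "block_avg k i u y \<le> block_avg k i u x"
    using xy up[of x] lo[of y] d[of x y] by (auto simp: block_avg_def)
qed

lemma decr_card_step:
  assumes "decr N u" "0 < k"
  shows "decr N (card_step N k u)"
  unfolding decr_def card_step_def
  by (intro allI impI divide_right_mono sum_mono) (use decrD[OF decr_block_avg[OF assms(1) _ assms(2)]] in auto)

text \<open>Reflection in the midpoint carries the block starting at \<open>i\<close> to the one
  starting at \<open>N + 2 - k - i\<close>, and oddness makes the two block sums opposite.\<close>

lemma block_avg_reflect:
  assumes i: "i \<in> {1..N+1-k}" and u: "odd_fun N u" and x: "x \<in> {1..N}"
  shows "block_avg k (N + 2 - k - i) u (N + 1 - x) = - block_avg k i u x"
proof -
  have k: "k \<le> N" using i by (cases "k \<le> N") auto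
  have mem: "N + 1 - x \<in> {N + 2 - k - i..<N + 2 - k - i + k} \<longleftrightarrow> x \<in> {i..<i+k}"
    using i x k by auto
  have "(\<Sum>y\<in>{N + 2 - k - i..<N + 2 - k - i + k}. u y) = (\<Sum>y\<in>{i..<i+k}. u (N + 1 - y))"
    by (rule sum.reindex_bij_witness[where i = "\<lambda>y. N + 1 - y" and j = "\<lambda>y. N + 1 - y"]) (use i k in auto)
  also have "\<dots> = (\<Sum>y\<in>{i..<i+k}. - u y)"
    by (rule sum.cong[OF refl]) (use u block_subset[OF i] in \<open>auto simp: odd_fun_def\<close>)
  finally have s: "(\<Sum>y\<in>{N + 2 - k - i..<N + 2 - k - i + k}. u y) = - (\<Sum>y\<in>{i..<i+k}. u y)"
    by (simp add: sum_negf)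
  show ?thesis using u x unfolding block_avg_def mem s by (auto simp: odd_fun_def)
qed

lemma odd_card_step:
  assumes "odd_fun N u"
  shows "odd_fun N (card_step N k u)"
  unfolding odd_fun_def
proof
  fix x assume x: "x \<in> {1..N}"
  have "(\<Sum>i\<in>{1..N+1-k}. block_avg k i u (N + 1 - x)) = (\<Sum>i\<in>{1..N+1-k}. block_avg k (N + 2 - k - i) u (N + 1 - x))"
    by (rule sum.reindex_bij_witness[where i = "\<lambda>i. N + 2 - k - i" and j = "\<lambda>i. N + 2 - k - i"]) auto
  also have "\<dots> = (\<Sum>i\<in>{1..N+1-k}. - block_avg k i u x)"
    by (rule sum.cong[OF refl]) (rule block_avg_reflect[OF _ assms x])
  finally show "card_step N k u (N + 1 - x) = - card_step N k u x"
    by (simp add: card_step_def sum_negf)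
qed

lemma odd_card_gen:
  assumes "odd_fun N u" "k \<le> N"
  shows "odd_fun N (card_gen N k u)"
proof -
  have eq: "card_gen N k u x = real (N+1-k) * (card_step N k u x - u x)" for x
    using assms by (simp add: card_step_gen[of k N u x])
  show ?thesis
    using odd_card_step[OF assms(1), of k] assms(1) unfolding odd_fun_def eq
    by (simp add: right_diff_distrib)
qed

lemma sum_reflect:
  fixes F :: "nat \<Rightarrow> real"
  shows "(\<Sum>x\<in>{1..N}. F x) = (\<Sum>x\<in>{1..N}. F (N + 1 - x))"
  by (rule sum.reindex_bij_witness[where i = "\<lambda>i. N + 1 - i" and j = "\<lambda>i. N + 1 - i"]) auto

text \<open>Pairing \<open>x\<close> with \<open>N+1-x\<close> turns twice the sum into the sum of
  \<open>e x * (u x - u (N+1-x))\<close>, whose two factors have the same sign on either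
  half.\<close>

lemma odd_decr_correlation:
  assumes e: "odd_fun N e" and u: "decr N u" and pos: "\<And>x. 1 \<le> x \<Longrightarrow> 2 * x \<le> N + 1 \<Longrightarrow> 0 \<le> e x"
  shows "0 \<le> (\<Sum>x\<in>{1..N}. e x * u x)"
proof -
  have "2 * (\<Sum>x\<in>{1..N}. e x * u x) = (\<Sum>x\<in>{1..N}. e x * u x) + (\<Sum>x\<in>{1..N}. e (N+1-x) * u (N+1-x))"
    using sum_reflect[of "\<lambda>x. e x * u x" N] by simp
  also have "\<dots> = (\<Sum>x\<in>{1..N}. e x * (u x - u (N+1-x)))"
    unfolding sum.distrib[symmetric] by (rule sum.cong) (use e in \<open>auto simp: odd_fun_def algebra_simps\<close>)
  also have "0 \<le> \<dots>"
  proof (rule sum_nonneg)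
    fix x assume x: "x \<in> {1..N}"
    show "0 \<le> e x * (u x - u (N+1-x))"
    proof (cases "2 * x \<le> N + 1")
      case True
      then show ?thesis using x pos[of x] decrD[OF u, of x "N+1-x"] by auto
    next
      case False
      have "0 \<le> e (N+1-x)" by (rule pos) (use x False in auto)
      hence "e x \<le> 0" using e x by (auto simp: odd_fun_def)
      moreover have "u x - u (N+1-x) \<le> 0" using decrD[OF u, of "N+1-x" x] x False by auto
      ultimately show ?thesis by (simp add: mult_nonpos_nonpos)
    qed
  qed
  finally show ?thesis by simp
qed

text \<open>By symmetry the step is moved onto \<open>h\<close>. The defect
  \<open>card_gen N k h + l * h\<close> is odd, so its sign on the left half alone decides the sign
  of its pairing with a decreasing \<open>u\<close>.\<close>

lemma card_step_drift:
  assumes k: "k \<le> N" and h: "odd_fun N h" and u: "decr N u"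
  shows card_step_drift_ge: "(\<And>x. 1 \<le> x \<Longrightarrow> 2 * x \<le> N + 1 \<Longrightarrow> 0 \<le> card_gen N k h x + l * h x) \<Longrightarrow>
      (1 - l / real (N+1-k)) * (\<Sum>x\<in>{1..N}. h x * u x) \<le> (\<Sum>x\<in>{1..N}. h x * card_step N k u x)"
    and card_step_drift_le: "(\<And>x. 1 \<le> x \<Longrightarrow> 2 * x \<le> N + 1 \<Longrightarrow> card_gen N k h x + l * h x \<le> 0) \<Longrightarrow>
      (\<Sum>x\<in>{1..N}. h x * card_step N k u x) \<le> (1 - l / real (N+1-k)) * (\<Sum>x\<in>{1..N}. h x * u x)"
proof -
  define e where "e = (\<lambda>x. card_gen N k h x + l * h x)"
  have oe: "odd_fun N e" "odd_fun N (\<lambda>x. - e x)"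
    using odd_card_gen[OF h k] h by (auto simp: odd_fun_def e_def)
  have "(\<Sum>x\<in>{1..N}. h x * card_step N k u x) = (\<Sum>x\<in>{1..N}. card_step N k h x * u x)"
    by (rule card_step_adjoint)
  also have "\<dots> = (\<Sum>x\<in>{1..N}. (1 - l / real (N+1-k)) * (h x * u x) + 1 / real (N+1-k) * (e x * u x))"
    by (rule sum.cong[OF refl]) (simp add: card_step_gen[OF k] e_def algebra_simps add_divide_distrib diff_divide_distrib)
  finally have eq: "(\<Sum>x\<in>{1..N}. h x * card_step N k u x) = (1 - l / real (N+1-k)) * (\<Sum>x\<in>{1..N}. h x * u x)
     + 1 / real (N+1-k) * (\<Sum>x\<in>{1..N}. e x * u x)"
    by (simp add: sum.distrib sum_distrib_left)
  show "(1 - l / real (N+1-k)) * (\<Sum>x\<in>{1..N}. h x * u x) \<le> (\<Sum>x\<in>{1..N}. h x * card_step N k u x)"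
    if "\<And>x. 1 \<le> x \<Longrightarrow> 2 * x \<le> N + 1 \<Longrightarrow> 0 \<le> card_gen N k h x + l * h x"
    using odd_decr_correlation[OF oe(1) u] that unfolding eq e_def by simp
  show "(\<Sum>x\<in>{1..N}. h x * card_step N k u x) \<le> (1 - l / real (N+1-k)) * (\<Sum>x\<in>{1..N}. h x * u x)"
    if le: "\<And>x. 1 \<le> x \<Longrightarrow> 2 * x \<le> N + 1 \<Longrightarrow> card_gen N k h x + l * h x \<le> 0"
  proof -
    have "0 \<le> (\<Sum>x\<in>{1..N}. - e x * u x)"
      by (rule odd_decr_correlation[OF oe(2) u]) (use le in \<open>simp only: e_def neg_0_le_iff_le\<close>)
    hence "(\<Sum>x\<in>{1..N}. e x * u x) \<le> 0" by (simp add: sum_negf)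
    thus ?thesis unfolding eq by (simp add: divide_nonpos_nonneg)
  qed
qed

text \<open>With \<open>x \<le> N + 1 - k\<close> only the left end can cut off blocks: those
  containing \<open>x\<close> start at \<open>x - p\<close> with \<open>p < min k x\<close>.\<close>

lemma card_gen_offsets:
  assumes x: "1 \<le> x" "x \<le> N + 1 - k" and k: "0 < k"
  shows "card_gen N k u x = (\<Sum>p<min k x. \<Sum>j<k. u (x - p + j) - u x) / k"
proof -
  have "card_gen N k u x = (\<Sum>i\<in>{i\<in>{1..N+1-k}. x \<in> {i..<i+k}}. (\<Sum>y\<in>{i..<i+k}. u y) / k - u x)"
    unfolding card_gen_def by (rule sum.mono_neutral_cong_right) (auto simp: block_avg_def)
  also have "\<dots> = (\<Sum>p<min k x. (\<Sum>y\<in>{x-p..<x-p+k}. u y) / k - u x)"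
    by (rule sum.reindex_bij_witness[where i = "\<lambda>p. x - p" and j = "\<lambda>i. x - i"]) (use x in auto)
  also have "\<dots> = (\<Sum>p<min k x. (\<Sum>j<k. u (x - p + j) - u x) / k)"
  proof (rule sum.cong[OF refl])
    fix p
    have "(\<Sum>y\<in>{x-p..<x-p+k}. u y) = (\<Sum>j<k. u (x - p + j))"
      by (rule sum.reindex_bij_witness[where i = "\<lambda>j. x - p + j" and j = "\<lambda>y. y - (x - p)"]) auto
    thus "(\<Sum>y\<in>{x-p..<x-p+k}. u y) / k - u x = (\<Sum>j<k. u (x - p + j) - u x) / k"
      using k by (simp add: sum_subtractf diff_divide_distrib)
  qed
  finally show ?thesis by (simp add: sum_divide_distrib)
qed

section \<open>Explicit sub- and supersolutions\<close>

lemma jordan_sin: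
  assumes "0 \<le> x" "x \<le> pi / 2"
  shows "2 * x / pi \<le> sin x"
proof -
  have "convex_on {0..pi/2} (\<lambda>x. - sin x)"
  proof (rule f''_ge0_imp_convex[where f' = "\<lambda>x. - cos x" and f'' = "\<lambda>x. sin x"])
    show "((\<lambda>x. - sin x) has_real_derivative - cos x) (at x)" for x :: real
      by (auto intro!: derivative_eq_intros)
    show "((\<lambda>x. - cos x) has_real_derivative sin x) (at x)" for x :: real
      by (auto intro!: derivative_eq_intros)
    show "0 \<le> sin x" if "x \<in> {0..pi/2}" for x :: real
      using that by (intro sin_ge_zero) auto
  qed auto
  from convex_onD_Icc'[OF this, of x] assms show ?thesis by (simp add: field_simps)
qed

lemma one_minus_cos: "1 - cos t = 2 * (sin (t / 2))^2" for t :: real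
  using cos_double_sin[of "t/2"] by simp

lemma one_minus_cos_le: "1 - cos t \<le> t^2 / 2" for t :: real
proof -
  have "\<bar>sin (t / 2)\<bar>^2 \<le> \<bar>t / 2\<bar>^2" by (rule power_mono[OF abs_sin_x_le_abs_x]) simp
  hence "(sin (t / 2))^2 \<le> (t / 2)^2" by (simp only: power2_abs)
  thus ?thesis unfolding one_minus_cos by (simp add: power2_eq_square)
qed

lemma one_minus_cos_ge:
  assumes "\<bar>t\<bar> \<le> pi"
  shows "2 * t^2 / pi^2 \<le> 1 - cos (t :: real)"
proof -
  have "2 * (\<bar>t\<bar> / 2) / pi \<le> sin (\<bar>t\<bar> / 2)" by (rule jordan_sin) (use assms in auto)
  hence "(2 * (\<bar>t\<bar> / 2) / pi)^2 \<le> (sin (\<bar>t\<bar> / 2))^2" by (rule power_mono) auto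
  moreover have "(sin (\<bar>t\<bar> / 2))^2 = (sin (t / 2))^2" by (auto simp: abs_if)
  ultimately show ?thesis unfolding one_minus_cos by (simp add: power_divide)
qed

lemma sum_lessThan_real: "(\<Sum>j<k. real j) = real k * (real k - 1) / 2"
  by (induction k) (auto simp: field_simps)

lemma sum_lessThan_real_sq: "(\<Sum>j<k. (real j)^2) = real k * (real k - 1) * (2 * real k - 1) / 6"
  by (induction k) (auto simp: field_simps power2_eq_square)

text \<open>Spread about the mean \<open>(k - 1) / 2\<close> plus the offset of \<open>c\<close>
  from it. The first term, the minimum over \<open>c\<close>, is where the factor
  \<open>k * (k^2 - 1)\<close> of the theorem comes from.\<close>

lemma sum_sq_diff: "(\<Sum>j<k. (real j - c)^2) = real k * (real k ^ 2 - 1) / 12 + real k * (c - (real k - 1) / 2)^2"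
proof -
  have "(\<Sum>j<k. (real j - c)^2) = (\<Sum>j<k. (real j)^2) - 2 * c * (\<Sum>j<k. real j) + real k * c^2"
    by (simp add: power2_diff sum.distrib sum_subtractf sum_distrib_left mult_ac)
  thus ?thesis unfolding sum_lessThan_real sum_lessThan_real_sq
    by (simp add: field_simps power2_eq_square)
qed

lemma sum_sum_sq_diff: "(\<Sum>p<k. \<Sum>j<k. (real j - real p)^2) = real k^2 * (real k ^ 2 - 1) / 6"
proof -
  have "(\<Sum>p<k. real k * (real p - (real k - 1) / 2)^2) = real k * (real k * (real k ^ 2 - 1) / 12)"
    by (simp add: sum_distrib_left[symmetric] sum_sq_diff)
  thus ?thesis unfolding sum_sq_diff by (simp add: sum.distrib power2_eq_square)
qed

text \<open>The phase is measured from the midpoint, which makes the wave odd for every frequency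
  and leaves \<open>\<theta>\<close> free to be tuned: slightly above \<open>pi / N\<close> for the
  lower bound, exactly \<open>pi / N\<close> for the upper.\<close>

definition sine_wave :: "nat \<Rightarrow> real \<Rightarrow> nat \<Rightarrow> real" where
  "sine_wave N \<theta> x = sin (\<theta> * ((real N + 1) / 2 - real x))"

lemma odd_sine_wave: "odd_fun N (sine_wave N \<theta>)"
  unfolding odd_fun_def sine_wave_def
proof
  fix x assume "x \<in> {1..N}"
  hence "\<theta> * ((real N + 1) / 2 - real (N + 1 - x)) = - (\<theta> * ((real N + 1) / 2 - real x))"
    by (auto simp: of_nat_diff field_simps)
  thus "sin (\<theta> * ((real N + 1) / 2 - real (N + 1 - x))) = - sin (\<theta> * ((real N + 1) / 2 - real x))"
    by simp
qed

text \<open>The generator applied to the sine at \<open>x\<close> is a sum over the displacements \<open>j - p\<close>, where \<open>p\<close> is the offset of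
  \<open>x\<close> in its block; only \<open>m = min k x\<close> offsets occur, and the odd part cancels in the bulk \<open>m = k\<close>.\<close>
definition even_part :: "nat \<Rightarrow> real \<Rightarrow> nat \<Rightarrow> real" where
  "even_part k \<theta> m = (\<Sum>p<m. \<Sum>j<k. 1 - cos (\<theta> * (real j - real p))) / real k"

definition odd_part :: "nat \<Rightarrow> real \<Rightarrow> nat \<Rightarrow> real" where
  "odd_part k \<theta> m = (\<Sum>p<m. \<Sum>j<k. sin (\<theta> * (real j - real p))) / real k"

text \<open>A displacement by \<open>j - p\<close> lowers the phase \<open>\<alpha>\<close> by
  \<open>\<theta> * (j - p)\<close>; the addition formula separates the parts even and odd in the
  displacement.\<close>

lemma card_gen_sine_wave:
  fixes \<theta> :: real
  assumes x: "1 \<le> x" "x \<le> N + 1 - k" and k: "0 < k"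
  defines "\<alpha> \<equiv> \<theta> * ((real N + 1) / 2 - real x)"
  shows "card_gen N k (sine_wave N \<theta>) x = - sin \<alpha> * even_part k \<theta> (min k x) - cos \<alpha> * odd_part k \<theta> (min k x)"
proof -
  have "sine_wave N \<theta> (x - p + j) - sine_wave N \<theta> x
       = - sin \<alpha> * (1 - cos (\<theta> * (real j - real p))) - cos \<alpha> * sin (\<theta> * (real j - real p))"
    if "p < min k x" for p j
  proof -
    have eq: "\<theta> * ((real N + 1) / 2 - real (x - p + j)) = \<alpha> - \<theta> * (real j - real p)"
      using that unfolding \<alpha>_def by (simp add: of_nat_diff algebra_simps)
    show ?thesis
      by (simp only: sine_wave_def eq \<alpha>_def[symmetric] sin_diff) (simp add: algebra_simps)
  qed
  hence "(\<Sum>p<min k x. \<Sum>j<k. sine_wave N \<theta> (x - p + j) - sine_wave N \<theta> x)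
     = (\<Sum>p<min k x. \<Sum>j<k. - sin \<alpha> * (1 - cos (\<theta> * (real j - real p))) - cos \<alpha> * sin (\<theta> * (real j - real p)))"
    by (intro sum.cong refl) auto
  also have "\<dots> = - sin \<alpha> * (\<Sum>p<min k x. \<Sum>j<k. 1 - cos (\<theta> * (real j - real p)))
       - cos \<alpha> * (\<Sum>p<min k x. \<Sum>j<k. sin (\<theta> * (real j - real p)))"
    unfolding sum_distrib_left sum_subtractf[symmetric] ..
  finally show ?thesis
    by (simp only: card_gen_offsets[OF x k] even_part_def odd_part_def diff_divide_distrib times_divide_eq_right)
qed

lemma odd_part_square:
  "(\<Sum>p<m. \<Sum>j<m. sin (\<theta> * (real j - real p))) = 0" (is "?Q = 0")
proof -
  have "?Q = (\<Sum>p<m. \<Sum>j<m. sin (\<theta> * (real p - real j)))" by (rule sum.swap)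
  also have "\<dots> = (\<Sum>p<m. \<Sum>j<m. - sin (\<theta> * (real j - real p)))"
    by (intro sum.cong refl) (simp add: sin_minus[symmetric] del: sin_minus, simp add: algebra_simps)
  also have "\<dots> = - ?Q" by (simp add: sum_negf)
  finally show ?thesis by simp
qed

lemma odd_part_full: "odd_part k \<theta> k = 0"
  by (simp add: odd_part_def odd_part_square)

text \<open>The offsets with \<open>j < m\<close> cancel by antisymmetry. The remaining
  displacements have \<open>p < m \<le> j\<close>, hence point inward, and their angles stay within
  a half period.\<close>

lemma odd_part_nonneg:
  assumes m: "m \<le> k" and \<theta>: "0 \<le> \<theta>" "\<theta> * real k \<le> pi"
  shows "0 \<le> odd_part k \<theta> m"
proof -
  have split: "(\<Sum>j<k. f j) = (\<Sum>j<m. f j) + (\<Sum>j\<in>{m..<k}. f j)" for f :: "nat \<Rightarrow> real"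
    using m by (simp add: lessThan_atLeast0 sum.atLeastLessThan_concat)
  have "(\<Sum>p<m. \<Sum>j<k. sin (\<theta> * (real j - real p)))
     = (\<Sum>p<m. (\<Sum>j<m. sin (\<theta> * (real j - real p))) + (\<Sum>j\<in>{m..<k}. sin (\<theta> * (real j - real p))))"
    by (simp only: split)
  also have "\<dots> = (\<Sum>p<m. \<Sum>j\<in>{m..<k}. sin (\<theta> * (real j - real p)))"
    by (simp add: sum.distrib odd_part_square)
  also have "\<dots> \<ge> 0"
  proof (intro sum_nonneg sin_ge_zero)
    fix p j assume pj: "p \<in> {..<m}" "j \<in> {m..<k}"
    show "0 \<le> \<theta> * (real j - real p)" using pj \<theta> by auto
    have "\<theta> * (real j - real p) \<le> \<theta> * real k" using pj \<theta> by (intro mult_left_mono) auto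
    thus "\<theta> * (real j - real p) \<le> pi" using \<theta> by simp
  qed
  finally show ?thesis by (simp add: odd_part_def)
qed

text \<open>Missing blocks only remove nonnegative terms, and \<open>1 - cos t \<le> t^2 / 2\<close>
  loses nothing to leading order, so the rate in the lower bound is asymptotically exact.\<close>

lemma even_part_le:
  assumes m: "m \<le> k" and k: "0 < k"
  shows "even_part k \<theta> m \<le> \<theta>^2 * (real k * (real k ^ 2 - 1)) / 12"
proof -
  have "(\<Sum>p<m. \<Sum>j<k. 1 - cos (\<theta> * (real j - real p))) \<le> (\<Sum>p<k. \<Sum>j<k. 1 - cos (\<theta> * (real j - real p)))"
    by (rule sum_mono2) (use m in \<open>auto intro!: sum_nonneg\<close>)
  also have "\<dots> \<le> (\<Sum>p<k. \<Sum>j<k. \<theta>^2 / 2 * (real j - real p)^2)"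
  proof (intro sum_mono)
    fix p j show "1 - cos (\<theta> * (real j - real p)) \<le> \<theta>^2 / 2 * (real j - real p)^2"
      using one_minus_cos_le[of "\<theta> * (real j - real p)"] by (simp add: power_mult_distrib)
  qed
  also have "\<dots> = \<theta>^2 / 2 * (real k^2 * (real k ^ 2 - 1) / 6)"
    by (simp only: sum_distrib_left[symmetric] sum_sum_sq_diff)
  finally show ?thesis using k by (simp add: even_part_def field_simps power2_eq_square)
qed

text \<open>Each offset \<open>p\<close> contributes at least the minimal spread from
  \<open>sum_sq_diff\<close>, which makes the bound linear in \<open>m\<close>. The chord bound for
  the cosine costs a constant factor, harmless for the upper bound.\<close>

lemma even_part_ge:
  assumes m: "m \<le> k" and k: "0 < k" and \<theta>: "0 \<le> \<theta>" "\<theta> * real k \<le> pi"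
  shows "real m * (\<theta>^2 * (real k ^ 2 - 1) / (6 * pi^2)) \<le> even_part k \<theta> m"
proof -
  have "real m * (\<theta>^2 * (real k * (real k ^ 2 - 1)) / (6 * pi^2)) = (\<Sum>p<m. 2 * \<theta>^2 / pi^2 * (real k * (real k ^ 2 - 1) / 12))"
    by simp
  also have "\<dots> \<le> (\<Sum>p<m. 2 * \<theta>^2 / pi^2 * (\<Sum>j<k. (real j - real p)^2))"
    unfolding sum_sq_diff by (intro sum_mono mult_left_mono) auto
  also have "\<dots> \<le> (\<Sum>p<m. \<Sum>j<k. 1 - cos (\<theta> * (real j - real p)))"
    unfolding sum_distrib_left
  proof (intro sum_mono)
    fix p j assume pj: "p \<in> {..<m}" "j \<in> {..<k}"
    have "\<bar>\<theta> * (real j - real p)\<bar> = \<theta> * \<bar>real j - real p\<bar>" using \<theta> by (simp add: abs_mult)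
    also have "\<dots> \<le> \<theta> * real k" using pj m \<theta> by (intro mult_left_mono) auto
    finally have "\<bar>\<theta> * (real j - real p)\<bar> \<le> pi" using \<theta> by simp
    from one_minus_cos_ge[OF this] show "2 * \<theta>^2 / pi^2 * (real j - real p)^2 \<le> 1 - cos (\<theta> * (real j - real p))"
      by (simp add: power_mult_distrib)
  qed
  finally show ?thesis using k by (simp add: even_part_def field_simps)
qed

text \<open>With \<open>\<theta> = \<pi> / (N - 2 k)\<close> the crest of the sine sits at \<open>k + 1/2\<close>, beyond all positions \<open>x < k\<close> that
  lack some of their blocks; there the inward drift of the card can only raise the sine.\<close>
lemma sine_wave_subsolution:
  assumes k: "0 < k" "4 * k \<le> N" and x: "1 \<le> x" "2 * x \<le> N + 1"
    and \<theta>_def: "\<theta> = pi / (real N - 2 * real k)"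
  shows "0 \<le> card_gen N k (sine_wave N \<theta>) x + \<theta>^2 * (real k * (real k ^ 2 - 1)) / 12 * sine_wave N \<theta> x"
proof -
  define \<alpha> where "\<alpha> = \<theta> * ((real N + 1) / 2 - real x)"
  have pos: "real N - 2 * real k > 0" using k by linarith
  have \<theta>: "0 < \<theta>" using pos by (simp add: \<theta>_def)
  have \<alpha>0: "0 \<le> \<alpha>" unfolding \<alpha>_def using \<theta> x by (intro mult_nonneg_nonneg) auto
  have "\<alpha> \<le> \<theta> * (real N - 2 * real k)"
    unfolding \<alpha>_def using \<theta> x k by (intro mult_left_mono) (auto simp: field_simps)
  also have "\<dots> = pi" using pos by (simp add: \<theta>_def)
  finally have \<alpha>1: "\<alpha> \<le> pi" .
  have \<theta>k: "\<theta> * real k \<le> pi" using pos k by (simp add: \<theta>_def field_simps)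
  have s: "0 \<le> sin \<alpha>" using \<alpha>0 \<alpha>1 by (rule sin_ge_zero)
  have c: "cos \<alpha> * odd_part k \<theta> (min k x) \<le> 0"
  proof (cases "x < k")
    case True
    have "pi / 2 = \<theta> * ((real N - 2 * real k) / 2)" using pos by (simp add: \<theta>_def)
    also have "\<dots> \<le> \<alpha>" unfolding \<alpha>_def by (rule mult_left_mono) (use \<theta> True in \<open>simp_all add: field_simps\<close>)
    finally have "pi / 2 \<le> \<alpha>" .
    hence "0 \<le> sin (\<alpha> - pi / 2)"
      by (intro sin_ge_zero) (use \<alpha>1 pi_gt_zero in \<open>simp_all add: field_simps\<close>)
    hence "cos \<alpha> \<le> 0" by (simp add: sin_diff)
    moreover have "0 \<le> odd_part k \<theta> (min k x)" using \<theta> \<theta>k by (intro odd_part_nonneg) auto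
    ultimately show ?thesis by (simp add: mult_nonpos_nonneg)
  qed (simp add: odd_part_full)
  have "sin \<alpha> * even_part k \<theta> (min k x) \<le> sin \<alpha> * (\<theta>^2 * (real k * (real k ^ 2 - 1)) / 12)"
    using s k by (intro mult_left_mono even_part_le) auto
  moreover have "x \<le> N + 1 - k" using k x by linarith
  ultimately show ?thesis
    using c card_gen_sine_wave[OF x(1), of N k \<theta>] k
    by (simp add: \<alpha>_def[symmetric] sine_wave_def mult.commute)
qed

text \<open>A position \<open>x < k\<close> lies in only \<open>x\<close> blocks, so a decay at the bulk rate forces a
  correction of order \<open>1 / x\<close> there.\<close>
definition boundary_layer :: "nat \<Rightarrow> nat \<Rightarrow> real" where
  "boundary_layer k x = max 0 (1 / real x - 1 / real k)"

lemma boundary_layer_nonneg: "0 \<le> boundary_layer k x"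
  by (simp add: boundary_layer_def)

lemma boundary_layer_eq_0: "0 < k \<Longrightarrow> k \<le> x \<Longrightarrow> boundary_layer k x = 0"
  by (simp add: boundary_layer_def frac_le)

lemma boundary_layer_eq: "0 < x \<Longrightarrow> x \<le> k \<Longrightarrow> boundary_layer k x = 1 / real x - 1 / real k"
  by (simp add: boundary_layer_def frac_le)

text \<open>Summing over block starts instead of offsets, a position \<open>y < k\<close> is counted
  by at most \<open>y\<close> starts. Since \<open>y * (1 / y - 1 / k) = 1 - y / k\<close>, the
  total is at most \<open>(k - 1) / 2\<close>.\<close>

lemma boundary_layer_inflow:
  assumes k: "0 < k" and x: "1 \<le> x"
  shows "(\<Sum>p<min k x. \<Sum>j<k. boundary_layer k (x - p + j)) \<le> real k / 2"
proof -
  define G where "G = (\<lambda>i. \<Sum>y\<in>{i..<k}. boundary_layer k y)"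
  have blk: "(\<Sum>j<k. boundary_layer k (i + j)) = G i" for i
  proof -
    have "(\<Sum>j<k. boundary_layer k (i + j)) = (\<Sum>y\<in>{i..<i+k}. boundary_layer k y)"
      by (rule sum.reindex_bij_witness[where j = "\<lambda>j. i + j" and i = "\<lambda>y. y - i"]) auto
    also have "\<dots> = G i" unfolding G_def
      by (rule sum.mono_neutral_right) (use k in \<open>auto intro: boundary_layer_eq_0\<close>)
    finally show ?thesis .
  qed
  have Gnn: "0 \<le> G i" for i unfolding G_def by (intro sum_nonneg boundary_layer_nonneg)
  have "(\<Sum>p<min k x. \<Sum>j<k. boundary_layer k (x - p + j)) = (\<Sum>i\<in>{x - min k x <.. x}. G i)"
    unfolding blk by (rule sum.reindex_bij_witness[where j = "\<lambda>p. x - p" and i = "\<lambda>y. x - y"]) auto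
  \<comment> \<open>Enlarging to all starts below \<open>k\<close> makes the bound independent of
    \<open>x\<close>; starts from \<open>k\<close> on see no layer and are dropped next.\<close>
  also have "\<dots> \<le> (\<Sum>i\<in>{1..<k} \<union> {x - min k x <.. x}. G i)"
    by (rule sum_mono2) (use Gnn in auto)
  also have "\<dots> = (\<Sum>i\<in>{1..<k}. G i)"
    by (rule sum.mono_neutral_right) (auto simp: G_def)
  also have "\<dots> = (\<Sum>i\<in>{1..<k}. \<Sum>y\<in>{1..<k}. if i \<le> y then boundary_layer k y else 0)"
    unfolding G_def by (intro sum.cong refl sum.mono_neutral_cong_left) auto
  also have "\<dots> = (\<Sum>y\<in>{1..<k}. \<Sum>i\<in>{1..<k}. if i \<le> y then boundary_layer k y else 0)"
    by (rule sum.swap)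
  also have "\<dots> = (\<Sum>y\<in>{1..<k}. real y * boundary_layer k y)"
  proof (rule sum.cong[OF refl])
    fix y assume y: "y \<in> {1..<k}"
    have "(\<Sum>i\<in>{1..<k}. if i \<le> y then boundary_layer k y else 0) = (\<Sum>i\<in>{1..y}. boundary_layer k y)"
      by (rule sum.mono_neutral_cong_right) (use y in auto)
    thus "(\<Sum>i\<in>{1..<k}. if i \<le> y then boundary_layer k y else 0) = real y * boundary_layer k y" by simp
  qed
  also have "\<dots> = (\<Sum>y\<in>{1..<k}. 1 - real y / real k)"
    by (rule sum.cong) (auto simp: boundary_layer_eq right_diff_distrib)
  also have "\<dots> = real (k - 1) - (\<Sum>y\<in>{1..<k}. real y) / real k"
    by (simp add: sum_subtractf sum_divide_distrib)
  also have "(\<Sum>y\<in>{1..<k}. real y) = (\<Sum>y<k. real y)"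
    by (rule sum.mono_neutral_left) auto
  also have "real (k - 1) - (\<Sum>y<k. real y) / real k = (real k - 1) / 2"
    unfolding sum_lessThan_real using k by (simp add: of_nat_diff field_simps)
  finally show ?thesis by simp
qed

text \<open>The layer is antisymmetrized so that the corrected wave remains odd; on the left half
  its mirror term vanishes as soon as \<open>4 * k \<le> N\<close>.\<close>

definition super_wave :: "nat \<Rightarrow> nat \<Rightarrow> real \<Rightarrow> nat \<Rightarrow> real" where
  "super_wave N k \<epsilon> x = sine_wave N (pi / real N) x
     + \<epsilon> * (boundary_layer k x - boundary_layer k (N + 1 - x))"

lemma odd_super_wave: "odd_fun N (super_wave N k \<epsilon>)"
  using odd_sine_wave[of N "pi / real N"] by (auto simp: odd_fun_def super_wave_def algebra_simps)

lemma super_wave_left: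
  assumes "0 < k" "4 * k \<le> N" "1 \<le> x" "2 * x \<le> N + 1"
  shows "super_wave N k \<epsilon> x = sine_wave N (pi / real N) x + \<epsilon> * boundary_layer k x"
  using assms by (simp add: super_wave_def boundary_layer_eq_0)

lemma sine_wave_nonneg:
  assumes "1 \<le> x" "2 * x \<le> N + 1"
  shows "0 \<le> sine_wave N (pi / real N) x"
proof -
  have N: "0 < real N" using assms by linarith
  have p0: "0 \<le> pi / real N" by simp
  have xr: "1 \<le> real x" "2 * real x \<le> real N + 1" using assms by linarith+
  have "pi / real N * ((real N + 1) / 2 - real x) \<le> pi / real N * real N"
    by (rule mult_left_mono[OF _ p0]) (use xr in \<open>simp add: field_simps\<close>)
  also have "\<dots> = pi" using N by simp
  finally show ?thesis unfolding sine_wave_def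
    by (intro sin_ge_zero mult_nonneg_nonneg[OF p0]) (use xr in \<open>simp add: field_simps\<close>)+
qed

lemma sine_wave_ge_half:
  assumes "1 \<le> x" "4 * x \<le> N"
  shows "1 / 2 \<le> sine_wave N (pi / real N) x"
proof -
  have N: "0 < real N" using assms by linarith
  have p0: "0 \<le> pi / real N" by simp
  have r1: "1 \<le> real x" using assms by linarith
  have r: "4 * real x \<le> real N" using assms(2) by linarith
  have a: "pi / 6 = pi / real N * (real N / 6)" using N by simp
  have "pi / real N * (real N / 6) \<le> pi / real N * ((real N + 1) / 2 - real x)"
    by (rule mult_left_mono[OF _ p0]) (use r in \<open>simp add: field_simps\<close>)
  moreover have "pi / real N * ((real N + 1) / 2 - real x) \<le> pi / real N * (real N / 2)"
    by (rule mult_left_mono[OF _ p0]) (use r1 in \<open>simp add: field_simps\<close>)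
  moreover have "pi / real N * (real N / 2) = pi / 2" using N by simp
  ultimately have "sin (pi / 6) \<le> sin (pi / real N * ((real N + 1) / 2 - real x))"
    unfolding a[symmetric] using pi_gt_zero by (intro sin_monotone_2pi_le) linarith+
  thus ?thesis by (simp add: sine_wave_def sin_30)
qed

text \<open>At frequency \<open>pi / N\<close> the phase stays in \<open>{0..pi/2}\<close> on the
  left half, so the cosine is nonnegative and the inward drift only lowers the generator. The price
  is a rate proportional to \<open>min k x\<close>, too weak near the end.\<close>

lemma sine_wave_supersolution:
  assumes k: "0 < k" "4 * k \<le> N" and x: "1 \<le> x" "2 * x \<le> N + 1"
  shows "card_gen N k (sine_wave N (pi / real N)) x
    \<le> - ((real k ^ 2 - 1) / (6 * real N ^ 2)) * real (min k x) * sine_wave N (pi / real N) x"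
proof -
  define \<theta> where "\<theta> = pi / real N"
  define \<alpha> where "\<alpha> = \<theta> * ((real N + 1) / 2 - real x)"
  have N: "0 < real N" using k by linarith
  have xr: "1 \<le> real x" "2 * real x \<le> real N + 1" using x by linarith+
  have \<theta>: "0 < \<theta>" "\<theta> * real k \<le> pi" using N k by (auto simp: \<theta>_def field_simps)
  have "0 \<le> \<alpha>" unfolding \<alpha>_def
    by (rule mult_nonneg_nonneg) (use \<theta>(1) xr in \<open>simp_all add: field_simps\<close>)
  have "\<alpha> \<le> \<theta> * (real N / 2)" unfolding \<alpha>_def
    by (rule mult_left_mono) (use \<theta>(1) xr in \<open>simp_all add: field_simps\<close>)
  also have "\<dots> = pi / 2" using N by (simp add: \<theta>_def)
  finally have "\<alpha> \<le> pi / 2" .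
  with \<open>0 \<le> \<alpha>\<close> have s: "0 \<le> sin \<alpha>" and c: "0 \<le> cos \<alpha>"
    by (auto intro!: sin_ge_zero cos_ge_zero)
  have "sin \<alpha> * (real (min k x) * (\<theta>^2 * (real k ^ 2 - 1) / (6 * pi^2))) \<le> sin \<alpha> * even_part k \<theta> (min k x)"
    using s k \<theta> by (intro mult_left_mono even_part_ge) auto
  moreover have "\<theta>^2 * (real k ^ 2 - 1) / (6 * pi^2) = (real k ^ 2 - 1) / (6 * real N ^ 2)"
    using N by (simp add: \<theta>_def power_divide)
  moreover have "0 \<le> cos \<alpha> * odd_part k \<theta> (min k x)"
    using c \<theta> by (intro mult_nonneg_nonneg odd_part_nonneg) auto
  moreover have "x \<le> N + 1 - k" using k x by linarith
  ultimately show ?thesis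
    using card_gen_sine_wave[OF x(1), of N k \<theta>] k
    by (simp add: \<alpha>_def[symmetric] \<theta>_def[symmetric] sine_wave_def mult_ac)
qed

lemma card_gen_add: "card_gen N k (\<lambda>x. u x + v x) x = card_gen N k u x + card_gen N k v x"
  unfolding card_gen_def sum.distrib[symmetric]
  by (rule sum.cong) (auto simp: block_avg_def sum.distrib add_divide_distrib)

text \<open>In terms of \<open>c\<close> the bulk rate of the sine is \<open>4 * c\<close>, while
  only \<open>c / 4\<close> is claimed; the slack pays for the correction. For \<open>x < k\<close>
  and \<open>q = x / k\<close> the sine gives at most \<open>- 2 * c * q\<close>, the outflow from
  the layer \<open>- c * (1 - q)\<close>, its inflow at most \<open>c / 2\<close> and the rate term
  at most \<open>c / 2\<close>: in total at most \<open>- c * q\<close>. For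
  \<open>k \<le> x < 2 * k\<close> the sine, at least 1/2, beats the inflow; from
  \<open>2 * k\<close> on no block through \<open>x\<close> reaches the layer.\<close>

lemma super_wave_supersolution:
  assumes k: "2 \<le> k" "8 * k \<le> N" "k ^ 3 \<le> N ^ 2" and x: "1 \<le> x" "2 * x \<le> N + 1"
  shows "card_gen N k (super_wave N k (real k * (real k ^ 2 - 1) / (24 * real N ^ 2))) x
    + real k * (real k ^ 2 - 1) / (96 * real N ^ 2) * super_wave N k (real k * (real k ^ 2 - 1) / (24 * real N ^ 2)) x \<le> 0"
proof -
  define c where "c = real k * (real k ^ 2 - 1) / (24 * real N ^ 2)"
  define F where "F = (\<lambda>x. c * (boundary_layer k x - boundary_layer k (N + 1 - x)))"
  define s where "s = sine_wave N (pi / real N) x"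
  have N: "0 < real N" using k by linarith
  have k0: "0 < k" and k4: "4 * k \<le> N" using k by auto
  have "1 \<le> real k ^ 2" using k by simp
  hence c0: "0 \<le> c" unfolding c_def by simp
  have "real k * (real k ^ 2 - 1) \<le> real (k ^ 3)" by (simp add: power3_eq_cube power2_eq_square algebra_simps)
  also have "\<dots> \<le> real (N ^ 2)" using k(3) by (rule of_nat_mono)
  finally have c1: "c \<le> 1 / 24" using N unfolding c_def by (simp add: field_simps)
  have s0: "0 \<le> s" unfolding s_def by (rule sine_wave_nonneg[OF x])
  have s1: "s \<le> 1" unfolding s_def sine_wave_def by simp
  have W: "super_wave N k c x = s + c * boundary_layer k x"
    using super_wave_left[OF k0 k4 x] by (simp add: s_def)
  have Fx: "F x = c * boundary_layer k x" using k4 x k0 by (simp add: F_def boundary_layer_eq_0)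
  have xr: "x \<le> N + 1 - k" using k x by linarith
  have Fle: "F y \<le> c * boundary_layer k y" for y
    unfolding F_def using c0 boundary_layer_nonneg[of k "N+1-y"] by (intro mult_left_mono) auto
  have gF: "card_gen N k F x \<le> c * (\<Sum>p<min k x. \<Sum>j<k. boundary_layer k (x - p + j)) / real k - real (min k x) * F x"
  proof -
    have "(\<Sum>p<min k x. \<Sum>j<k. F (x - p + j) - F x) \<le> (\<Sum>p<min k x. \<Sum>j<k. c * boundary_layer k (x - p + j) - F x)"
      by (intro sum_mono diff_right_mono Fle)
    also have "\<dots> = c * (\<Sum>p<min k x. \<Sum>j<k. boundary_layer k (x - p + j)) - real (min k x) * (real k * F x)"
      by (simp add: sum_subtractf sum_distrib_left)
    finally show ?thesis unfolding card_gen_offsets[OF x(1) xr k0] using k0 by (simp add: field_simps)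
  qed
  have infl: "c * (\<Sum>p<min k x. \<Sum>j<k. boundary_layer k (x - p + j)) / real k \<le> c / 2"
    using mult_left_mono[OF boundary_layer_inflow[OF k0 x(1)] c0] k0 by (simp add: field_simps)
  have \<kappa>: "(real k ^ 2 - 1) / (6 * real N ^ 2) = 4 * c / real k"
    using N k0 by (simp add: c_def field_simps)
  have gs: "card_gen N k (sine_wave N (pi / real N)) x \<le> - (4 * c / real k) * real (min k x) * s"
    using sine_wave_supersolution[OF k0 k4 x] unfolding \<kappa> s_def .
  have "card_gen N k (super_wave N k c) x = card_gen N k (sine_wave N (pi / real N)) x + card_gen N k F x"
    unfolding card_gen_add[symmetric] F_def super_wave_def ..
  also have "\<dots> + c / 4 * super_wave N k c x \<le> 0"
  proof -
    consider "x < k" | "k \<le> x" "x < 2 * k" | "2 * k \<le> x" by linarith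
    thus ?thesis
    proof cases
      case 1
      define q where "q = real x / real k"
      have q: "0 < q" "q \<le> 1" using 1 x by (auto simp: q_def)
      have h: "1 / 2 \<le> s" unfolding s_def by (rule sine_wave_ge_half) (use 1 x k in auto)
      have bl: "boundary_layer k x = 1 / real x - 1 / real k" using 1 x by (simp add: boundary_layer_eq)
      have "boundary_layer k x \<le> 1" 
      proof -
        have "1 / real x \<le> 1" using x by simp
        thus ?thesis unfolding bl using zero_le_divide_1_iff[of "real k"] by linarith
      qed
      hence "c * boundary_layer k x \<le> 1/24 * 1" using c0 c1 boundary_layer_nonneg by (intro mult_mono) auto
      hence "super_wave N k c x \<le> 2" unfolding W using s1 by simp
      hence A: "c / 4 * super_wave N k c x \<le> c / 2" using mult_left_mono[of "super_wave N k c x" 2 "c/4"] c0 by simp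
      have B: "real (min k x) * F x = c * (1 - q)" unfolding Fx bl using 1 x by (simp add: q_def field_simps)
      have C: "(4 * c / real k) * real (min k x) * s = 4 * c * q * s" using 1 by (simp add: q_def)
      have D: "4 * c * q * (1/2) \<le> 4 * c * q * s" using h c0 q by (intro mult_left_mono) auto
      have "- (4 * c * q * s) + c / 2 - c * (1 - q) + c / 2 \<le> - c * q"
        using D by (simp add: algebra_simps)
      also have "\<dots> \<le> 0" using c0 q by simp
      finally show ?thesis using gs gF infl A unfolding B mult_minus_left C by linarith
    next
      case 2
      have h: "1 / 2 \<le> s" unfolding s_def by (rule sine_wave_ge_half) (use 2 x k in auto)
      have z: "boundary_layer k x = 0" using 2 k0 by (simp add: boundary_layer_eq_0)
      have "c * (1 / 2) \<le> c * s" using h c0 by (intro mult_left_mono) auto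
      thus ?thesis using gs gF infl 2 k0 c0 mult_nonneg_nonneg[OF c0 s0] unfolding W Fx z by simp
    next
      case 3
      have z: "boundary_layer k x = 0" using 3 k0 by (simp add: boundary_layer_eq_0)
      have "boundary_layer k (x - p + j) = 0" if "p < min k x" for p j
        by (rule boundary_layer_eq_0) (use k0 3 that in auto)
      hence "(\<Sum>p<min k x. \<Sum>j<k. boundary_layer k (x - p + j)) = 0" by simp
      thus ?thesis using gs gF 3 k0 c0 mult_nonneg_nonneg[OF c0 s0] unfolding W Fx z by simp
    qed
  qed
  also have "c / 4 = real k * (real k ^ 2 - 1) / (96 * real N ^ 2)" by (simp add: c_def)
  finally show ?thesis unfolding c_def .
qed

section \<open>Contraction of the deck chain\<close>

lemma decks_permutes: "\<eta> \<in> decks N \<longleftrightarrow> \<eta> permutes {1..N}"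
  by (simp add: decks_def)

lemma finite_decks: "finite (decks N)"
  unfolding decks_def by (rule finite_permutations) simp

lemma card_decks: "card (decks N) = fact N"
  unfolding decks_def by (rule card_permutations) auto

lemma block_permutes:
  fixes i :: nat
  assumes "\<tau> permutes {i..<i+k}" "i \<in> {1..N+1-k}"
  shows "\<tau> permutes {1..N}"
  using assms(1) block_subset[OF assms(2)] by (rule permutes_subset)

lemma decks_compose:
  assumes "\<eta> \<in> decks N" "\<tau> permutes {1..N}"
  shows "\<eta> \<circ> \<tau> \<in> decks N"
  using permutes_compose[OF assms(2)] assms(1) by (simp add: decks_permutes)

text \<open>\<open>inv \<eta> c\<close> is the position of card \<open>c\<close>, so this compares
  the positions of equal cards on the scale \<open>H\<close>.\<close>

definition label_dist :: "nat \<Rightarrow> (nat \<Rightarrow> real) \<Rightarrow> (nat \<Rightarrow> nat) \<Rightarrow> (nat \<Rightarrow> nat) \<Rightarrow> real" where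
  "label_dist N H \<eta> \<eta>' = (\<Sum>c\<in>{1..N}. \<bar>H (inv \<eta> c) - H (inv \<eta>' c)\<bar>)"

text \<open>\<open>f m\<close> is the position in \<open>\<eta>'\<close> of the card at
  \<open>m\<close> in \<open>\<eta>\<close>. On the positions \<open>P\<close> whose card lies in
  \<open>B\<close> in both decks \<open>\<pi>\<close> must be \<open>f\<close>; the rest of
  \<open>B\<close> is completed by an arbitrary bijection, the cardinalities being equal.\<close>

lemma matching_permutation:
  assumes \<eta>: "bij \<eta>" and \<eta>': "bij \<eta>'" and B: "finite B"
  obtains \<pi> where "\<pi> permutes B"
    "\<And>c. inv \<eta> c \<in> B \<Longrightarrow> inv \<eta>' c \<in> B \<Longrightarrow> inv (\<eta>' \<circ> \<pi>) c = inv \<eta> c"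
proof -
  define f where "f = (\<lambda>m. inv \<eta>' (\<eta> m))"
  define P where "P = {m\<in>B. f m \<in> B}"
  have "bij (inv \<eta>' \<circ> \<eta>)" by (rule bij_comp[OF \<eta> bij_imp_bij_inv[OF \<eta>']])
  hence inj: "inj f" by (simp add: f_def o_def bij_is_inj)
  have fP: "f ` P \<subseteq> B" "P \<subseteq> B" by (auto simp: P_def)
  have "card (f ` P) = card P" by (rule card_image) (use inj in \<open>auto intro: inj_on_subset\<close>)
  hence "card (B - P) = card (B - f ` P)"
    using fP B by (simp add: card_Diff_subset finite_subset)
  then obtain g where g: "bij_betw g (B - P) (B - f ` P)"
    using B finite_same_card_bij[of "B - P" "B - f ` P"] by auto
  define \<pi> where "\<pi> = (\<lambda>m. if m \<in> P then f m else if m \<in> B then g m else m)"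
  have "bij_betw \<pi> (P \<union> (B - P)) (f ` P \<union> (B - f ` P))"
  proof (rule bij_betw_combine)
    have "bij_betw f P (f ` P)" using inj by (auto simp: bij_betw_def intro: inj_on_subset)
    thus "bij_betw \<pi> P (f ` P)" by (subst bij_betw_cong[of _ _ f]) (auto simp: \<pi>_def)
    show "bij_betw \<pi> (B - P) (B - f ` P)"
      using g by (subst bij_betw_cong[of _ _ g]) (auto simp: \<pi>_def)
  qed auto
  hence "bij_betw \<pi> B B" using fP by (simp add: Un_absorb1)
  hence perm: "\<pi> permutes B" by (rule bij_imp_permutes) (use fP in \<open>auto simp: \<pi>_def\<close>)
  moreover have "inv (\<eta>' \<circ> \<pi>) c = inv \<eta> c" if "inv \<eta> c \<in> B" "inv \<eta>' c \<in> B" for c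
  proof (rule inv_f_eq)
    show "inj (\<eta>' \<circ> \<pi>)" using \<eta>' permutes_bij[OF perm] by (simp add: bij_is_inj inj_compose)
    have "\<eta> (inv \<eta> c) = c" "\<eta>' (inv \<eta>' c) = c" using \<eta> \<eta>' by (simp_all add: bij_is_surj surj_f_inv_f)
    thus "(\<eta>' \<circ> \<pi>) (inv \<eta> c) = c" using that by (simp add: \<pi>_def P_def f_def)
  qed
  ultimately show thesis by (rule that)
qed

text \<open>A point outside the block lies on one side of it, so by monotonicity all differences
  have one sign and the absolute value commutes with the mean.\<close>

lemma abs_block_avg_outside:
  assumes H: "decr N H" and i: "i \<in> {1..N+1-k}" and k: "0 < k" and y: "y \<in> {1..N}" "y \<notin> {i..<i+k}"
  shows "(\<Sum>w\<in>{i..<i+k}. \<bar>H w - H y\<bar>) / real k = \<bar>(\<Sum>w\<in>{i..<i+k}. H w) / real k - H y\<bar>"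
proof -
  have sub: "{i..<i+k} \<subseteq> {1..N}" using block_subset[OF i] .
  have eq: "(\<Sum>w\<in>{i..<i+k}. H w) / real k - H y = (\<Sum>w\<in>{i..<i+k}. H w - H y) / real k"
    using k by (simp add: sum_subtractf diff_divide_distrib)
  consider "y < i" | "i + k \<le> y" using y by fastforce
  thus ?thesis
  proof cases
    case 1
    have le: "H w - H y \<le> 0" if "w \<in> {i..<i+k}" for w
      using decrD[OF H, of y w] 1 y sub that by auto
    have "(\<Sum>w\<in>{i..<i+k}. \<bar>H w - H y\<bar>) = - (\<Sum>w\<in>{i..<i+k}. H w - H y)"
      unfolding sum_negf[symmetric] by (rule sum.cong) (use le in auto)
    moreover have "(\<Sum>w\<in>{i..<i+k}. H w - H y) \<le> 0" by (rule sum_nonpos[OF le])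
    ultimately show ?thesis unfolding eq by (simp only: abs_divide) simp
  next
    case 2
    have le: "0 \<le> H w - H y" if "w \<in> {i..<i+k}" for w
      using decrD[OF H, of w y] 2 y sub that by auto
    have "(\<Sum>w\<in>{i..<i+k}. \<bar>H w - H y\<bar>) = (\<Sum>w\<in>{i..<i+k}. H w - H y)"
      by (rule sum.cong) (use le in auto)
    moreover have "0 \<le> (\<Sum>w\<in>{i..<i+k}. H w - H y)" by (rule sum_nonneg[OF le])
    ultimately show ?thesis unfolding eq by (simp only: abs_divide)
  qed
qed

text \<open>A card in the block in both decks is brought to one common position and contributes 0. A
  card in it in just one deck becomes uniform there, against a fixed position outside.\<close>

lemma mean_abs_diff_le:
  assumes H: "decr N H" and i: "i \<in> {1..N+1-k}" and k: "0 < k"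
    and xy: "x \<in> {1..N}" "y \<in> {1..N}" and \<pi>: "\<pi> permutes {i..<i+k}"
    and match: "x \<in> {i..<i+k} \<Longrightarrow> y \<in> {i..<i+k} \<Longrightarrow> \<pi> y = x"
  shows "(\<Sum>\<tau> | \<tau> permutes {i..<i+k}. \<bar>H (\<tau> x) - H (\<tau> (\<pi> y))\<bar>) / fact k
     \<le> \<bar>block_avg k i H x - block_avg k i H y\<bar>"
proof -
  let ?B = "{i..<i+k}" and ?T = "{\<tau>. \<tau> permutes {i..<i+k}}"
  have cT: "card ?T = fact k" using card_permutations[of ?B k] by simp
  have out: "\<tau> z = z" if "\<tau> \<in> ?T" "z \<notin> ?B" for \<tau> z
    by (rule permutes_not_in[of \<tau> ?B]) (use that in simp_all)
  have \<pi>out: "\<pi> y = y" if "y \<notin> ?B" by (rule permutes_not_in[OF \<pi> that])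
  have pt: "(\<Sum>\<tau>\<in>?T. g (\<tau> m)) / fact k = (\<Sum>w\<in>?B. g w) / real k" if "m \<in> ?B" for g :: "nat \<Rightarrow> real" and m
    using sum_permutes_point[of ?B m g] that by simp
  have in_block: "block_avg k i H z = (\<Sum>w\<in>?B. H w) / real k" if "z \<in> ?B" for z
    using that by (simp only: block_avg_def if_True)
  have outside: "block_avg k i H z = H z" if "z \<notin> ?B" for z
    using that by (simp only: block_avg_def if_False)
  consider "x \<in> ?B" "y \<in> ?B" | "x \<in> ?B" "y \<notin> ?B" | "x \<notin> ?B" "y \<in> ?B" | "x \<notin> ?B" "y \<notin> ?B" by blast
  thus ?thesis
  proof cases
    case 1
    thus ?thesis using match by simp
  next
    case 2
    have "(\<Sum>\<tau>\<in>?T. \<bar>H (\<tau> x) - H (\<tau> (\<pi> y))\<bar>) = (\<Sum>\<tau>\<in>?T. \<bar>H (\<tau> x) - H y\<bar>)"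
      by (intro sum.cong refl) (simp only: \<pi>out[OF 2(2)] out[OF _ 2(2)])
    thus ?thesis
      by (simp only: pt[OF 2(1), of "\<lambda>w. \<bar>H w - H y\<bar>"] abs_block_avg_outside[OF H i k xy(2) 2(2)]
          in_block[OF 2(1)] outside[OF 2(2)] order.refl)
  next
    case 3
    have z: "\<pi> y \<in> ?B" using 3 by (simp only: permutes_in_image[OF \<pi>])
    have "(\<Sum>\<tau>\<in>?T. \<bar>H (\<tau> x) - H (\<tau> (\<pi> y))\<bar>) = (\<Sum>\<tau>\<in>?T. \<bar>H (\<tau> (\<pi> y)) - H x\<bar>)"
      by (intro sum.cong refl) (simp only: out[OF _ 3(1)] abs_minus_commute)
    thus ?thesis
      by (simp only: pt[OF z, of "\<lambda>w. \<bar>H w - H x\<bar>"] abs_block_avg_outside[OF H i k xy(1) 3(1)]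
          in_block[OF 3(2)] outside[OF 3(1)] abs_minus_commute[of "H x"] order.refl)
  next
    case 4
    have "(\<Sum>\<tau>\<in>?T. \<bar>H (\<tau> x) - H (\<tau> (\<pi> y))\<bar>) = (\<Sum>\<tau>\<in>?T. \<bar>H x - H y\<bar>)"
      by (intro sum.cong refl) (simp only: \<pi>out[OF 4(2)] out[OF _ 4(1)] out[OF _ 4(2)])
    thus ?thesis by (simp add: outside[OF 4(1)] outside[OF 4(2)] cT)
  qed
qed

lemma block_mix_lipschitz:
  assumes H: "decr N H" and i: "i \<in> {1..N+1-k}" and k: "0 < k"
    and f: "\<And>\<eta> \<eta>'. \<eta> \<in> decks N \<Longrightarrow> \<eta>' \<in> decks N \<Longrightarrow> \<bar>f \<eta> - f \<eta>'\<bar> \<le> label_dist N H \<eta> \<eta>'"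
    and \<eta>: "\<eta> \<in> decks N" "\<eta>' \<in> decks N"
  shows "\<bar>block_mix k i f \<eta> - block_mix k i f \<eta>'\<bar> \<le> label_dist N (block_avg k i H) \<eta> \<eta>'"
proof -
  let ?B = "{i..<i+k}" and ?T = "{\<tau>. \<tau> permutes {i..<i+k}}"
  have p: "\<eta> permutes {1..N}" "\<eta>' permutes {1..N}" using \<eta> by (auto simp: decks_permutes)
  have b: "bij \<eta>" "bij \<eta>'" using p permutes_bij by auto
  obtain \<pi> where \<pi>: "\<pi> permutes ?B"
    and match: "\<And>c. inv \<eta> c \<in> ?B \<Longrightarrow> inv \<eta>' c \<in> ?B \<Longrightarrow> inv (\<eta>' \<circ> \<pi>) c = inv \<eta> c"
    using matching_permutation[OF b, of ?B] by auto
  have ivp: "inv (\<eta>' \<circ> \<pi>) c = inv \<pi> (inv \<eta>' c)" for c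
    using o_inv_distrib[OF b(2) permutes_bij[OF \<pi>]] by simp
  \<comment> \<open>This is the coupling: reindexing by \<open>\<pi>\<close> leaves the second
    average unchanged but lets both decks use the same \<open>\<tau>\<close> after the common cards
    have been aligned.\<close>
  have re: "(\<Sum>\<tau>\<in>?T. f (\<eta>' \<circ> \<tau>)) = (\<Sum>\<tau>\<in>?T. f (\<eta>' \<circ> (\<pi> \<circ> \<tau>)))"
    by (rule setum_permutations_compose_left[OF \<pi>])
  have lip: "\<bar>f (\<eta> \<circ> \<tau>) - f (\<eta>' \<circ> (\<pi> \<circ> \<tau>))\<bar>
      \<le> (\<Sum>c\<in>{1..N}. \<bar>H (inv \<tau> (inv \<eta> c)) - H (inv \<tau> (inv \<pi> (inv \<eta>' c)))\<bar>)" if "\<tau> \<in> ?T" for \<tau>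
  proof -
    have t: "\<tau> permutes ?B" using that by simp
    have pt: "\<pi> \<circ> \<tau> permutes ?B" by (rule permutes_compose[OF t \<pi>])
    have "inv (\<eta> \<circ> \<tau>) c = inv \<tau> (inv \<eta> c)" for c
      using o_inv_distrib[OF b(1) permutes_bij[OF t]] by simp
    moreover have "inv (\<eta>' \<circ> (\<pi> \<circ> \<tau>)) c = inv \<tau> (inv \<pi> (inv \<eta>' c))" for c
      using o_inv_distrib[OF b(2) permutes_bij[OF pt]] o_inv_distrib[OF permutes_bij[OF \<pi>] permutes_bij[OF t]] by simp
    ultimately show ?thesis
      using f[OF decks_compose[OF \<eta>(1) block_permutes[OF t i]] decks_compose[OF \<eta>(2) block_permutes[OF pt i]]]
      by (simp only: label_dist_def)
  qed
  have "\<bar>block_mix k i f \<eta> - block_mix k i f \<eta>'\<bar> = \<bar>\<Sum>\<tau>\<in>?T. f (\<eta> \<circ> \<tau>) - f (\<eta>' \<circ> (\<pi> \<circ> \<tau>))\<bar> / fact k"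
    unfolding block_mix_def re sum_subtractf by (simp add: diff_divide_distrib[symmetric])
  also have "\<dots> \<le> (\<Sum>\<tau>\<in>?T. \<Sum>c\<in>{1..N}. \<bar>H (inv \<tau> (inv \<eta> c)) - H (inv \<tau> (inv \<pi> (inv \<eta>' c)))\<bar>) / fact k"
    by (intro divide_right_mono order_trans[OF sum_abs] sum_mono lip) auto
  also have "\<dots> = (\<Sum>c\<in>{1..N}. (\<Sum>\<tau>\<in>?T. \<bar>H (inv \<tau> (inv \<eta> c)) - H (inv \<tau> (inv \<pi> (inv \<eta>' c)))\<bar>) / fact k)"
    by (subst sum.swap) (simp add: sum_divide_distrib)
  also have "\<dots> \<le> label_dist N (block_avg k i H) \<eta> \<eta>'"
    unfolding label_dist_def
  proof (rule sum_mono)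
    fix c assume c: "c \<in> {1..N}"
    have m: "inv \<eta> c \<in> {1..N}" "inv \<eta>' c \<in> {1..N}"
      using c permutes_in_image[OF permutes_inv[OF p(1)]] permutes_in_image[OF permutes_inv[OF p(2)]] by auto
    \<comment> \<open>Positions of cards move by \<open>inv \<tau>\<close>, which is as uniform as
      \<open>\<tau>\<close>.\<close>
    have "(\<Sum>\<tau>\<in>?T. \<bar>H (inv \<tau> (inv \<eta> c)) - H (inv \<tau> (inv \<pi> (inv \<eta>' c)))\<bar>)
       = (\<Sum>\<tau>\<in>?T. \<bar>H (\<tau> (inv \<eta> c)) - H (\<tau> (inv \<pi> (inv \<eta>' c)))\<bar>)"
      by (rule sum_permutations_inverse[symmetric])
    also have "\<dots> / fact k \<le> \<bar>block_avg k i H (inv \<eta> c) - block_avg k i H (inv \<eta>' c)\<bar>"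
      by (rule mean_abs_diff_le[OF H i k m permutes_inv[OF \<pi>]]) (use match[of c] ivp[of c] in simp)
    finally show "(\<Sum>\<tau>\<in>?T. \<bar>H (inv \<tau> (inv \<eta> c)) - H (inv \<tau> (inv \<pi> (inv \<eta>' c)))\<bar>) / fact k
      \<le> \<bar>block_avg k i H (inv \<eta> c) - block_avg k i H (inv \<eta>' c)\<bar>" .
  qed
  finally show ?thesis .
qed

text \<open>Every \<open>block_avg k i H\<close> is again decreasing, so the differences have the
  same sign for all \<open>i\<close> and averaging over the blocks loses nothing.\<close>

lemma sum_abs_block_avg_diff:
  assumes H: "decr N H" and k: "0 < k" and xy: "x \<in> {1..N}" "y \<in> {1..N}"
  shows "(\<Sum>i\<in>{1..N+1-k}. \<bar>block_avg k i H x - block_avg k i H y\<bar>) / real (N+1-k)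
    = \<bar>card_step N k H x - card_step N k H y\<bar>"
proof -
  have main: "(\<Sum>i\<in>{1..N+1-k}. \<bar>block_avg k i H x - block_avg k i H y\<bar>) / real (N+1-k)
    = \<bar>card_step N k H x - card_step N k H y\<bar>" if "x \<le> y" "x \<in> {1..N}" "y \<in> {1..N}" for x y
  proof -
    have "(\<Sum>i\<in>{1..N+1-k}. \<bar>block_avg k i H x - block_avg k i H y\<bar>) = (\<Sum>i\<in>{1..N+1-k}. block_avg k i H x - block_avg k i H y)"
      by (rule sum.cong[OF refl]) (use decrD[OF decr_block_avg[OF H _ k], of _ x y] that in auto)
    moreover have "card_step N k H y \<le> card_step N k H x"
      using decrD[OF decr_card_step[OF H k], of x y] that by auto
    ultimately show ?thesis
      by (simp add: card_step_def sum_subtractf diff_divide_distrib)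
  qed
  show ?thesis
  proof (cases "x \<le> y")
    case False
    then show ?thesis using main[of y x] xy by (simp add: abs_minus_commute)
  qed (use main xy in auto)
qed

text \<open>The coupling is used in dual form: a step turns Lipschitz functions for the scale
  \<open>H\<close> into Lipschitz functions for the scale \<open>card_step N k H\<close>, so
  iteration only involves the one-card operator.\<close>

lemma deck_step_lipschitz:
  assumes H: "decr N H" and k: "0 < k"
    and f: "\<And>\<eta> \<eta>'. \<eta> \<in> decks N \<Longrightarrow> \<eta>' \<in> decks N \<Longrightarrow> \<bar>f \<eta> - f \<eta>'\<bar> \<le> label_dist N H \<eta> \<eta>'"
    and \<eta>: "\<eta> \<in> decks N" "\<eta>' \<in> decks N"
  shows "\<bar>deck_step N k f \<eta> - deck_step N k f \<eta>'\<bar> \<le> label_dist N (card_step N k H) \<eta> \<eta>'"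
proof -
  have p: "\<eta> permutes {1..N}" "\<eta>' permutes {1..N}" using \<eta> by (auto simp: decks_permutes)
  have "\<bar>deck_step N k f \<eta> - deck_step N k f \<eta>'\<bar>
     = \<bar>\<Sum>i\<in>{1..N+1-k}. block_mix k i f \<eta> - block_mix k i f \<eta>'\<bar> / real (N+1-k)"
    by (simp add: deck_step_def diff_divide_distrib[symmetric] sum_subtractf)
  also have "\<dots> \<le> (\<Sum>i\<in>{1..N+1-k}. label_dist N (block_avg k i H) \<eta> \<eta>') / real (N+1-k)"
    by (intro divide_right_mono order_trans[OF sum_abs] sum_mono block_mix_lipschitz[OF H _ k f \<eta>]) auto
  also have "\<dots> = (\<Sum>c\<in>{1..N}. (\<Sum>i\<in>{1..N+1-k}. \<bar>block_avg k i H (inv \<eta> c) - block_avg k i H (inv \<eta>' c)\<bar>) / real (N+1-k))"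
    unfolding label_dist_def by (subst sum.swap) (simp add: sum_divide_distrib)
  also have "\<dots> = label_dist N (card_step N k H) \<eta> \<eta>'"
    unfolding label_dist_def
  proof (rule sum.cong[OF refl])
    fix c assume c: "c \<in> {1..N}"
    show "(\<Sum>i\<in>{1..N+1-k}. \<bar>block_avg k i H (inv \<eta> c) - block_avg k i H (inv \<eta>' c)\<bar>) / real (N+1-k)
      = \<bar>card_step N k H (inv \<eta> c) - card_step N k H (inv \<eta>' c)\<bar>"
      by (rule sum_abs_block_avg_diff[OF H k])
        (simp_all only: c permutes_in_image[OF permutes_inv[OF p(1)]] permutes_in_image[OF permutes_inv[OF p(2)]])
  qed
  finally show ?thesis .
qed

lemma decr_card_step_funpow: "decr N H \<Longrightarrow> 0 < k \<Longrightarrow> decr N ((card_step N k ^^ n) H)"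
  by (induction n) (auto intro: decr_card_step)

lemma odd_card_step_funpow: "odd_fun N H \<Longrightarrow> odd_fun N ((card_step N k ^^ n) H)"
  by (induction n) (auto intro: odd_card_step)

lemma deck_step_funpow_lipschitz:
  assumes H: "decr N H" and k: "0 < k"
    and f: "\<And>\<eta> \<eta>'. \<eta> \<in> decks N \<Longrightarrow> \<eta>' \<in> decks N \<Longrightarrow> \<bar>f \<eta> - f \<eta>'\<bar> \<le> label_dist N H \<eta> \<eta>'"
    and \<eta>: "\<eta> \<in> decks N" "\<eta>' \<in> decks N"
  shows "\<bar>(deck_step N k ^^ n) f \<eta> - (deck_step N k ^^ n) f \<eta>'\<bar> \<le> label_dist N ((card_step N k ^^ n) H) \<eta> \<eta>'"
  using \<eta>
proof (induction n arbitrary: \<eta> \<eta>')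
  case 0
  show ?case unfolding funpow.simps id_apply by (rule f[OF 0])
next
  case (Suc n)
  show ?case unfolding funpow.simps o_apply
    by (rule deck_step_lipschitz[OF decr_card_step_funpow[OF H k] k Suc.IH Suc.prems])
qed

lemma label_dist_le:
  assumes H: "decr N H" and \<eta>: "\<eta> \<in> decks N" "\<eta>' \<in> decks N"
  shows "label_dist N H \<eta> \<eta>' \<le> real N * (H 1 - H N)"
proof -
  have p: "\<eta> permutes {1..N}" "\<eta>' permutes {1..N}" using \<eta> by (auto simp: decks_permutes)
  have "label_dist N H \<eta> \<eta>' \<le> (\<Sum>c\<in>{1..N}. H 1 - H N)"
    unfolding label_dist_def
  proof (rule sum_mono)
    fix c assume c: "c \<in> {1..N}"
    have m: "inv \<eta> c \<in> {1..N}" "inv \<eta>' c \<in> {1..N}"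
      by (simp_all only: c permutes_in_image[OF permutes_inv[OF p(1)]] permutes_in_image[OF permutes_inv[OF p(2)]])
    have "H z \<le> H 1" "H N \<le> H z" if "z \<in> {1..N}" for z
      using that decrD[OF H, of 1 z] decrD[OF H, of z N] by auto
    from this[OF m(1)] this[OF m(2)] show "\<bar>H (inv \<eta> c) - H (inv \<eta>' c)\<bar> \<le> H 1 - H N" by linarith
  qed
  thus ?thesis by simp
qed

text \<open>A gap of 2 in \<open>H\<close> makes every function bounded by 1 a 1-Lipschitz one.\<close>
lemma label_dist_separated:
  assumes H: "\<And>x y. x \<noteq> y \<Longrightarrow> 2 \<le> \<bar>H x - H y\<bar>" and \<eta>: "\<eta> \<in> decks N" "\<eta>' \<in> decks N" "\<eta> \<noteq> \<eta>'"
  shows "2 \<le> label_dist N H \<eta> \<eta>'"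
proof -
  have p: "\<eta> permutes {1..N}" "\<eta>' permutes {1..N}" using \<eta> by (auto simp: decks_permutes)
  have "inv \<eta> \<noteq> inv \<eta>'"
  proof
    assume "inv \<eta> = inv \<eta>'"
    hence "inv (inv \<eta>) = inv (inv \<eta>')" by (simp only:)
    thus False using \<eta>(3) inv_inv_eq[OF permutes_bij[OF p(1)]] inv_inv_eq[OF permutes_bij[OF p(2)]] by (simp only:)
  qed
  then obtain c where c: "inv \<eta> c \<noteq> inv \<eta>' c" by auto
  have "c \<in> {1..N}"
  proof (rule ccontr)
    assume "c \<notin> {1..N}"
    from permutes_not_in[OF permutes_inv[OF p(1)] this] permutes_not_in[OF permutes_inv[OF p(2)] this] c
    show False by (simp only:)
  qed
  have "2 \<le> \<bar>H (inv \<eta> c) - H (inv \<eta>' c)\<bar>" by (rule H[OF c])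
  also have "\<dots> \<le> label_dist N H \<eta> \<eta>'"
    unfolding label_dist_def by (rule member_le_sum[OF \<open>c \<in> {1..N}\<close>]) auto
  finally show ?thesis .
qed

text \<open>The decreasing odd scale whose consecutive values are 2 apart, as
  \<open>label_dist_separated\<close> demands.\<close>

definition centered :: "nat \<Rightarrow> nat \<Rightarrow> real" where
  "centered N x = real N + 1 - 2 * real x"

lemma decr_centered: "decr N (centered N)"
  by (auto simp: decr_def centered_def)

lemma odd_centered: "odd_fun N (centered N)"
  by (auto simp: odd_fun_def centered_def of_nat_diff)

lemma centered_separated: "x \<noteq> y \<Longrightarrow> 2 \<le> \<bar>centered N x - centered N y\<bar>"
  by (auto simp: centered_def)

text \<open>The wave \<open>s\<close> and the iterates \<open>u n\<close> are odd and nonnegative on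
  the left, so all terms of their pairing are nonnegative. The pairing starts below
  \<open>N * (2 * N)\<close> and contracts by \<open>q\<close>; the two equal terms at the ends,
  with \<open>1/2 \<le> s 1\<close>, bound \<open>u n 1\<close>.\<close>

lemma centered_decay:
  assumes k: "2 \<le> k" "8 * k \<le> N" "k ^ 3 \<le> N ^ 2"
  shows "(card_step N k ^^ n) (centered N) 1
     \<le> 2 * real N ^ 2 * (1 - real k * (real k ^ 2 - 1) / (96 * real N ^ 2) / real (N+1-k)) ^ n"
proof -
  define l where "l = real k * (real k ^ 2 - 1) / (96 * real N ^ 2)"
  define q where "q = 1 - l / real (N+1-k)"
  define s where "s = super_wave N k (real k * (real k ^ 2 - 1) / (24 * real N ^ 2))"
  define u where "u = (\<lambda>n. (card_step N k ^^ n) (centered N))"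
  have k0: "0 < k" and kN: "k \<le> N" and N: "0 < real N" using k by auto
  have "1 \<le> real k ^ 2" using k by simp
  hence l0: "0 \<le> l" unfolding l_def by simp
  have "real k * (real k ^ 2 - 1) \<le> real (k ^ 3)" by (simp add: power3_eq_cube power2_eq_square algebra_simps)
  also have "\<dots> \<le> real (N ^ 2)" using k(3) by (rule of_nat_mono)
  finally have kk: "real k * (real k ^ 2 - 1) \<le> real N ^ 2" by simp
  hence c1: "real k * (real k ^ 2 - 1) / (24 * real N ^ 2) \<le> 1 / 24"
    using N by (simp add: divide_le_eq)
  have "real k * (real k ^ 2 - 1) \<le> 96 * real N ^ 2" using kk zero_le_power2[of "real N"] by linarith
  hence l1: "l \<le> 1" using N unfolding l_def by (simp add: divide_le_eq)
  have c0: "0 \<le> real k * (real k ^ 2 - 1) / (24 * real N ^ 2)" using \<open>1 \<le> real k ^ 2\<close> by simp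
  have "l / real (N+1-k) \<le> l / 1" using l0 kN by (intro divide_left_mono) auto
  hence q0: "0 \<le> q" using l1 by (simp add: q_def)
  have d: "decr N (u n)" for n unfolding u_def by (rule decr_card_step_funpow[OF decr_centered k0])
  have o: "odd_fun N (u n)" for n unfolding u_def by (rule odd_card_step_funpow[OF odd_centered])
  have os: "odd_fun N s" unfolding s_def by (rule odd_super_wave)
  have step: "(\<Sum>x\<in>{1..N}. s x * u (Suc n) x) \<le> q * (\<Sum>x\<in>{1..N}. s x * u n x)" for n
    using card_step_drift_le[OF kN os d, of l n] super_wave_supersolution[OF k]
    by (simp add: u_def q_def s_def l_def)
  have decay: "(\<Sum>x\<in>{1..N}. s x * u n x) \<le> q ^ n * (\<Sum>x\<in>{1..N}. s x * u 0 x)" for n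
  proof (induction n)
    case (Suc n)
    show ?case using order_trans[OF step[of n] mult_left_mono[OF Suc.IH q0]] by (simp add: mult.assoc)
  qed simp
  have half_or: "2 * x \<le> N + 1 \<or> (N + 1 - x \<ge> 1 \<and> 2 * (N + 1 - x) \<le> N + 1)" if "x \<in> {1..N}" for x
    using that by auto
  have sl: "s x = sine_wave N (pi / real N) x + real k * (real k ^ 2 - 1) / (24 * real N ^ 2) * boundary_layer k x"
    if "1 \<le> x" "2 * x \<le> N + 1" for x
    unfolding s_def by (rule super_wave_left) (use that k in auto)
  have s_left: "0 \<le> s x" if "1 \<le> x" "2 * x \<le> N + 1" for x
    unfolding sl[OF that]
    by (rule add_nonneg_nonneg[OF sine_wave_nonneg[OF that] mult_nonneg_nonneg[OF c0 boundary_layer_nonneg]])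
  have s_left2: "s x \<le> 2" if "1 \<le> x" "2 * x \<le> N + 1" for x
  proof -
    have "1 / real x \<le> 1" using that by simp
    hence "boundary_layer k x \<le> 1" unfolding boundary_layer_def using zero_le_divide_1_iff[of "real k"]
      by (intro max.boundedI) linarith+
    hence "real k * (real k ^ 2 - 1) / (24 * real N ^ 2) * boundary_layer k x \<le> 1 / 24 * 1"
      using c0 c1 boundary_layer_nonneg by (intro mult_mono) auto
    moreover have "sine_wave N (pi / real N) x \<le> 1" by (simp add: sine_wave_def)
    ultimately show ?thesis unfolding sl[OF that] by linarith
  qed
  have u_left: "0 \<le> u n x" if "1 \<le> x" "2 * x \<le> N + 1" for x n
  proof -
    have "u n (N + 1 - x) \<le> u n x" using decrD[OF d, of x "N+1-x" n] that by auto
    moreover have "u n (N + 1 - x) = - u n x" using o that by (auto simp: odd_fun_def)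
    ultimately show ?thesis by simp
  qed
  have su: "s x * u n x = s (N+1-x) * u n (N+1-x)" if "x \<in> {1..N}" for x n
    using os o[of n] that by (auto simp: odd_fun_def)
  have nn: "0 \<le> s x * u n x" if "x \<in> {1..N}" for x n
    using half_or[OF that]
  proof
    assume "2 * x \<le> N + 1"
    thus ?thesis using s_left[of x] u_left[of x n] that by (intro mult_nonneg_nonneg) auto
  next
    assume "N + 1 - x \<ge> 1 \<and> 2 * (N + 1 - x) \<le> N + 1"
    thus ?thesis unfolding su[OF that] using s_left[of "N+1-x"] u_left[of "N+1-x" n]
      by (intro mult_nonneg_nonneg) auto
  qed
  have "s x * u 0 x \<le> 2 * real N" if x: "x \<in> {1..N}" for x
  proof -
    have *: "s x * u 0 x \<le> 2 * real N" if "1 \<le> x" "2 * x \<le> N + 1" for x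
      using s_left2[OF that] s_left[OF that] u_left[OF that, of 0] that
      by (intro mult_mono) (auto simp: u_def centered_def)
    show ?thesis using half_or[OF x]
    proof
      assume "2 * x \<le> N + 1"
      thus ?thesis using *[of x] x by auto
    next
      assume "N + 1 - x \<ge> 1 \<and> 2 * (N + 1 - x) \<le> N + 1"
      thus ?thesis unfolding su[OF x] using *[of "N+1-x"] by blast
    qed
  qed
  hence "(\<Sum>x\<in>{1..N}. s x * u 0 x) \<le> real (card {1..N}) * (2 * real N)" by (intro sum_bounded_above) auto
  hence S0: "(\<Sum>x\<in>{1..N}. s x * u 0 x) \<le> 2 * real N ^ 2" by (simp add: power2_eq_square)
  have "1 / 2 \<le> sine_wave N (pi / real N) 1" by (rule sine_wave_ge_half) (use k in auto)
  moreover have "s 1 = sine_wave N (pi / real N) 1 + real k * (real k ^ 2 - 1) / (24 * real N ^ 2) * boundary_layer k 1"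
    by (rule sl) (use k in auto)
  ultimately have s1: "1 / 2 \<le> s 1"
    using mult_nonneg_nonneg[OF c0 boundary_layer_nonneg[of k 1]] by linarith
  have "u n 1 = 2 * (1 / 2 * u n 1)" by simp
  also have "\<dots> \<le> 2 * (s 1 * u n 1)" using s1 u_left[of 1 n] k by (intro mult_left_mono mult_right_mono) auto
  also have "\<dots> = (\<Sum>x\<in>{1, N}. s x * u n x)" using su[of 1 n] k by auto
  also have "\<dots> \<le> (\<Sum>x\<in>{1..N}. s x * u n x)" by (rule sum_mono2) (use nn k in auto)
  also have "\<dots> \<le> q ^ n * (2 * real N ^ 2)"
    using decay[of n] mult_left_mono[OF S0, of "q ^ n"] q0 by simp
  finally show ?thesis by (simp add: u_def q_def l_def mult.commute)
qed

text \<open>Each of the \<open>N\<close> cards contributes at most \<open>u 1 - u N\<close>, which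
  is \<open>2 * u 1\<close> by oddness; with \<open>centered_decay\<close> this makes the factor
  \<open>4 * N^3\<close>.\<close>

lemma deck_step_contraction:
  assumes k: "2 \<le> k" "8 * k \<le> N" "k ^ 3 \<le> N ^ 2"
    and f: "\<And>\<eta>. \<eta> \<in> decks N \<Longrightarrow> \<bar>f \<eta>\<bar> \<le> 1" and \<eta>: "\<eta> \<in> decks N" "\<eta>' \<in> decks N"
  shows "\<bar>(deck_step N k ^^ n) f \<eta> - (deck_step N k ^^ n) f \<eta>'\<bar>
     \<le> 4 * real N ^ 3 * (1 - real k * (real k ^ 2 - 1) / (96 * real N ^ 2) / real (N+1-k)) ^ n"
proof -
  define u where "u = (card_step N k ^^ n) (centered N)"
  have k0: "0 < k" using k by simp
  have d: "decr N u" unfolding u_def by (rule decr_card_step_funpow[OF decr_centered k0])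
  have o: "odd_fun N u" unfolding u_def by (rule odd_card_step_funpow[OF odd_centered])
  have uN: "u N = - u 1" using bspec[OF o[unfolded odd_fun_def], of 1] k by simp
  have "\<bar>f \<eta> - f \<eta>'\<bar> \<le> label_dist N (centered N) \<eta> \<eta>'" if "\<eta> \<in> decks N" "\<eta>' \<in> decks N" for \<eta> \<eta>'
  proof (cases "\<eta> = \<eta>'")
    case False
    have "\<bar>f \<eta> - f \<eta>'\<bar> \<le> 2" using f[OF that(1)] f[OF that(2)] by linarith
    also have "\<dots> \<le> label_dist N (centered N) \<eta> \<eta>'"
      by (rule label_dist_separated[OF centered_separated that False])
    finally show ?thesis .
  qed (simp add: label_dist_def)
  from deck_step_funpow_lipschitz[OF decr_centered k0 this \<eta>, of n]
  have "\<bar>(deck_step N k ^^ n) f \<eta> - (deck_step N k ^^ n) f \<eta>'\<bar> \<le> label_dist N u \<eta> \<eta>'" unfolding u_def .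
  also have "\<dots> \<le> real N * (u 1 - u N)" by (rule label_dist_le[OF d \<eta>])
  also have "\<dots> = 2 * real N * u 1" using uN by simp
  also have "\<dots> \<le> 2 * real N * (2 * real N ^ 2 * (1 - real k * (real k ^ 2 - 1) / (96 * real N ^ 2) / real (N+1-k)) ^ n)"
    unfolding u_def by (intro mult_left_mono centered_decay[OF k]) auto
  finally show ?thesis by (simp add: power3_eq_cube power2_eq_square mult_ac)
qed

section \<open>Poissonization\<close>

lemma block_mix_sum:
  "block_mix k i (\<lambda>\<eta>. \<Sum>a\<in>A. g a * F a \<eta>) \<eta> = (\<Sum>a\<in>A. g a * block_mix k i (F a) \<eta>)"
  unfolding block_mix_def by (subst sum.swap) (simp add: sum_distrib_left sum_divide_distrib)

lemma deck_step_sum: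
  "deck_step N k (\<lambda>\<eta>. \<Sum>a\<in>A. g a * F a \<eta>) = (\<lambda>\<eta>. \<Sum>a\<in>A. g a * deck_step N k (F a) \<eta>)"
  unfolding deck_step_def block_mix_sum by (subst sum.swap) (simp add: sum_distrib_left sum_divide_distrib)

lemma deck_step_funpow_sum:
  "(deck_step N k ^^ n) (\<lambda>\<eta>. \<Sum>a\<in>A. g a * F a \<eta>) = (\<lambda>\<eta>. \<Sum>a\<in>A. g a * (deck_step N k ^^ n) (F a) \<eta>)"
  by (induction n) (simp_all add: deck_step_sum)

lemma block_mix_const: "block_mix k i (\<lambda>\<eta>. c) \<eta> = c"
  using card_permutations[of "{i..<i+k}" k] by (simp add: block_mix_def)

lemma block_mix_mono:
  assumes "\<And>\<xi>. f \<xi> \<le> g \<xi>"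
  shows "block_mix k i f \<eta> \<le> block_mix k i g \<eta>"
  unfolding block_mix_def by (intro divide_right_mono sum_mono assms) simp

lemma deck_step_mono:
  assumes "\<And>\<xi>. f \<xi> \<le> g \<xi>"
  shows "deck_step N k f \<eta> \<le> deck_step N k g \<eta>"
  unfolding deck_step_def by (intro divide_right_mono sum_mono block_mix_mono assms) simp

lemma deck_step_const: "k \<le> N \<Longrightarrow> deck_step N k (\<lambda>\<eta>. c) = (\<lambda>\<eta>. c)"
  by (simp add: deck_step_def block_mix_const fun_eq_iff)

lemma deck_step_funpow_const: "k \<le> N \<Longrightarrow> (deck_step N k ^^ n) (\<lambda>\<eta>. c) = (\<lambda>\<eta>. c)"
  by (induction n) (simp_all add: deck_step_const)

lemma deck_step_funpow_mono:
  assumes "\<And>\<xi>. f \<xi> \<le> g \<xi>"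
  shows "(deck_step N k ^^ n) f \<eta> \<le> (deck_step N k ^^ n) g \<eta>"
  using assms
proof (induction n arbitrary: \<eta>)
  case (Suc n)
  show ?case unfolding funpow.simps o_apply by (rule deck_step_mono[OF Suc.IH[OF Suc.prems]])
qed simp

lemma deck_step_funpow_bounded:
  assumes k: "k \<le> N" and f: "\<And>\<xi>. \<bar>f \<xi>\<bar> \<le> C"
  shows "\<bar>(deck_step N k ^^ n) f \<eta>\<bar> \<le> C"
proof -
  have b: "f \<xi> \<le> C" "- C \<le> f \<xi>" for \<xi> using f[of \<xi>] by linarith+
  show ?thesis
    using deck_step_funpow_mono[of f "\<lambda>_. C", OF b(1), of n N k \<eta>]
      deck_step_funpow_mono[of "\<lambda>_. - C" f, OF b(2), of n N k \<eta>]
    unfolding deck_step_funpow_const[OF k] by linarith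
qed

text \<open>Shuffling a deck gives a deck, so values off \<open>decks N\<close> are never seen. This
  permits expanding a function in indicators of decks, an identity valid only on
  \<open>decks N\<close>.\<close>

lemma deck_step_cong:
  assumes "\<And>\<xi>. \<xi> \<in> decks N \<Longrightarrow> f \<xi> = g \<xi>" and \<eta>: "\<eta> \<in> decks N"
  shows "deck_step N k f \<eta> = deck_step N k g \<eta>"
proof -
  have "f (\<eta> \<circ> \<tau>) = g (\<eta> \<circ> \<tau>)" if "i \<in> {1..N+1-k}" "\<tau> permutes {i..<i+k}" for i \<tau>
    by (rule assms(1)[OF decks_compose[OF \<eta> block_permutes[OF that(2,1)]]])
  hence "block_mix k i f \<eta> = block_mix k i g \<eta>" if "i \<in> {1..N+1-k}" for i
    unfolding block_mix_def by (intro arg_cong2[where f = "(/)"] sum.cong refl) (use that in simp)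
  thus ?thesis unfolding deck_step_def by (intro arg_cong2[where f = "(/)"] sum.cong refl)
qed

lemma deck_step_funpow_cong:
  assumes "\<And>\<xi>. \<xi> \<in> decks N \<Longrightarrow> f \<xi> = g \<xi>" and "\<eta> \<in> decks N"
  shows "(deck_step N k ^^ n) f \<eta> = (deck_step N k ^^ n) g \<eta>"
  using assms(2)
proof (induction n arbitrary: \<eta>)
  case 0
  show ?case unfolding funpow.simps id_apply by (rule assms(1)[OF 0])
next
  case (Suc n)
  show ?case unfolding funpow.simps o_apply by (rule deck_step_cong[OF Suc.IH Suc.prems])
qed

lemma sum_decks_block_mix:
  assumes i: "i \<in> {1..N+1-k}"
  shows "(\<Sum>\<eta>\<in>decks N. block_mix k i f \<eta>) = (\<Sum>\<eta>\<in>decks N. f \<eta>)"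
proof -
  have "(\<Sum>\<eta>\<in>decks N. \<Sum>\<tau> | \<tau> permutes {i..<i+k}. f (\<eta> \<circ> \<tau>)) = (\<Sum>\<tau> | \<tau> permutes {i..<i+k}. \<Sum>\<eta>\<in>decks N. f (\<eta> \<circ> \<tau>))"
    by (rule sum.swap)
  also have "\<dots> = (\<Sum>\<tau> | \<tau> permutes {i..<i+k}. \<Sum>\<eta>\<in>decks N. f \<eta>)"
  proof (rule sum.cong[OF refl])
    fix \<tau> assume "\<tau> \<in> {\<tau>. \<tau> permutes {i..<i+k}}"
    hence "\<tau> permutes {1..N}" using block_permutes[OF _ i] by simp
    from sum_permutations_compose_right[OF this, of f]
    show "(\<Sum>\<eta>\<in>decks N. f (\<eta> \<circ> \<tau>)) = (\<Sum>\<eta>\<in>decks N. f \<eta>)" by (simp add: decks_def)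
  qed
  also have "\<dots> = fact k * (\<Sum>\<eta>\<in>decks N. f \<eta>)"
    using card_permutations[of "{i..<i+k}" k] by simp
  finally have eq: "(\<Sum>\<eta>\<in>decks N. \<Sum>\<tau> | \<tau> permutes {i..<i+k}. f (\<eta> \<circ> \<tau>)) = fact k * (\<Sum>\<eta>\<in>decks N. f \<eta>)" .
  show ?thesis unfolding block_mix_def sum_divide_distrib[symmetric] eq by simp
qed

lemma sum_decks_deck_step:
  assumes k: "k \<le> N"
  shows "(\<Sum>\<eta>\<in>decks N. deck_step N k f \<eta>) = (\<Sum>\<eta>\<in>decks N. f \<eta>)"
proof -
  have "(\<Sum>\<eta>\<in>decks N. deck_step N k f \<eta>) = (\<Sum>i\<in>{1..N+1-k}. \<Sum>\<eta>\<in>decks N. block_mix k i f \<eta>) / real (N+1-k)"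
    unfolding deck_step_def sum_divide_distrib[symmetric] by (subst sum.swap) (rule refl)
  also have "\<dots> = (\<Sum>i\<in>{1..N+1-k}. \<Sum>\<eta>\<in>decks N. f \<eta>) / real (N+1-k)"
    by (intro arg_cong2[where f = "(/)"] sum.cong refl sum_decks_block_mix)
  also have "\<dots> = (\<Sum>\<eta>\<in>decks N. f \<eta>)" using k by simp
  finally show ?thesis .
qed

lemma sum_decks_deck_step_funpow:
  "k \<le> N \<Longrightarrow> (\<Sum>\<eta>\<in>decks N. (deck_step N k ^^ n) f \<eta>) = (\<Sum>\<eta>\<in>decks N. f \<eta>)"
  by (induction n) (simp_all add: sum_decks_deck_step)

lemma deck_step_scale: "deck_step N k (\<lambda>\<eta>. c * f \<eta>) \<eta> = c * deck_step N k f \<eta>"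
  using fun_cong[OF deck_step_sum[of N k "\<lambda>_. c" "\<lambda>_. f" "{()}"], of \<eta>] by simp

text \<open>Pascal's rule, as the induction step in the expansion of the powers of a shift minus the
  identity.\<close>

lemma alternating_binomial_step:
  fixes a :: "nat \<Rightarrow> real"
  shows "(\<Sum>i\<le>n. real (n choose i) * (-1) ^ (n - i) * a (Suc i)) - (\<Sum>i\<le>n. real (n choose i) * (-1) ^ (n - i) * a i)
    = (\<Sum>i\<le>Suc n. real (Suc n choose i) * (-1) ^ (Suc n - i) * a i)"
proof -
  have "(\<Sum>i\<le>Suc n. real (Suc n choose i) * (-1) ^ (Suc n - i) * a i)
     = (-1) ^ Suc n * a 0 + (\<Sum>i\<le>n. real (Suc n choose Suc i) * (-1) ^ (n - i) * a (Suc i))"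
    by (subst sum.atMost_Suc_shift) simp
  also have "\<dots> = (-1) ^ Suc n * a 0 + (\<Sum>i\<le>n. real (n choose Suc i) * (-1) ^ (n - i) * a (Suc i))
     + (\<Sum>i\<le>n. real (n choose i) * (-1) ^ (n - i) * a (Suc i))"
    by (simp add: sum.distrib distrib_right)
  also have "(-1) ^ Suc n * a 0 + (\<Sum>i\<le>n. real (n choose Suc i) * (-1) ^ (n - i) * a (Suc i))
     = (\<Sum>i\<le>Suc n. - (real (n choose i) * (-1) ^ (n - i) * a i))"
  proof (subst sum.atMost_Suc_shift, intro arg_cong2[where f = "(+)"] sum.cong refl)
    fix i assume "i \<in> {..n}"
    show "real (n choose Suc i) * (-1) ^ (n - i) * a (Suc i) = - (real (n choose Suc i) * (-1) ^ (n - Suc i) * a (Suc i))"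
    proof (cases "i < n")
      case True
      hence "n - i = Suc (n - Suc i)" by simp
      thus ?thesis by simp
    qed (use \<open>i \<in> {..n}\<close> in simp)
  qed simp
  also have "\<dots> = - (\<Sum>i\<le>n. real (n choose i) * (-1) ^ (n - i) * a i)"
    by (simp add: sum_negf)
  finally show ?thesis by simp
qed

lemma shuffle_gen_funpow:
  assumes k: "1 \<le> k" "k \<le> N"
  shows "(shuffle_gen N k ^^ n) f
    = (\<lambda>\<eta>. real (N+1-k) ^ n * (\<Sum>i\<le>n. real (n choose i) * (-1) ^ (n - i) * (deck_step N k ^^ i) f \<eta>))"
proof (induction n)
  case (Suc n)
  let ?S = "\<lambda>\<eta>. \<Sum>i\<le>n. real (n choose i) * (-1) ^ (n - i) * (deck_step N k ^^ i) f \<eta>"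
  have st: "deck_step N k ?S \<eta> = (\<Sum>i\<le>n. real (n choose i) * (-1) ^ (n - i) * (deck_step N k ^^ Suc i) f \<eta>)" for \<eta>
    using fun_cong[OF deck_step_sum[of N k "\<lambda>i. real (n choose i) * (-1) ^ (n - i)" "\<lambda>i. (deck_step N k ^^ i) f" "{..n}"], of \<eta>]
    by simp
  have "(shuffle_gen N k ^^ Suc n) f \<eta> = real (N+1-k) ^ Suc n * (deck_step N k ?S \<eta> - ?S \<eta>)" for \<eta>
    unfolding funpow.simps o_apply Suc.IH shuffle_gen_eq[OF k] deck_step_scale
    by (simp only: power_Suc right_diff_distrib mult.assoc)
  thus ?case unfolding st using alternating_binomial_step[of n "\<lambda>i. (deck_step N k ^^ i) f \<eta>" for \<eta>] by auto
qed simp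

section \<open>Poisson weights and the continuous-time semigroup\<close>

definition poisson :: "real \<Rightarrow> nat \<Rightarrow> real" where
  "poisson m n = exp (- m) * m ^ n / fact n"

lemma poisson_nonneg: "0 \<le> m \<Longrightarrow> 0 \<le> poisson m n"
  by (simp add: poisson_def)

lemma poisson_generating: "(\<lambda>n. poisson m n * q ^ n) sums exp (- (m * (1 - q)))"
proof -
  have "(\<lambda>n. exp (- m) * ((m * q) ^ n /\<^sub>R fact n)) sums (exp (- m) * exp (m * q))"
    by (rule sums_mult[OF exp_converges])
  also have "(\<lambda>n. exp (- m) * ((m * q) ^ n /\<^sub>R fact n)) = (\<lambda>n. poisson m n * q ^ n)"
    by (simp add: poisson_def fun_eq_iff power_mult_distrib field_simps)
  also have "exp (- m) * exp (m * q) = exp (- (m * (1 - q)))"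
    by (simp add: exp_add[symmetric] algebra_simps)
  finally show ?thesis .
qed

lemma poisson_sums: "poisson m sums 1"
  using poisson_generating[of m 1] by simp

definition heat_mean :: "nat \<Rightarrow> nat \<Rightarrow> real \<Rightarrow> ((nat \<Rightarrow> nat) \<Rightarrow> real) \<Rightarrow> (nat \<Rightarrow> nat) \<Rightarrow> real" where
  "heat_mean N k t f \<eta> = (\<Sum>n. poisson (real (N+1-k) * t) n * (deck_step N k ^^ n) f \<eta>)"

lemma heat_mean_summable:
  assumes k: "k \<le> N" and t: "0 \<le> t" and f: "\<And>\<xi>. \<bar>f \<xi>\<bar> \<le> C"
  shows "summable (\<lambda>n. poisson (real (N+1-k) * t) n * (deck_step N k ^^ n) f \<eta>)"
proof (rule summable_comparison_test)
  show "\<exists>n0. \<forall>n\<ge>n0. norm (poisson (real (N+1-k) * t) n * (deck_step N k ^^ n) f \<eta>) \<le> poisson (real (N+1-k) * t) n * C"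
    using deck_step_funpow_bounded[OF k f] t by (auto simp: abs_mult poisson_nonneg intro!: mult_mono)
  show "summable (\<lambda>n. poisson (real (N+1-k) * t) n * C)"
    by (rule summable_mult2[OF sums_summable[OF poisson_sums]])
qed

text \<open>With \<open>r = N+1-k\<close> and jump operator \<open>P\<close>, the exponential of
  \<open>r t (P - 1)\<close> is \<open>exp (- r t)\<close> times that of \<open>r t P\<close>. At
  the level of series this is the Cauchy product of the absolutely convergent \<open>a\<close> and
  \<open>b\<close>.\<close>

lemma shuffle_heat_eq:
  assumes k: "1 \<le> k" "k \<le> N" and t: "0 \<le> t"
  shows "shuffle_heat N k t \<eta> \<zeta> = heat_mean N k t (\<lambda>\<xi>. if \<xi> = \<zeta> then 1 else 0) \<eta>"
proof -
  define f :: "(nat \<Rightarrow> nat) \<Rightarrow> real" where "f = (\<lambda>\<xi>. if \<xi> = \<zeta> then 1 else 0)"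
  define m where "m = real (N+1-k) * t"
  define a where "a = (\<lambda>n. m ^ n / fact n * (deck_step N k ^^ n) f \<eta>)"
  define b where "b = (\<lambda>n. (- m) ^ n / fact n)"
  have m0: "0 \<le> m" using t by (simp add: m_def)
  have b: "b sums exp (- m)" using exp_converges[of "- m"] by (simp add: b_def field_simps)
  have sp: "summable (\<lambda>n. m ^ n / fact n)" using sums_summable[OF exp_converges[of m]] by (simp add: field_simps)
  have nb: "summable (\<lambda>n. norm (b n))" using sp m0 by (simp add: b_def power_abs)
  have bd: "\<bar>(deck_step N k ^^ n) f \<eta>\<bar> \<le> 1" for n
    by (rule deck_step_funpow_bounded[OF k(2)]) (simp add: f_def)
  have na: "summable (\<lambda>n. norm (a n))"
  proof (rule summable_comparison_test[OF _ sp])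
    show "\<exists>n0. \<forall>n\<ge>n0. norm (norm (a n)) \<le> m ^ n / fact n"
      using mult_left_mono[OF bd, of "m ^ n / fact n" n for n] m0 by (simp add: a_def abs_mult)
  qed
  have trm: "t ^ n / fact n * ((shuffle_gen N k ^^ n) f) \<eta> = (\<Sum>i\<le>n. a i * b (n - i))" for n
  proof -
    have "t ^ n / fact n * ((shuffle_gen N k ^^ n) f) \<eta>
      = (\<Sum>i\<le>n. m ^ n / fact n * (real (n choose i) * (-1) ^ (n - i) * (deck_step N k ^^ i) f \<eta>))"
      unfolding shuffle_gen_funpow[OF k] sum_distrib_left[symmetric] by (simp add: m_def power_mult_distrib)
    also have "\<dots> = (\<Sum>i\<le>n. a i * b (n - i))"
    proof (rule sum.cong[OF refl])
      fix i assume "i \<in> {..n}"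
      hence i: "i \<le> n" by simp
      have "m ^ n = m ^ i * m ^ (n - i)" using i by (simp add: power_add[symmetric])
      moreover have "(- m) ^ (n - i) = (-1) ^ (n - i) * m ^ (n - i)" by (rule power_minus)
      ultimately show "m ^ n / fact n * (real (n choose i) * (-1) ^ (n - i) * (deck_step N k ^^ i) f \<eta>) = a i * b (n - i)"
        using i by (simp add: a_def b_def binomial_fact field_simps)
    qed
    finally show ?thesis .
  qed
  have "shuffle_heat N k t \<eta> \<zeta> = (\<Sum>n. \<Sum>i\<le>n. a i * b (n - i))"
    unfolding shuffle_heat_def trm[symmetric] f_def ..
  also have "\<dots> = (\<Sum>n. a n) * (\<Sum>n. b n)" by (rule Cauchy_product[OF na nb, symmetric])
  also have "\<dots> = exp (- m) * (\<Sum>n. a n)" using sums_unique[OF b] by simp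
  also have "\<dots> = (\<Sum>n. exp (- m) * a n)" by (rule suminf_mult[symmetric, OF summable_norm_cancel[OF na]])
  also have "\<dots> = heat_mean N k t f \<eta>"
    by (simp add: heat_mean_def a_def poisson_def m_def mult.assoc)
  finally show ?thesis unfolding f_def .
qed

lemma sum_shuffle_heat:
  assumes k: "1 \<le> k" "k \<le> N" and t: "0 \<le> t" and \<eta>: "\<eta> \<in> decks N"
  shows "(\<Sum>\<zeta>\<in>decks N. g \<zeta> * shuffle_heat N k t \<eta> \<zeta>) = heat_mean N k t g \<eta>"
proof -
  define F :: "(nat \<Rightarrow> nat) \<Rightarrow> (nat \<Rightarrow> nat) \<Rightarrow> real" where "F = (\<lambda>\<zeta> \<xi>. if \<xi> = \<zeta> then 1 else 0)"
  define w where "w = poisson (real (N+1-k) * t)"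
  have sm: "summable (\<lambda>n. w n * (deck_step N k ^^ n) (F \<zeta>) \<eta>)" for \<zeta>
    unfolding w_def by (rule heat_mean_summable[OF k(2) t, of _ 1]) (simp add: F_def)
  have sh: "shuffle_heat N k t \<eta> \<zeta> = (\<Sum>n. w n * (deck_step N k ^^ n) (F \<zeta>) \<eta>)" for \<zeta>
    unfolding shuffle_heat_eq[OF k t] heat_mean_def F_def w_def ..
  have "(\<Sum>\<zeta>\<in>decks N. g \<zeta> * shuffle_heat N k t \<eta> \<zeta>) = (\<Sum>\<zeta>\<in>decks N. \<Sum>n. g \<zeta> * (w n * (deck_step N k ^^ n) (F \<zeta>) \<eta>))"
    unfolding sh by (intro sum.cong refl suminf_mult[symmetric] sm)
  also have "\<dots> = (\<Sum>n. \<Sum>\<zeta>\<in>decks N. g \<zeta> * (w n * (deck_step N k ^^ n) (F \<zeta>) \<eta>))"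
    by (rule suminf_sum[symmetric]) (intro summable_mult sm)
  also have "\<dots> = (\<Sum>n. w n * (deck_step N k ^^ n) g \<eta>)"
  proof (rule suminf_cong)
    fix n
    have "(deck_step N k ^^ n) g \<eta> = (deck_step N k ^^ n) (\<lambda>\<xi>. \<Sum>\<zeta>\<in>decks N. g \<zeta> * F \<zeta> \<xi>) \<eta>"
      by (rule deck_step_funpow_cong[OF _ \<eta>]) (simp add: F_def finite_decks sum.delta if_distrib[of "(*) _"] cong: if_cong)
    also have "\<dots> = (\<Sum>\<zeta>\<in>decks N. g \<zeta> * (deck_step N k ^^ n) (F \<zeta>) \<eta>)"
      unfolding deck_step_funpow_sum ..
    finally show "(\<Sum>\<zeta>\<in>decks N. g \<zeta> * (w n * (deck_step N k ^^ n) (F \<zeta>) \<eta>)) = w n * (deck_step N k ^^ n) g \<eta>"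
      by (simp add: sum_distrib_left mult_ac)
  qed
  finally show ?thesis by (simp add: heat_mean_def w_def)
qed

lemma heat_mean_1: "k \<le> N \<Longrightarrow> heat_mean N k t (\<lambda>_. 1) \<eta> = 1"
  using sums_unique[OF poisson_sums[of "real (N+1-k) * t"]] by (simp add: heat_mean_def deck_step_funpow_const)

text \<open>The sign \<open>g\<close> of the deviation is a test function bounded by 1 that attains
  the variation distance. Its uniform mean \<open>\<mu>\<close> is an average over starting decks,
  so contraction between pairs of decks suffices; the Poisson generating function turns
  \<open>q ^ n\<close> into \<open>exp (- l * t)\<close>.\<close>

lemma shuffle_tv_upper:
  assumes k: "2 \<le> k" "8 * k \<le> N" "k ^ 3 \<le> N ^ 2" and t: "0 \<le> t" and \<eta>: "\<eta> \<in> decks N"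
  shows "shuffle_tv N k t \<eta> \<le> 2 * real N ^ 3 * exp (- (real k * (real k ^ 2 - 1) / (96 * real N ^ 2) * t))"
proof -
  define g where "g = (\<lambda>\<zeta>. sgn (shuffle_heat N k t \<eta> \<zeta> - 1 / fact N))"
  define w where "w = poisson (real (N+1-k) * t)"
  define l where "l = real k * (real k ^ 2 - 1) / (96 * real N ^ 2)"
  define q where "q = 1 - l / real (N+1-k)"
  define \<mu> where "\<mu> = (\<Sum>\<xi>\<in>decks N. g \<xi>) / fact N"
  have k1: "1 \<le> k" "k \<le> N" using k by auto
  have g1: "\<bar>g \<xi>\<bar> \<le> 1" for \<xi> by (simp add: g_def sgn_real_def)
  have "(\<Sum>\<zeta>\<in>decks N. \<bar>shuffle_heat N k t \<eta> \<zeta> - 1 / fact N\<bar>) = (\<Sum>\<zeta>\<in>decks N. g \<zeta> * shuffle_heat N k t \<eta> \<zeta> - g \<zeta> * (1 / fact N))"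
    by (intro sum.cong refl) (simp only: g_def abs_sgn, simp add: algebra_simps)
  also have "\<dots> = heat_mean N k t g \<eta> - \<mu>"
    unfolding sum_subtractf sum_shuffle_heat[OF k1 t \<eta>] \<mu>_def by (simp add: sum_divide_distrib)
  also have "\<dots> = (\<Sum>n. w n * ((deck_step N k ^^ n) g \<eta> - \<mu>))"
  proof -
    have "(\<lambda>n. w n * (deck_step N k ^^ n) g \<eta> - w n * \<mu>) sums (heat_mean N k t g \<eta> - 1 * \<mu>)"
      unfolding heat_mean_def w_def
      by (intro sums_diff summable_sums heat_mean_summable[OF k1(2) t g1] sums_mult2 poisson_sums)
    thus ?thesis by (simp add: sums_iff right_diff_distrib)
  qed
  also have "\<dots> \<le> (\<Sum>n. 4 * real N ^ 3 * (w n * q ^ n))"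
  proof (rule suminf_le)
    fix n
    have "\<bar>(deck_step N k ^^ n) g \<eta> - (deck_step N k ^^ n) g \<xi>\<bar> \<le> 4 * real N ^ 3 * q ^ n" if "\<xi> \<in> decks N" for \<xi>
      using deck_step_contraction[OF k _ \<eta> that, of g n] g1 by (simp add: q_def l_def)
    hence "(\<Sum>\<xi>\<in>decks N. (deck_step N k ^^ n) g \<eta> - (deck_step N k ^^ n) g \<xi>) \<le> real (card (decks N)) * (4 * real N ^ 3 * q ^ n)"
      by (intro sum_bounded_above) (use abs_le_D1 in blast)
    \<comment> \<open>The uniform law is stationary, so averaging the iterate over all starting
      decks returns \<open>\<mu>\<close>.\<close>
    moreover have "(\<Sum>\<xi>\<in>decks N. (deck_step N k ^^ n) g \<eta> - (deck_step N k ^^ n) g \<xi>) = fact N * ((deck_step N k ^^ n) g \<eta> - \<mu>)"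
      by (simp add: sum_subtractf sum_decks_deck_step_funpow[OF k1(2)] card_decks \<mu>_def right_diff_distrib)
    ultimately have "(deck_step N k ^^ n) g \<eta> - \<mu> \<le> 4 * real N ^ 3 * q ^ n"
      by (simp add: card_decks)
    hence "w n * ((deck_step N k ^^ n) g \<eta> - \<mu>) \<le> w n * (4 * real N ^ 3 * q ^ n)"
      using t unfolding w_def by (intro mult_left_mono poisson_nonneg) auto
    thus "w n * ((deck_step N k ^^ n) g \<eta> - \<mu>) \<le> 4 * real N ^ 3 * (w n * q ^ n)" by (simp add: mult_ac)
  next
    show "summable (\<lambda>n. w n * ((deck_step N k ^^ n) g \<eta> - \<mu>))"
      unfolding right_diff_distrib w_def
      by (intro summable_diff heat_mean_summable[OF k1(2) t g1] summable_mult2 sums_summable[OF poisson_sums])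
    show "summable (\<lambda>n. 4 * real N ^ 3 * (w n * q ^ n))"
      unfolding w_def by (intro summable_mult sums_summable[OF poisson_generating])
  qed
  also have "\<dots> = 4 * real N ^ 3 * exp (- (l * t))"
  proof -
    have "real (N+1-k) * t * (1 - q) = l * t" using k1 by (simp add: q_def)
    with sums_mult[OF poisson_generating[of "real (N+1-k) * t" q], of "4 * real N ^ 3"]
    show ?thesis by (simp add: sums_iff w_def)
  qed
  finally show ?thesis by (simp add: shuffle_tv_def l_def)
qed

text \<open>Test with \<open>1 - 2 * of_bool (A \<zeta>)\<close>, which has modulus 1; the constant
  part drops out because both laws have mass 1.\<close>

lemma shuffle_tv_lower:
  assumes k: "1 \<le> k" "k \<le> N" and t: "0 \<le> t" and \<eta>: "\<eta> \<in> decks N"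
  shows "(\<Sum>\<zeta>\<in>decks N. of_bool (A \<zeta>)) / fact N - heat_mean N k t (\<lambda>\<zeta>. of_bool (A \<zeta>)) \<eta> \<le> shuffle_tv N k t \<eta>"
proof -
  let ?p = "shuffle_heat N k t \<eta>"
  let ?a = "\<lambda>\<zeta>. of_bool (A \<zeta>) :: real"
  have tot: "(\<Sum>\<zeta>\<in>decks N. ?p \<zeta>) = 1"
    using sum_shuffle_heat[OF k t \<eta>, of "\<lambda>_. 1"] heat_mean_1[OF k(2)] by simp
  have "2 * ((\<Sum>\<zeta>\<in>decks N. ?a \<zeta>) / fact N - heat_mean N k t ?a \<eta>)
     = (\<Sum>\<zeta>\<in>decks N. (1 - 2 * ?a \<zeta>) * (?p \<zeta> - 1 / fact N))"
  proof -
    have "(\<Sum>\<zeta>\<in>decks N. (1 - 2 * ?a \<zeta>) * (?p \<zeta> - 1 / fact N))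
      = (\<Sum>\<zeta>\<in>decks N. ?p \<zeta> - 1 / fact N - 2 * (?a \<zeta> * ?p \<zeta>) + 2 * (?a \<zeta> / fact N))"
      by (intro sum.cong refl) (simp only: of_bool_def, simp add: algebra_simps)
    also have "\<dots> = 2 * ((\<Sum>\<zeta>\<in>decks N. ?a \<zeta>) / fact N) - 2 * (\<Sum>\<zeta>\<in>decks N. ?a \<zeta> * ?p \<zeta>)"
      unfolding sum.distrib sum_subtractf sum_distrib_left[symmetric] sum_divide_distrib[symmetric] tot
      by (simp add: card_decks)
    finally show ?thesis unfolding sum_shuffle_heat[OF k t \<eta>, symmetric] by simp
  qed
  also have "\<dots> \<le> (\<Sum>\<zeta>\<in>decks N. \<bar>?p \<zeta> - 1 / fact N\<bar>)"
    by (rule sum_mono) auto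
  finally have "2 * ((\<Sum>\<zeta>\<in>decks N. ?a \<zeta>) / fact N - heat_mean N k t ?a \<eta>)
     \<le> (\<Sum>\<zeta>\<in>decks N. \<bar>?p \<zeta> - 1 / fact N\<bar>)" .
  moreover have "a \<le> 1 / 2 * b" if "2 * a \<le> b" for a b :: real using that by simp
  ultimately show ?thesis unfolding shuffle_tv_def by blast
qed

section \<open>Lower tail of the test statistic\<close>

text \<open>Expectation under a law on decks, kept as an abstract positive normalized functional.
  The class contains point masses and is closed under shuffling a fixed block, which is all that
  conditioning on the blocks needs.\<close>

locale deck_mean =
  fixes E :: "((nat \<Rightarrow> nat) \<Rightarrow> real) \<Rightarrow> real"
  assumes add: "E (\<lambda>\<xi>. f \<xi> + g \<xi>) = E f + E g"
    and scale: "E (\<lambda>\<xi>. c * f \<xi>) = c * E f"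
    and mono: "(\<And>\<xi>. f \<xi> \<le> g \<xi>) \<Longrightarrow> E f \<le> E g"
    and one: "E (\<lambda>\<xi>. 1) = 1"
begin

lemma const: "E (\<lambda>\<xi>. c) = c"
  using scale[of c "\<lambda>_. 1"] one by simp

lemma sum: "finite A \<Longrightarrow> E (\<lambda>\<xi>. \<Sum>a\<in>A. F a \<xi>) = (\<Sum>a\<in>A. E (F a))"
  by (induction A rule: finite_induct) (simp_all add: const add)

lemma div: "E (\<lambda>\<xi>. f \<xi> / c) = E f / c"
  using scale[of "1 / c" f] by simp

lemma second_moment_shift:
  assumes "E f = x"
  shows "E (\<lambda>\<xi>. (a - (f \<xi> - x))^2) = a^2 + E (\<lambda>\<xi>. (f \<xi> - x)^2)"
proof -
  have "E (\<lambda>\<xi>. (a - (f \<xi> - x))^2) = E (\<lambda>\<xi>. (a^2 + 2 * a * x) + ((- 2 * a) * f \<xi> + (f \<xi> - x)^2))"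
    by (rule arg_cong[of _ _ E]) (auto simp: power2_eq_square algebra_simps)
  also have "\<dots> = (a^2 + 2 * a * x) + ((- 2 * a) * x + E (\<lambda>\<xi>. (f \<xi> - x)^2))"
    unfolding add const scale assms ..
  finally show ?thesis by simp
qed

lemma second_moment:
  assumes "E f = x"
  shows "E (\<lambda>\<xi>. (f \<xi> - x)^2) = E (\<lambda>\<xi>. (f \<xi>)^2) - x^2"
proof -
  have "E (\<lambda>\<xi>. (f \<xi>)^2) = E (\<lambda>\<xi>. (- x - (f \<xi> - x))^2)"
    by (rule arg_cong[of _ _ E]) (auto simp: power2_eq_square algebra_simps)
  thus ?thesis unfolding second_moment_shift[OF assms] by simp
qed

end

lemma deck_mean_block_mix:
  assumes "deck_mean E"
  shows "deck_mean (\<lambda>f. E (block_mix k i f))"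
proof -
  interpret deck_mean E by fact
  show ?thesis
  proof
    show "E (block_mix k i (\<lambda>\<xi>. f \<xi> + g \<xi>)) = E (block_mix k i f) + E (block_mix k i g)" for f g
      unfolding add[symmetric] by (rule arg_cong[of _ _ E]) (auto simp: block_mix_def sum.distrib add_divide_distrib)
    show "E (block_mix k i (\<lambda>\<xi>. c * f \<xi>)) = c * E (block_mix k i f)" for c f
      unfolding scale[symmetric] by (rule arg_cong[of _ _ E]) (auto simp: block_mix_def sum_distrib_left)
    show "E (block_mix k i f) \<le> E (block_mix k i g)" if "\<And>\<xi>. f \<xi> \<le> g \<xi>" for f g
      by (rule mono) (rule block_mix_mono[OF that])
    have "block_mix k i (\<lambda>\<xi>. 1) = (\<lambda>\<xi>. 1)" by (rule ext) (rule block_mix_const)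
    thus "E (block_mix k i (\<lambda>\<xi>. 1)) = 1" by (simp add: one)
  qed
qed

lemma deck_mean_eval: "deck_mean (\<lambda>f. f \<eta>)"
  by unfold_locales auto

definition neg_corr :: "nat \<Rightarrow> (nat \<Rightarrow> real) \<Rightarrow> (((nat \<Rightarrow> nat) \<Rightarrow> real) \<Rightarrow> real) \<Rightarrow> bool" where
  "neg_corr N w E \<longleftrightarrow> (\<forall>m\<in>{1..N}. \<forall>m'\<in>{1..N}. m \<noteq> m' \<longrightarrow>
     E (\<lambda>\<xi>. w (\<xi> m) * w (\<xi> m')) \<le> E (\<lambda>\<xi>. w (\<xi> m)) * E (\<lambda>\<xi>. w (\<xi> m')))"

lemma block_mix_point:
  "block_mix k i (\<lambda>\<xi>. w (\<xi> m)) = (\<lambda>\<xi>. block_avg k i (\<lambda>x. w (\<xi> x)) m)"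
proof
  fix \<xi> :: "nat \<Rightarrow> nat"
  have c: "card {\<tau>. \<tau> permutes {i..<i+k}} = fact k" using card_permutations[of "{i..<i+k}" k] by simp
  show "block_mix k i (\<lambda>\<xi>. w (\<xi> m)) \<xi> = block_avg k i (\<lambda>x. w (\<xi> x)) m"
  proof (cases "m \<in> {i..<i+k}")
    case True
    with sum_permutes_point[of "{i..<i+k}" m "\<lambda>x. w (\<xi> x)"] show ?thesis
      by (simp add: block_mix_def block_avg_def)
  next
    case False
    have "(\<Sum>\<tau> | \<tau> permutes {i..<i+k}. w ((\<xi> \<circ> \<tau>) m)) = (\<Sum>\<tau> | \<tau> permutes {i..<i+k}. w (\<xi> m))"
      by (rule sum.cong[OF refl]) (simp add: permutes_not_in[OF _ False])
    thus ?thesis unfolding block_mix_def block_avg_def by (simp only: False if_False sum_constant c) simp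
  qed
qed

lemma deck_mean_block_mix_point:
  assumes "deck_mean E"
  shows "E (block_mix k i (\<lambda>\<xi>. w (\<xi> m))) = block_avg k i (\<lambda>x. E (\<lambda>\<xi>. w (\<xi> x))) m"
proof -
  interpret deck_mean E by fact
  show ?thesis unfolding block_mix_point block_avg_def
    by (cases "m \<in> {i..<i+k}") (simp_all only: if_True if_False div sum finite_atLeastLessThan)
qed

text \<open>Sampling without replacement is negatively correlated: after clearing denominators this
  is Cauchy-Schwarz, the square of the sum being at most \<open>k\<close> times the sum of
  squares.\<close>

lemma pair_average_le:
  fixes u :: "'a \<Rightarrow> real"
  assumes B: "finite B" "card B = k" and k: "2 \<le> k"
  shows "(\<Sum>a\<in>B. \<Sum>b\<in>B - {a}. u a * u b) / (real k * (real k - 1)) \<le> ((\<Sum>a\<in>B. u a) / real k)^2"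
proof -
  define S Q where "S = (\<Sum>a\<in>B. u a)" and "Q = (\<Sum>a\<in>B. (u a)^2)"
  have "(\<Sum>a\<in>B. \<Sum>b\<in>B - {a}. u a * u b) = (\<Sum>a\<in>B. u a * S - (u a)^2)"
    by (rule sum.cong[OF refl])
      (simp add: S_def sum_distrib_left[symmetric] sum_diff1 B(1) right_diff_distrib power2_eq_square)
  also have "\<dots> = S^2 - Q"
    by (simp add: sum_subtractf sum_distrib_right[symmetric] S_def Q_def power2_eq_square)
  finally have eq: "(\<Sum>a\<in>B. \<Sum>b\<in>B - {a}. u a * u b) = S^2 - Q" .
  have "S^2 \<le> (\<Sum>a\<in>B. 1^2) * Q"
    using Cauchy_Schwarz_ineq_sum[of "\<lambda>_. 1" u B] by (simp add: S_def Q_def)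
  hence "S^2 \<le> real k * Q" using B by simp
  moreover have "0 < real k" "0 < real k - 1" using k by auto
  ultimately show ?thesis unfolding eq S_def[symmetric]
    by (simp add: field_simps power2_eq_square)
qed

text \<open>Two points inside become a random ordered pair, handled by
  \<open>pair_average_le\<close>; one point inside is averaged against a fixed outside one; two
  outside do not move. The block must be fixed: a mixture over blocks can acquire positive
  correlation from its varying means.\<close>

lemma neg_corr_block_mix:
  assumes E: "deck_mean E" and nc: "neg_corr N w E" and i: "i \<in> {1..N+1-k}" and k: "2 \<le> k"
  shows "neg_corr N w (\<lambda>f. E (block_mix k i f))"
  unfolding neg_corr_def
proof (intro ballI impI)
  fix m m' assume m: "m \<in> {1..N}" "m' \<in> {1..N}" "m \<noteq> m'"
  interpret deck_mean E by fact
  define u where "u = (\<lambda>x. E (\<lambda>\<xi>. w (\<xi> x)))"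
  let ?B = "{i..<i+k}" and ?A = "block_avg k i u"
  let ?F = "\<lambda>m m' \<xi>. w (\<xi> m) * w (\<xi> m')"
  have sub: "?B \<subseteq> {1..N}" by (rule block_subset[OF i])
  have k0: "0 < real k" using k by simp
  have c: "card {\<tau>. \<tau> permutes ?B} = fact k" using card_permutations[of ?B k] by simp
  have neg: "E (?F a b) \<le> u a * u b" if "a \<in> {1..N}" "b \<in> {1..N}" "a \<noteq> b" for a b
    using nc that unfolding neg_corr_def u_def by blast
  have A_in: "?A x = (\<Sum>y\<in>?B. u y) / real k" if "x \<in> ?B" for x
    using that by (simp only: block_avg_def if_True)
  have A_out: "?A x = u x" if "x \<notin> ?B" for x
    using that by (simp only: block_avg_def if_False)
  have mixed: "E (block_mix k i (?F a b)) \<le> ?A a * ?A b" if ab: "a \<in> ?B" "b \<in> {1..N}" "b \<notin> ?B" for a b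
  proof -
    have "block_mix k i (?F a b) = (\<lambda>\<xi>. (\<Sum>y\<in>?B. ?F y b \<xi>) / real k)"
    proof
      fix \<xi> :: "nat \<Rightarrow> nat"
      have "(\<Sum>\<tau> | \<tau> permutes ?B. ?F a b (\<xi> \<circ> \<tau>)) = (\<Sum>\<tau> | \<tau> permutes ?B. w (\<xi> (\<tau> a)) * w (\<xi> b))"
        by (rule sum.cong[OF refl]) (simp add: permutes_not_in[OF _ ab(3)])
      thus "block_mix k i (?F a b) \<xi> = (\<Sum>y\<in>?B. ?F y b \<xi>) / real k"
        using sum_permutes_point[OF _ ab(1), of "\<lambda>x. w (\<xi> x) * w (\<xi> b)"] by (simp add: block_mix_def)
    qed
    hence "E (block_mix k i (?F a b)) = (\<Sum>y\<in>?B. E (?F y b)) / real k"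
      by (simp add: div sum)
    also have "\<dots> \<le> (\<Sum>y\<in>?B. u y * u b) / real k"
      by (intro divide_right_mono sum_mono neg) (use sub ab in auto)
    also have "\<dots> = ?A a * ?A b"
      unfolding A_in[OF ab(1)] A_out[OF ab(3)] by (simp add: sum_distrib_right)
    finally show ?thesis .
  qed
  have "E (block_mix k i (?F m m')) \<le> ?A m * ?A m'"
  proof -
    consider "m \<in> ?B" "m' \<in> ?B" | "m \<in> ?B" "m' \<notin> ?B" | "m \<notin> ?B" "m' \<in> ?B" | "m \<notin> ?B" "m' \<notin> ?B" by blast
    thus ?thesis
    proof cases
      case 1
      have "real k * (real k - 1) * block_mix k i (?F m m') \<xi> = (\<Sum>a\<in>?B. \<Sum>b\<in>?B - {a}. ?F a b \<xi>)" for \<xi>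
        using sum_permutes_pair[OF _ 1 m(3), of "\<lambda>a b. ?F a b \<xi>"] k by (simp add: block_mix_def of_nat_diff)
      hence "block_mix k i (?F m m') = (\<lambda>\<xi>. (\<Sum>a\<in>?B. \<Sum>b\<in>?B - {a}. ?F a b \<xi>) / (real k * (real k - 1)))"
        using k by (auto simp: fun_eq_iff field_simps)
      hence "E (block_mix k i (?F m m')) = (\<Sum>a\<in>?B. \<Sum>b\<in>?B - {a}. E (?F a b)) / (real k * (real k - 1))"
        by (simp add: div sum)
      also have "\<dots> \<le> (\<Sum>a\<in>?B. \<Sum>b\<in>?B - {a}. u a * u b) / (real k * (real k - 1))"
        by (intro divide_right_mono sum_mono neg) (use sub k in auto)
      also have "\<dots> \<le> ((\<Sum>a\<in>?B. u a) / real k)^2" by (rule pair_average_le) (use k in auto)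
      also have "\<dots> = ?A m * ?A m'" unfolding A_in[OF 1(1)] A_in[OF 1(2)] by (simp add: power2_eq_square)
      finally show ?thesis .
    next
      case 2
      show ?thesis by (rule mixed[OF 2(1) m(2) 2(2)])
    next
      case 3
      show ?thesis using mixed[OF 3(2) m(1) 3(1)] by (simp only: mult.commute)
    next
      case 4
      have "block_mix k i (?F m m') = ?F m m'"
      proof
        fix \<xi> :: "nat \<Rightarrow> nat"
        have "(\<Sum>\<tau> | \<tau> permutes ?B. ?F m m' (\<xi> \<circ> \<tau>)) = (\<Sum>\<tau> | \<tau> permutes ?B. ?F m m' \<xi>)"
          by (rule sum.cong[OF refl]) (simp add: permutes_not_in[OF _ 4(1)] permutes_not_in[OF _ 4(2)])
        thus "block_mix k i (?F m m') \<xi> = ?F m m' \<xi>" unfolding block_mix_def by (simp only: sum_constant c) simp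
      qed
      thus ?thesis using neg[OF m] unfolding A_out[OF 4(1)] A_out[OF 4(2)] by simp
    qed
  qed
  thus "E (block_mix k i (?F m m')) \<le> E (block_mix k i (\<lambda>\<xi>. w (\<xi> m))) * E (block_mix k i (\<lambda>\<xi>. w (\<xi> m')))"
    unfolding deck_mean_block_mix_point[OF E] u_def .
qed

definition stat :: "nat \<Rightarrow> (nat \<Rightarrow> real) \<Rightarrow> (nat \<Rightarrow> real) \<Rightarrow> (nat \<Rightarrow> nat) \<Rightarrow> real" where
  "stat N h w \<xi> = (\<Sum>m\<in>{1..N}. h m * w (\<xi> m))"

lemma (in deck_mean) mean_stat: "E (stat N h w) = (\<Sum>m\<in>{1..N}. h m * E (\<lambda>\<xi>. w (\<xi> m)))"
  unfolding stat_def by (simp add: sum scale)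

text \<open>With nonnegative weights the off-diagonal covariances only help, and
  \<open>\<bar>w c\<bar> \<le> 1\<close> bounds the diagonal.\<close>

lemma (in deck_mean) variance_stat_nonneg:
  assumes nc: "neg_corr N w E" and h: "\<And>m. 0 \<le> h m" and w: "\<And>c. \<bar>w c\<bar> \<le> 1"
  shows "E (\<lambda>\<xi>. (stat N h w \<xi> - (\<Sum>m\<in>{1..N}. h m * E (\<lambda>\<xi>. w (\<xi> m))))^2) \<le> (\<Sum>m\<in>{1..N}. (h m)^2)"
proof -
  define u where "u = (\<lambda>x. E (\<lambda>\<xi>. w (\<xi> x)))"
  have "E (\<lambda>\<xi>. (stat N h w \<xi>)^2) = E (\<lambda>\<xi>. \<Sum>m\<in>{1..N}. \<Sum>m'\<in>{1..N}. (h m * h m') * (w (\<xi> m) * w (\<xi> m')))"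
    by (rule arg_cong[of _ _ E]) (simp add: stat_def power2_eq_square sum_product mult_ac)
  also have "\<dots> = (\<Sum>m\<in>{1..N}. \<Sum>m'\<in>{1..N}. (h m * h m') * E (\<lambda>\<xi>. w (\<xi> m) * w (\<xi> m')))"
    by (simp add: sum scale)
  also have "\<dots> \<le> (\<Sum>m\<in>{1..N}. \<Sum>m'\<in>{1..N}. (h m * h m') * (u m * u m') + (if m = m' then (h m)^2 else 0))"
  proof (intro sum_mono)
    fix m m' assume m: "m \<in> {1..N}" "m' \<in> {1..N}"
    show "(h m * h m') * E (\<lambda>\<xi>. w (\<xi> m) * w (\<xi> m')) \<le> (h m * h m') * (u m * u m') + (if m = m' then (h m)^2 else 0)"
    proof (cases "m = m'")
      case True
      have "E (\<lambda>\<xi>. w (\<xi> m) * w (\<xi> m)) \<le> E (\<lambda>\<xi>. 1)"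
      proof (rule mono)
        fix \<xi> show "w (\<xi> m) * w (\<xi> m) \<le> 1" using w[of "\<xi> m"] by (simp add: power2_eq_square[symmetric] abs_square_le_1)
      qed
      hence "h m * h m * E (\<lambda>\<xi>. w (\<xi> m) * w (\<xi> m)) \<le> (h m)^2"
        using mult_left_mono[of _ 1 "h m * h m"] by (simp add: one power2_eq_square)
      moreover have "0 \<le> (h m * h m) * (u m * u m)" by (rule mult_nonneg_nonneg[OF zero_le_square zero_le_square])
      ultimately have "(h m * h m) * E (\<lambda>\<xi>. w (\<xi> m) * w (\<xi> m)) \<le> (h m * h m) * (u m * u m) + (h m)^2"
        by linarith
      thus ?thesis unfolding True[symmetric] by (simp only: refl if_True)
    next
      case False
      have "E (\<lambda>\<xi>. w (\<xi> m) * w (\<xi> m')) \<le> u m * u m'"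
        using nc m False unfolding neg_corr_def u_def by blast
      thus ?thesis using False h by (simp add: mult_left_mono)
    qed
  qed
  also have "\<dots> = (\<Sum>m\<in>{1..N}. h m * u m)^2 + (\<Sum>m\<in>{1..N}. (h m)^2)"
    by (simp add: sum.distrib power2_eq_square sum_product mult_ac)
  finally show ?thesis
    unfolding second_moment[OF mean_stat] u_def by simp
qed

text \<open>Negative correlations bound the variance only for weights of one sign, so \<open>h\<close> is split into
  its positive and negative parts.\<close>
lemma (in deck_mean) variance_stat:
  assumes nc: "neg_corr N w E" and w: "\<And>c. \<bar>w c\<bar> \<le> 1"
  shows "E (\<lambda>\<xi>. (stat N h w \<xi> - (\<Sum>m\<in>{1..N}. h m * E (\<lambda>\<xi>. w (\<xi> m))))^2) \<le> 2 * (\<Sum>m\<in>{1..N}. (h m)^2)"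
proof -
  define p n where "p = (\<lambda>m. max 0 (h m))" and "n = (\<lambda>m. max 0 (- h m))"
  define X where "X = (\<lambda>h. \<Sum>m\<in>{1..N}. h m * E (\<lambda>\<xi>. w (\<xi> m)))"
  have h: "h m = p m - n m" for m by (simp add: p_def n_def)
  have "stat N h w \<xi> - X h = (stat N p w \<xi> - X p) - (stat N n w \<xi> - X n)" for \<xi>
    by (simp add: stat_def X_def h left_diff_distrib sum_subtractf)
  moreover have "(a - b)^2 \<le> 2 * a^2 + 2 * b^2" for a b :: real
    using sum_power2_ge_zero[of "a + b" 0] by (simp add: power2_eq_square algebra_simps)
  ultimately have "E (\<lambda>\<xi>. (stat N h w \<xi> - X h)^2) \<le> E (\<lambda>\<xi>. 2 * (stat N p w \<xi> - X p)^2 + 2 * (stat N n w \<xi> - X n)^2)"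
    by (intro mono) simp
  also have "\<dots> = 2 * E (\<lambda>\<xi>. (stat N p w \<xi> - X p)^2) + 2 * E (\<lambda>\<xi>. (stat N n w \<xi> - X n)^2)"
    by (simp add: add scale)
  also have "\<dots> \<le> 2 * (\<Sum>m\<in>{1..N}. (p m)^2) + 2 * (\<Sum>m\<in>{1..N}. (n m)^2)"
    unfolding X_def by (intro add_mono mult_left_mono variance_stat_nonneg nc w) (auto simp: p_def n_def)
  also have "\<dots> = 2 * (\<Sum>m\<in>{1..N}. (h m)^2)"
    unfolding distrib_left[symmetric] sum.distrib[symmetric]
    by (intro arg_cong2[where f = "(*)"] sum.cong refl) (auto simp: p_def n_def max_def)
  finally show ?thesis unfolding X_def .
qed

lemma max0_sq_le: "y \<le> z \<Longrightarrow> (max 0 y)^2 \<le> z^2" for y z :: real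
  by (cases "y \<le> 0") (auto intro: power_mono)

text \<open>The one-sided square is dominated by a full square centred at the mean, whose cross term
  has mean zero.\<close>

lemma (in deck_mean) lower_deviation:
  assumes x: "E f = x"
  shows "E (\<lambda>\<xi>. (max 0 (c - f \<xi>))^2) \<le> (max 0 (c - x))^2 + E (\<lambda>\<xi>. (f \<xi> - x)^2)"
proof -
  have "E (\<lambda>\<xi>. (max 0 (c - f \<xi>))^2) \<le> E (\<lambda>\<xi>. (max 0 (c - x) - (f \<xi> - x))^2)"
  proof (rule mono, rule max0_sq_le)
    fix \<xi> have "c - x \<le> max 0 (c - x)" by simp
    thus "c - f \<xi> \<le> max 0 (c - x) - (f \<xi> - x)" by linarith
  qed
  also have "\<dots> = (max 0 (c - x))^2 + E (\<lambda>\<xi>. (f \<xi> - x)^2)" by (rule second_moment_shift[OF x])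
  finally show ?thesis .
qed

text \<open>Counterpart of \<open>lower_deviation\<close> for the choice of the block:
  \<open>X i\<close> will be the mean of the statistic after block \<open>i\<close>,
  \<open>x\<close> their average, \<open>y\<close> the mean before the step and \<open>q\<close> the
  decay over the remaining steps. Spread about the average is at most that about any
  \<open>y\<close>, and increments from \<open>y\<close> are what \<open>block_avg_increment\<close>
  controls.\<close>

lemma sum_lower_deviation:
  fixes X :: "'a \<Rightarrow> real"
  assumes I: "finite I" and mean: "(\<Sum>i\<in>I. X i) = real (card I) * x" and q: "0 \<le> q" "q \<le> 1" and a: "0 \<le> a" "c - q * x \<le> a"
  shows "(\<Sum>i\<in>I. (max 0 (c - q * X i))^2) \<le> real (card I) * a^2 + (\<Sum>i\<in>I. (X i - y)^2)"
proof -
  have "(\<Sum>i\<in>I. (max 0 (c - q * X i))^2) \<le> (\<Sum>i\<in>I. (a - q * (X i - x))^2)"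
  proof (intro sum_mono max0_sq_le)
    fix i show "c - q * X i \<le> a - q * (X i - x)" using a by (simp add: right_diff_distrib)
  qed
  also have "\<dots> = (\<Sum>i\<in>I. a^2 - 2 * a * q * (X i - x) + q^2 * (X i - x)^2)"
    by (rule sum.cong) (auto simp: power2_eq_square algebra_simps)
  also have "\<dots> = real (card I) * a^2 + q^2 * (\<Sum>i\<in>I. (X i - x)^2)"
    using mean by (simp add: sum.distrib sum_subtractf sum_distrib_left[symmetric])
  also have "\<dots> \<le> real (card I) * a^2 + 1 * (\<Sum>i\<in>I. (X i - x)^2)"
    using q by (intro add_left_mono mult_right_mono sum_nonneg) (auto simp: power_le_one)
  also have "(\<Sum>i\<in>I. (X i - x)^2) \<le> (\<Sum>i\<in>I. (X i - y)^2)"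
  proof -
    have "(\<Sum>i\<in>I. (X i - y)^2) = (\<Sum>i\<in>I. (X i - x)^2 + 2 * (x - y) * (X i - x) + (x - y)^2)"
      by (rule sum.cong) (auto simp: power2_eq_square algebra_simps)
    also have "\<dots> = (\<Sum>i\<in>I. (X i - x)^2) + real (card I) * (x - y)^2"
      using mean by (simp add: sum.distrib sum_subtractf sum_distrib_left[symmetric])
    finally show ?thesis by simp
  qed
  finally show ?thesis by simp
qed

text \<open>The induction peels off the first block, so it ranges over all initial laws \<open>E\<close> of the admissible kind; the
  term \<open>R \<Sum> u\<^sup>2\<close> is the energy budget from which the spread over that block is paid.\<close>
lemma lower_tail:
  assumes k: "2 \<le> k" "k \<le> N" and h: "odd_fun N h"
    and drift: "\<And>x. 1 \<le> x \<Longrightarrow> 2 * x \<le> N + 1 \<Longrightarrow> 0 \<le> card_gen N k h x + l * h x"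
    and l: "0 \<le> l" "l \<le> 1" and R: "\<And>i. i \<in> {1..N+1-k} \<Longrightarrow> (\<Sum>x\<in>{i..<i+k}. (h x - h i)^2) \<le> R"
    and w: "\<And>c. \<bar>w c\<bar> \<le> 1"
    and E: "deck_mean E" "neg_corr N w E" "decr N (\<lambda>x. E (\<lambda>\<xi>. w (\<xi> x)))"
  shows "E ((deck_step N k ^^ n) (\<lambda>\<xi>. (max 0 (c - stat N h w \<xi>))^2))
    \<le> (max 0 (c - (1 - l / real (N+1-k)) ^ n * (\<Sum>x\<in>{1..N}. h x * E (\<lambda>\<xi>. w (\<xi> x)))))^2
      + R * (\<Sum>x\<in>{1..N}. (E (\<lambda>\<xi>. w (\<xi> x)))^2) + 2 * (\<Sum>x\<in>{1..N}. (h x)^2)"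
  using E
proof (induction n arbitrary: E)
  case 0
  interpret deck_mean E by fact
  have "0 \<le> R" using R[of 1] k by (intro order_trans[OF sum_nonneg R[of 1]]) auto
  hence "0 \<le> R * (\<Sum>x\<in>{1..N}. (E (\<lambda>\<xi>. w (\<xi> x)))^2)" by (intro mult_nonneg_nonneg sum_nonneg) auto
  moreover note lower_deviation[OF mean_stat[of N h w], of c] variance_stat[OF 0(2) w, of h]
  ultimately show ?case by simp
next
  case (Suc n)
  interpret deck_mean E by fact
  define r where "r = real (N+1-k)"
  define q where "q = 1 - l / r"
  define I where "I = {1..N+1-k}"
  define u where "u = (\<lambda>x. E (\<lambda>\<xi>. w (\<xi> x)))"
  define G where "G = (deck_step N k ^^ n) (\<lambda>\<xi>. (max 0 (c - stat N h w \<xi>))^2)"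
  define X where "X = (\<lambda>i. \<Sum>x\<in>{1..N}. h x * block_avg k i u x)"
  define V where "V = (\<lambda>i. \<Sum>x\<in>{1..N}. (block_avg k i u x)^2)"
  define H where "H = 2 * (\<Sum>x\<in>{1..N}. (h x)^2)"
  define M where "M = (\<Sum>x\<in>{1..N}. h x * u x)"
  have r: "1 \<le> r" "real (card I) = r" using k by (auto simp: r_def I_def)
  have fI: "finite I" by (simp add: I_def)
  have "l / r \<le> 1" using l r by (simp add: divide_le_eq)
  hence q: "0 \<le> q" "q \<le> 1" using l r by (auto simp: q_def)
  have k0: "0 < k" using k by simp
  have IH: "E (block_mix k i G) \<le> (max 0 (c - q ^ n * X i))^2 + R * V i + H" if i: "i \<in> I" for i
  proof -
    have i': "i \<in> {1..N+1-k}" using i by (simp add: I_def)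
    have pr: "(\<lambda>x. E (block_mix k i (\<lambda>\<xi>. w (\<xi> x)))) = block_avg k i u"
      unfolding u_def by (rule ext) (rule deck_mean_block_mix_point[OF Suc.prems(1)])
    have "decr N (\<lambda>x. E (block_mix k i (\<lambda>\<xi>. w (\<xi> x))))"
      unfolding pr by (rule decr_block_avg[OF _ i' k0]) (use Suc.prems(3) in \<open>simp add: u_def\<close>)
    from Suc.IH[OF deck_mean_block_mix[OF Suc.prems(1)] neg_corr_block_mix[OF Suc.prems(1,2) i' k(1)] this]
    show ?thesis unfolding G_def[symmetric] fun_cong[OF pr] X_def V_def H_def q_def r_def .
  qed
  \<comment> \<open>\<open>R\<close> times the energy lost by the profile when block
    \<open>i\<close> is averaged pays for the jump of the mean.\<close>
  have inc: "(X i - M)^2 \<le> R * ((\<Sum>x\<in>{1..N}. (u x)^2) - V i)" if i: "i \<in> I" for i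
    unfolding X_def M_def V_def by (rule block_avg_increment[OF _ k0 R]) (use i in \<open>auto simp: I_def\<close>)
  define x where "x = (\<Sum>x\<in>{1..N}. h x * card_step N k u x)"
  have mean: "(\<Sum>i\<in>I. X i) = real (card I) * x"
    unfolding X_def r(2) x_def card_step_def r_def[symmetric] I_def[symmetric]
    using r by (subst sum.swap) (simp add: sum_distrib_left[symmetric] sum_divide_distrib[symmetric])
  have "q * M \<le> x"
    unfolding q_def r_def M_def x_def
    by (rule card_step_drift_ge[OF k(2) h _ drift]) (use Suc.prems(3) in \<open>auto simp: u_def\<close>)
  hence "q ^ Suc n * M \<le> q ^ n * x"
    using mult_left_mono[of "q * M" x "q ^ n"] q by (simp add: mult_ac)
  hence a: "c - q ^ n * x \<le> max 0 (c - q ^ Suc n * M)" by linarith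
  have "E (deck_step N k G) = (\<Sum>i\<in>I. E (block_mix k i G)) / r"
    unfolding deck_step_def r_def[symmetric] I_def[symmetric] by (simp add: div sum fI)
  also have "\<dots> \<le> (\<Sum>i\<in>I. (max 0 (c - q ^ n * X i))^2 + R * V i + H) / r"
    using r by (intro divide_right_mono sum_mono IH) auto
  also have "(\<Sum>i\<in>I. (max 0 (c - q ^ n * X i))^2 + R * V i + H)
    \<le> (r * (max 0 (c - q ^ Suc n * M))^2 + (\<Sum>i\<in>I. (X i - M)^2)) + (\<Sum>i\<in>I. R * V i) + r * H"
    using sum_lower_deviation[OF fI mean _ _ _ a, of M] q
    by (simp add: sum.distrib r power_le_one)
  \<comment> \<open>The released energy and the remaining budget \<open>R * V i\<close> add up to
    the full budget for every \<open>i\<close>, which closes the induction.\<close>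
  also have "\<dots> \<le> (r * (max 0 (c - q ^ Suc n * M))^2 + (\<Sum>i\<in>I. R * ((\<Sum>x\<in>{1..N}. (u x)^2) - V i))) + (\<Sum>i\<in>I. R * V i) + r * H"
    by (intro add_mono order.refl sum_mono inc)
  also have "\<dots> = r * ((max 0 (c - q ^ Suc n * M))^2 + R * (\<Sum>x\<in>{1..N}. (u x)^2) + H)"
    by (simp add: right_diff_distrib sum_subtractf r algebra_simps)
  finally have "E (deck_step N k G) \<le> (max 0 (c - q ^ Suc n * M))^2 + R * (\<Sum>x\<in>{1..N}. (u x)^2) + H"
    using r by (simp add: divide_right_mono)
  thus ?case unfolding G_def M_def H_def u_def q_def r_def by simp
qed

text \<open>For odd \<open>N\<close> the middle label gets \<open>sgn 0 = 0\<close>, which keeps the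
  labelling odd and its uniform mean zero.\<close>

definition left_sign :: "nat \<Rightarrow> nat \<Rightarrow> real" where
  "left_sign N x = sgn (centered N x)"

lemma abs_left_sign: "\<bar>left_sign N x\<bar> \<le> 1"
  by (simp add: left_sign_def sgn_real_def)

lemma decr_left_sign: "decr N (left_sign N)"
proof -
  have "sgn b \<le> sgn a" if "b \<le> a" for a b :: real using that by (auto simp: sgn_real_def)
  thus ?thesis using decr_centered[of N] by (simp add: decr_def left_sign_def)
qed

lemma odd_left_sign: "odd_fun N (left_sign N)"
  using odd_centered[of N] by (simp add: odd_fun_def left_sign_def sgn_minus)

lemma sum_odd: "odd_fun N u \<Longrightarrow> (\<Sum>x\<in>{1..N}. u x) = 0"
  using sum_reflect[of u N] by (simp add: odd_fun_def sum_negf)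

lemma pi_sq_less: "pi^2 < 10"
proof -
  have "pi < 3.15" using pi_approx by simp
  hence "pi^2 < 3.15^2" by (rule power_strict_mono) auto
  thus ?thesis by (simp add: power2_eq_square)
qed

lemma angle_bounds:
  fixes k N :: nat
  assumes k: "2 \<le> k" "8 * k \<le> N" and \<theta>_def: "\<theta> = pi / (real N - 2 * real k)"
  shows "pi / real N \<le> \<theta>" "\<theta> \<le> 4 / 3 * (pi / real N)"
proof -
  have kr: "2 \<le> real k" "8 * real k \<le> real N" using k by linarith+
  have N: "0 < real N" "0 < real N - 2 * real k" "4 * (real N - 2 * real k) \<ge> 3 * real N" using kr by simp_all
  show "pi / real N \<le> \<theta>" unfolding \<theta>_def by (rule divide_left_mono) (use N in auto)
  have "pi / (real N - 2 * real k) \<le> pi / (3 / 4 * real N)" by (rule divide_left_mono) (use N in auto)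
  thus "\<theta> \<le> 4 / 3 * (pi / real N)" unfolding \<theta>_def by simp
qed

text \<open>The one place where \<open>k\<close> below \<open>N\<close> to the power 2/3 enters the
  lower bound estimates: it makes the block energy \<open>R\<close> at most 2 and the rate
  \<open>l\<close> at most 1.\<close>

lemma angle_cube_le:
  fixes k N :: nat
  assumes k: "2 \<le> k" "8 * k \<le> N" "16 * k ^ 3 \<le> N ^ 2" and \<theta>_def: "\<theta> = pi / (real N - 2 * real k)"
  shows "\<theta>^2 * real k ^ 3 \<le> 2"
proof -
  have N: "0 < real N" using k by linarith
  have t: "0 \<le> \<theta>" using angle_bounds(1)[OF k(1,2) \<theta>_def] by (rule order_trans[rotated]) simp
  have k3: "16 * real k ^ 3 \<le> real N ^ 2" using k(3) of_nat_mono[of "16 * k^3" "N^2", where ?'a = real] by simp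
  have "\<theta>^2 * real k ^ 3 \<le> (4 / 3 * (pi / real N))^2 * (real N ^ 2 / 16)"
    using angle_bounds(2)[OF k(1,2) \<theta>_def] t k3 by (intro mult_mono power_mono) auto
  also have "\<dots> = pi^2 / 9" using N by (simp add: power_mult_distrib power_divide)
  also have "\<dots> \<le> 2" using pi_sq_less by simp
  finally show ?thesis .
qed

lemma sine_wave_lipschitz:
  assumes "0 \<le> \<theta>"
  shows "\<bar>sine_wave N \<theta> x - sine_wave N \<theta> y\<bar> \<le> \<theta> * \<bar>real x - real y\<bar>"
proof -
  have lip: "\<bar>sin a - sin b\<bar> \<le> \<bar>a - b\<bar>" for a b :: real
  proof -
    have "\<bar>sin a - sin b\<bar> = 2 * (\<bar>sin ((a - b) / 2)\<bar> * \<bar>cos ((a + b) / 2)\<bar>)"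
      unfolding sin_diff_sin by (simp add: abs_mult)
    also have "\<dots> \<le> 2 * (\<bar>(a - b) / 2\<bar> * 1)"
      by (intro mult_left_mono mult_mono abs_sin_x_le_abs_x) auto
    finally show ?thesis by simp
  qed
  have "\<bar>\<theta> * ((real N + 1) / 2 - real x) - \<theta> * ((real N + 1) / 2 - real y)\<bar> = \<theta> * \<bar>real x - real y\<bar>"
    unfolding right_diff_distrib[symmetric] using assms by (simp add: abs_mult abs_minus_commute)
  thus ?thesis using lip[of "\<theta> * ((real N + 1) / 2 - real x)" "\<theta> * ((real N + 1) / 2 - real y)"]
    by (simp add: sine_wave_def)
qed

lemma sine_wave_block_energy:
  assumes "0 \<le> \<theta>"
  shows "(\<Sum>x\<in>{i..<i+k}. (sine_wave N \<theta> x - sine_wave N \<theta> i)^2) \<le> \<theta>^2 * real k ^ 3"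
proof -
  have "(sine_wave N \<theta> x - sine_wave N \<theta> i)^2 \<le> (\<theta> * real k)^2" if "x \<in> {i..<i+k}" for x
  proof -
    have "\<bar>sine_wave N \<theta> x - sine_wave N \<theta> i\<bar> \<le> \<theta> * \<bar>real x - real i\<bar>"
      by (rule sine_wave_lipschitz[OF assms])
    also have "\<dots> \<le> \<theta> * real k" using that assms by (intro mult_left_mono) auto
    finally have "\<bar>sine_wave N \<theta> x - sine_wave N \<theta> i\<bar>^2 \<le> (\<theta> * real k)^2" by (rule power_mono) simp
    thus ?thesis by simp
  qed
  hence "(\<Sum>x\<in>{i..<i+k}. (sine_wave N \<theta> x - sine_wave N \<theta> i)^2) \<le> real (card {i..<i+k}) * (\<theta> * real k)^2"
    by (rule sum_bounded_above)
  thus ?thesis by (simp add: power2_eq_square power3_eq_cube mult_ac)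
qed

text \<open>All terms are nonnegative. Between \<open>N / 4\<close> and \<open>3 * N / 8\<close>
  there are at least \<open>N / 16\<close> positions, the phase lies in \<open>{pi/8..pi/2}\<close>
  and the chord bound gives at least 1/4: hence \<open>N / 64\<close>.\<close>

lemma initial_stat_ge:
  fixes k N :: nat
  assumes k: "2 \<le> k" "8 * k \<le> N" and \<theta>_def: "\<theta> = pi / (real N - 2 * real k)"
  shows "real N / 64 \<le> (\<Sum>x\<in>{1..N}. sine_wave N \<theta> x * left_sign N x)"
proof -
  have N16: "16 \<le> real N" using k by linarith
  hence N: "0 < real N" by simp
  note \<theta> = angle_bounds[OF k \<theta>_def]
  have "0 \<le> \<theta>" using \<theta>(1) by (rule order_trans[rotated]) simp
  have half: "0 \<le> sine_wave N \<theta> x * left_sign N x" if "1 \<le> x" "2 * x \<le> N + 1" for x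
  proof -
    have xr: "1 \<le> real x" "2 * real x \<le> real N + 1" using that by linarith+
    have "\<theta> * ((real N + 1) / 2 - real x) \<le> (4 / 3 * (pi / real N)) * (real N / 2)"
      using \<theta>(2) by (rule mult_mono) (use xr in \<open>simp_all add: field_simps\<close>)
    also have "\<dots> \<le> pi" using N by simp
    finally have "0 \<le> sine_wave N \<theta> x"
      unfolding sine_wave_def using xr \<open>0 \<le> \<theta>\<close> by (intro sin_ge_zero mult_nonneg_nonneg) (simp_all add: field_simps)
    moreover have "0 \<le> left_sign N x" using xr by (simp add: left_sign_def centered_def sgn_real_def)
    ultimately show ?thesis by simp
  qed
  have nn: "0 \<le> sine_wave N \<theta> x * left_sign N x" if x: "x \<in> {1..N}" for x
  proof (cases "2 * x \<le> N + 1")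
    case True
    thus ?thesis using half x by simp
  next
    case False
    have "sine_wave N \<theta> x * left_sign N x = sine_wave N \<theta> (N+1-x) * left_sign N (N+1-x)"
      using odd_sine_wave[of N \<theta>] odd_left_sign[of N] x by (simp add: odd_fun_def)
    also have "\<dots> \<ge> 0" by (rule half) (use x False in auto)
    finally show ?thesis .
  qed
  define A where "A = {N div 4 + 1..N div 4 + N div 8}"
  have A: "A \<subseteq> {1..N}" by (auto simp: A_def)
  have big: "1 / 4 \<le> sine_wave N \<theta> x * left_sign N x" if "x \<in> A" for x
  proof -
    have "N < 4 * x" "8 * x \<le> 3 * N" using that by (auto simp: A_def)
    hence xr: "real N < 4 * real x" "8 * real x \<le> 3 * real N" by linarith+
    have "pi / real N * (real N / 8) \<le> \<theta> * ((real N + 1) / 2 - real x)"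
      using \<theta>(1) by (rule mult_mono) (use xr \<open>0 \<le> \<theta>\<close> in \<open>simp_all add: field_simps\<close>)
    hence lo: "pi / 8 \<le> \<theta> * ((real N + 1) / 2 - real x)" using N by simp
    have "\<theta> * ((real N + 1) / 2 - real x) \<le> (4 / 3 * (pi / real N)) * (3 / 8 * real N)"
      using \<theta>(2) by (rule mult_mono) (use xr N16 in \<open>simp_all add: field_simps\<close>)
    hence hi: "\<theta> * ((real N + 1) / 2 - real x) \<le> pi / 2" using N by simp
    have "1 / 4 = 2 * (pi / 8) / pi" by simp
    also have "\<dots> \<le> 2 * (\<theta> * ((real N + 1) / 2 - real x)) / pi"
      using lo by (intro divide_right_mono mult_left_mono) auto
    also have "\<dots> \<le> sine_wave N \<theta> x"
      unfolding sine_wave_def by (rule jordan_sin[OF _ hi]) (rule order_trans[OF _ lo], simp)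
    finally have "1 / 4 \<le> sine_wave N \<theta> x" .
    moreover have "left_sign N x = 1" using xr N by (simp add: left_sign_def centered_def)
    ultimately show ?thesis by simp
  qed
  have "real N / 16 \<le> real (N div 8)"
  proof -
    have "N \<le> 16 * (N div 8)" using k by linarith
    thus ?thesis by linarith
  qed
  hence "real N / 64 \<le> real (card A) * (1 / 4)" by (simp add: A_def)
  also have "\<dots> \<le> (\<Sum>x\<in>A. sine_wave N \<theta> x * left_sign N x)" by (rule sum_bounded_below[OF big])
  also have "\<dots> \<le> (\<Sum>x\<in>{1..N}. sine_wave N \<theta> x * left_sign N x)"
    by (rule sum_mono2[OF _ A]) (use nn in auto)
  finally show ?thesis .
qed

text \<open>The uniform law is one shuffle of a single block of all \<open>N\<close> cards, so the
  bounds for block shuffles apply; the mean vanishes because \<open>w\<close> is odd.\<close>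

lemma uniform_second_moment:
  assumes N: "2 \<le> N" and w: "odd_fun N w" "\<And>c. \<bar>w c\<bar> \<le> 1"
  shows "(\<Sum>\<xi>\<in>decks N. (stat N h w \<xi>)^2) / fact N \<le> 2 * (\<Sum>m\<in>{1..N}. (h m)^2)"
proof -
  define E where "E = (\<lambda>f. block_mix N 1 f id)"
  have E: "deck_mean E" unfolding E_def by (rule deck_mean_block_mix[OF deck_mean_eval])
  interpret deck_mean E by fact
  have "neg_corr N w (\<lambda>f. f id)" by (simp add: neg_corr_def)
  hence nc: "neg_corr N w E" unfolding E_def by (rule neg_corr_block_mix[OF deck_mean_eval]) (use N in auto)
  have ival: "{1..<1+N} = {1..N}" by auto
  have zero: "h m * E (\<lambda>\<xi>. w (\<xi> m)) = 0" if "m \<in> {1..N}" for m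
    unfolding E_def deck_mean_block_mix_point[OF deck_mean_eval] block_avg_def ival
    using that sum_odd[OF w(1)] by simp
  have "E (\<lambda>\<xi>. (stat N h w \<xi>)^2) \<le> 2 * (\<Sum>m\<in>{1..N}. (h m)^2)"
    using variance_stat[OF nc w(2), of h] by (simp add: zero sum.neutral)
  moreover have "E f = (\<Sum>\<xi>\<in>decks N. f \<xi>) / fact N" for f
    unfolding E_def block_mix_def ival decks_def by simp
  ultimately show ?thesis by simp
qed

lemma stat_bounded:
  assumes "\<And>m. \<bar>h m\<bar> \<le> 1" "\<And>c. \<bar>w c\<bar> \<le> 1"
  shows "\<bar>stat N h w \<xi>\<bar> \<le> real N"
proof -
  have "\<bar>stat N h w \<xi>\<bar> \<le> (\<Sum>m\<in>{1..N}. \<bar>h m * w (\<xi> m)\<bar>)" unfolding stat_def by (rule sum_abs)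
  also have "\<dots> \<le> (\<Sum>m\<in>{1..N}. 1)"
    by (rule sum_mono) (use assms in \<open>auto simp: abs_mult intro!: mult_le_one\<close>)
  finally show ?thesis by simp
qed

text \<open>The term \<open>exp (l\<^sup>2 t / r) - 1\<close> is the relative variance of \<open>(1 - l / r) ^ n\<close> for a Poisson number
  \<open>n\<close> of steps.\<close>
lemma heat_lower_tail:
  assumes k: "2 \<le> k" "k \<le> N" and t: "0 \<le> t" and h: "odd_fun N h" "\<And>m. \<bar>h m\<bar> \<le> 1"
    and drift: "\<And>x. 1 \<le> x \<Longrightarrow> 2 * x \<le> N + 1 \<Longrightarrow> 0 \<le> card_gen N k h x + l * h x"
    and l: "0 \<le> l" "l \<le> 1" and R: "0 \<le> R" "\<And>i. i \<in> {1..N+1-k} \<Longrightarrow> (\<Sum>x\<in>{i..<i+k}. (h x - h i)^2) \<le> R"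
    and w: "\<And>c. \<bar>w c\<bar> \<le> 1" "decr N w"
    and c: "c = exp (- (l * t)) * (\<Sum>x\<in>{1..N}. h x * w x)"
  shows "heat_mean N k t (\<lambda>\<xi>. (max 0 (c - stat N h w \<xi>))^2) id
    \<le> c^2 * (exp (l^2 * t / real (N+1-k)) - 1) + (R + 2) * real N"
proof -
  define M where "M = (\<Sum>x\<in>{1..N}. h x * w x)"
  define r where "r = real (N+1-k)"
  define q where "q = 1 - l / r"
  define p where "p = poisson (r * t)"
  define Psi where "Psi = (\<lambda>\<xi>. (max 0 (c - stat N h w \<xi>))^2)"
  have r: "0 < r" using k by (simp add: r_def)
  have p0: "0 \<le> p n" for n unfolding p_def by (rule poisson_nonneg) (use r t in simp)
  have sq1: "(z::real)^2 \<le> 1" if "\<bar>z\<bar> \<le> 1" for z using that by (simp add: abs_square_le_1)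
  have sumw: "(\<Sum>x\<in>{1..N}. (w x)^2) \<le> real N" "(\<Sum>x\<in>{1..N}. (h x)^2) \<le> real N"
    using sum_bounded_above[of "{1..N}" "\<lambda>x. (w x)^2" 1] sum_bounded_above[of "{1..N}" "\<lambda>x. (h x)^2" 1] sq1 w(1) h(2)
    by simp_all
  have bnd: "\<bar>Psi \<xi>\<bar> \<le> (\<bar>c\<bar> + real N)^2" for \<xi>
  proof -
    have "max 0 (c - stat N h w \<xi>) \<le> \<bar>c\<bar> + real N" using stat_bounded[of h w N \<xi>, OF h(2) w(1)] by linarith
    thus ?thesis unfolding Psi_def by (simp add: power_mono)
  qed
  have each: "(deck_step N k ^^ n) Psi id \<le> (c - q ^ n * M)^2 + (R + 2) * real N" for n
  proof -
    have nc: "neg_corr N w (\<lambda>f. f id)" by (simp add: neg_corr_def)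
    have "(deck_step N k ^^ n) Psi id \<le> (max 0 (c - q ^ n * M))^2 + R * (\<Sum>x\<in>{1..N}. (w x)^2) + 2 * (\<Sum>x\<in>{1..N}. (h x)^2)"
      using lower_tail[OF k h(1) drift l R(2) w(1) deck_mean_eval[of id] nc, of n c] w(2)
      by (simp add: Psi_def q_def r_def M_def)
    also have "\<dots> \<le> (c - q ^ n * M)^2 + R * real N + 2 * real N"
      using sumw R(1) by (intro add_mono mult_left_mono max0_sq_le) auto
    finally show ?thesis by (simp add: distrib_right)
  qed
  have eq: "r * t * (1 - q) = l * t" using r by (simp add: q_def)
  have eq2: "r * t * (1 - q^2) = 2 * (l * t) - l^2 * t / r"
    using r by (simp add: q_def power2_eq_square field_simps)
  have cM: "c = exp (- (l * t)) * M" using c by (simp add: M_def)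
  \<comment> \<open>Expanding the square calls for the generating function at \<open>1\<close>,
    \<open>q\<close> and \<open>q^2\<close>. As \<open>c\<close> is the Poisson mean of
    \<open>q ^ n * M\<close>, what is left of the square is the variance of that quantity.\<close>
  have "(\<lambda>n. (c^2 + (R + 2) * real N) * p n + (- 2 * c * M) * (p n * q ^ n) + M^2 * (p n * (q^2) ^ n))
     sums ((c^2 + (R + 2) * real N) * 1 + (- 2 * c * M) * exp (- (r * t * (1 - q))) + M^2 * exp (- (r * t * (1 - q^2))))"
    unfolding p_def by (intro sums_add sums_mult poisson_sums poisson_generating)
  also have "(\<lambda>n. (c^2 + (R + 2) * real N) * p n + (- 2 * c * M) * (p n * q ^ n) + M^2 * (p n * (q^2) ^ n))
     = (\<lambda>n. p n * ((c - q ^ n * M)^2 + (R + 2) * real N))"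
    by (auto simp: fun_eq_iff power2_eq_square power_mult_distrib algebra_simps)
  also have "(c^2 + (R + 2) * real N) * 1 + (- 2 * c * M) * exp (- (r * t * (1 - q))) + M^2 * exp (- (r * t * (1 - q^2)))
     = c^2 * (exp (l^2 * t / r) - 1) + (R + 2) * real N"
  proof -
    have "- 2 * c * M * exp (- (l * t)) = - 2 * c^2" unfolding cM by (simp add: power2_eq_square)
    moreover have "M^2 * exp (- (2 * (l * t) - l^2 * t / r)) = c^2 * exp (l^2 * t / r)"
    proof -
      have "exp (- (2 * (l * t) - l^2 * t / r)) = exp (- (l * t)) * exp (- (l * t)) * exp (l^2 * t / r)"
        by (simp add: exp_add[symmetric])
      thus ?thesis unfolding cM by (simp add: power2_eq_square)
    qed
    ultimately show ?thesis unfolding eq eq2 by (simp add: algebra_simps)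
  qed
  finally have S: "(\<lambda>n. p n * ((c - q ^ n * M)^2 + (R + 2) * real N)) sums (c^2 * (exp (l^2 * t / r) - 1) + (R + 2) * real N)" .
  have "heat_mean N k t Psi id \<le> (\<Sum>n. p n * ((c - q ^ n * M)^2 + (R + 2) * real N))"
    unfolding heat_mean_def p_def r_def
    by (intro suminf_le mult_left_mono heat_mean_summable[OF k(2) t bnd])
      (use each p0 sums_summable[OF S] in \<open>simp_all add: p_def r_def\<close>)
  thus ?thesis using sums_unique[OF S] by (simp add: Psi_def r_def)
qed

lemma heat_mean_mono:
  assumes k: "k \<le> N" and t: "0 \<le> t" and f: "\<And>\<xi>. \<bar>f \<xi>\<bar> \<le> C" and g: "\<And>\<xi>. \<bar>g \<xi>\<bar> \<le> D" and le: "\<And>\<xi>. f \<xi> \<le> g \<xi>"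
  shows "heat_mean N k t f \<eta> \<le> heat_mean N k t g \<eta>"
  unfolding heat_mean_def
proof (rule suminf_le)
  fix n show "poisson (real (N+1-k) * t) n * (deck_step N k ^^ n) f \<eta> \<le> poisson (real (N+1-k) * t) n * (deck_step N k ^^ n) g \<eta>"
    by (rule mult_left_mono[OF deck_step_funpow_mono[OF le] poisson_nonneg]) (use t in simp)
qed (rule heat_mean_summable[OF k t f], rule heat_mean_summable[OF k t g])

lemma deck_step_funpow_scale:
  "(deck_step N k ^^ n) (\<lambda>\<xi>. c * f \<xi>) = (\<lambda>\<eta>. c * (deck_step N k ^^ n) f \<eta>)"
  by (induction n) (simp_all add: deck_step_scale[abs_def])

lemma heat_mean_scale:
  assumes k: "k \<le> N" and t: "0 \<le> t" and f: "\<And>\<xi>. \<bar>f \<xi>\<bar> \<le> C"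
  shows "heat_mean N k t (\<lambda>\<xi>. c * f \<xi>) \<eta> = c * heat_mean N k t f \<eta>"
  using suminf_mult[OF heat_mean_summable[OF k t f, where \<eta> = \<eta>], of c]
  by (simp add: heat_mean_def deck_step_funpow_scale mult.left_commute)

text \<open>Chebyshev on both sides of the threshold \<open>c / 2\<close>, half the mean at time
  \<open>t\<close>: the chain is rarely below it, the uniform law rarely above. The starting deck
  \<open>id\<close> carries the labels \<open>left_sign\<close> in decreasing order, as
  \<open>lower_tail\<close> requires.\<close>

lemma shuffle_tv_id_ge:
  assumes k: "2 \<le> k" "8 * k \<le> N" "16 * k ^ 3 \<le> N ^ 2" and t: "0 \<le> t"
    and l: "l = pi^2 * (real k * (real k ^ 2 - 1)) / (12 * (real N - 2 * real k)^2)"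
  shows "1 - 98304 * exp (2 * (l * t)) / real N - 4 * (exp (2 * (l * t) / real N) - 1) \<le> shuffle_tv N k t id"
proof -
  define \<theta> where "\<theta> = pi / (real N - 2 * real k)"
  define h where "h = sine_wave N \<theta>"
  define w where "w = left_sign N"
  define M where "M = (\<Sum>x\<in>{1..N}. h x * w x)"
  define c where "c = exp (- (l * t)) * M"
  define Psi where "Psi = (\<lambda>\<xi>. (max 0 (c - stat N h w \<xi>))^2)"
  define A where "A = (\<lambda>\<xi>. stat N h w \<xi> < c / 2)"
  have N: "0 < real N" "2 \<le> N" "k \<le> N" "1 \<le> k" using k by linarith+
  have \<theta>0: "0 \<le> \<theta>" using angle_bounds(1)[OF k(1,2) \<theta>_def] by (rule order_trans[rotated]) simp
  have l\<theta>: "l = \<theta>^2 * (real k * (real k ^ 2 - 1)) / 12" unfolding l \<theta>_def by (simp add: power_divide)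
  have k2: "0 \<le> real k ^ 2 - 1" using k by simp
  have l0: "0 \<le> l" unfolding l\<theta> using k2 by simp
  have cub: "\<theta>^2 * real k ^ 3 \<le> 2" by (rule angle_cube_le[OF k \<theta>_def])
  have "\<theta>^2 * (real k * (real k ^ 2 - 1)) \<le> \<theta>^2 * real k ^ 3"
    by (rule mult_left_mono) (auto simp: power3_eq_cube power2_eq_square algebra_simps)
  hence l1: "l \<le> 1" using cub unfolding l\<theta> by simp
  have M: "real N / 64 \<le> M" unfolding M_def h_def w_def by (rule initial_stat_ge[OF k(1,2) \<theta>_def])
  hence M0: "0 < M" using N by (intro less_le_trans[OF _ M]) simp
  hence c0: "0 < c" by (simp add: c_def)
  have h1: "\<bar>h m\<bar> \<le> 1" for m by (simp add: h_def sine_wave_def)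
  have w1: "\<bar>w m\<bar> \<le> 1" for m by (simp add: w_def abs_left_sign)
  have sumh: "(\<Sum>x\<in>{1..N}. (h x)^2) \<le> real N"
    using sum_bounded_above[of "{1..N}" "\<lambda>x. (h x)^2" 1] h1 by (simp add: abs_square_le_1)
  have drift: "0 \<le> card_gen N k h x + l * h x" if "1 \<le> x" "2 * x \<le> N + 1" for x
    unfolding h_def l\<theta> by (rule sine_wave_subsolution[OF _ _ that \<theta>_def]) (use k in auto)
  have tail: "heat_mean N k t Psi id \<le> c^2 * (exp (l^2 * t / real (N+1-k)) - 1) + 4 * real N"
  proof -
    have "heat_mean N k t Psi id \<le> c^2 * (exp (l^2 * t / real (N+1-k)) - 1) + (2 + 2) * real N"
      unfolding Psi_def
    proof (rule heat_lower_tail[OF k(1) N(3) t _ h1 drift l0 l1])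
      show "odd_fun N h" unfolding h_def by (rule odd_sine_wave)
      show "(\<Sum>x\<in>{i..<i+k}. (h x - h i)^2) \<le> 2" for i
        unfolding h_def by (rule order_trans[OF sine_wave_block_energy[OF \<theta>0] cub])
      show "decr N w" unfolding w_def by (rule decr_left_sign)
    qed (use w1 in \<open>auto simp: c_def M_def\<close>)
    thus ?thesis by simp
  qed
  have Psib: "\<bar>Psi \<xi>\<bar> \<le> (\<bar>c\<bar> + real N)^2" for \<xi>
  proof -
    have "max 0 (c - stat N h w \<xi>) \<le> \<bar>c\<bar> + real N" using stat_bounded[of h w N \<xi>, OF h1 w1] by linarith
    thus ?thesis unfolding Psi_def by (simp add: power_mono)
  qed
  have AP: "of_bool (A \<xi>) \<le> 4 / c^2 * Psi \<xi>" for \<xi>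
  proof (cases "A \<xi>")
    case True
    have "(c / 2)^2 \<le> Psi \<xi>" unfolding Psi_def using True c0 by (intro power_mono) (auto simp: A_def)
    thus ?thesis using True c0 by (simp add: field_simps)
  qed (simp add: Psi_def)
  have "heat_mean N k t (\<lambda>\<xi>. of_bool (A \<xi>)) id \<le> heat_mean N k t (\<lambda>\<xi>. 4 / c^2 * Psi \<xi>) id"
  proof (rule heat_mean_mono[OF N(3) t _ _ AP])
    show "\<bar>of_bool (A \<xi>) :: real\<bar> \<le> 1" for \<xi> by simp
    show "\<bar>4 / c^2 * Psi \<xi>\<bar> \<le> 4 / c^2 * (\<bar>c\<bar> + real N)^2" for \<xi>
      unfolding abs_mult using Psib[of \<xi>] by (intro mult_mono) auto
  qed
  also have "\<dots> = 4 / c^2 * heat_mean N k t Psi id" by (rule heat_mean_scale[OF N(3) t Psib])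
  also have "\<dots> \<le> 4 / c^2 * (c^2 * (exp (l^2 * t / real (N+1-k)) - 1) + 4 * real N)"
    by (rule mult_left_mono[OF tail]) simp
  also have "\<dots> = 4 * (exp (l^2 * t / real (N+1-k)) - 1) + 16 * real N / c^2"
    using c0 by (simp add: field_simps)
  also have "\<dots> \<le> 4 * (exp (2 * (l * t) / real N) - 1) + 16 * real N / c^2"
  proof -
    have "l^2 * t \<le> l * t" using l0 l1 t by (intro mult_right_mono) (auto simp: power2_eq_square mult_left_le)
    hence "l^2 * t / real (N+1-k) \<le> l * t / (real N / 2)"
      using l0 t k N by (intro frac_le) auto
    thus ?thesis by (simp add: mult_ac)
  qed
  finally have pA: "heat_mean N k t (\<lambda>\<xi>. of_bool (A \<xi>)) id \<le> 4 * (exp (2 * (l * t) / real N) - 1) + 16 * real N / c^2" .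
  have "(\<Sum>\<xi>\<in>decks N. 1 - of_bool (A \<xi>)) / fact N \<le> (\<Sum>\<xi>\<in>decks N. 4 / c^2 * (stat N h w \<xi>)^2) / fact N"
  proof (intro divide_right_mono sum_mono)
    fix \<xi> show "1 - of_bool (A \<xi>) \<le> 4 / c^2 * (stat N h w \<xi>)^2"
    proof (cases "A \<xi>")
      case False
      have "(c / 2)^2 \<le> (stat N h w \<xi>)^2" using False c0 by (intro power_mono) (auto simp: A_def)
      thus ?thesis using False c0 by (simp add: field_simps)
    qed simp
  qed simp
  also have "\<dots> = 4 / c^2 * ((\<Sum>\<xi>\<in>decks N. (stat N h w \<xi>)^2) / fact N)"
    by (simp add: sum_distrib_left)
  also have "\<dots> \<le> 4 / c^2 * (2 * real N)"
  proof (rule mult_left_mono)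
    have "(\<Sum>\<xi>\<in>decks N. (stat N h w \<xi>)^2) / fact N \<le> 2 * (\<Sum>m\<in>{1..N}. (h m)^2)"
      by (rule uniform_second_moment[OF N(2) _ w1]) (simp add: w_def odd_left_sign)
    thus "(\<Sum>\<xi>\<in>decks N. (stat N h w \<xi>)^2) / fact N \<le> 2 * real N" using sumh by linarith
  qed simp
  finally have "(\<Sum>\<xi>\<in>decks N. 1 - of_bool (A \<xi>)) / fact N \<le> 8 * real N / c^2" by simp
  hence uA: "1 - 8 * real N / c^2 \<le> (\<Sum>\<xi>\<in>decks N. of_bool (A \<xi>)) / fact N"
    by (simp only: sum_subtractf sum_constant card_decks diff_divide_distrib) simp
  have idd: "id \<in> decks N" by (simp add: decks_permutes permutes_id)
  \<comment> \<open>The 16 from the chain and the 8 from the uniform law make 24; with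
    \<open>c\<close> at least \<open>N / 64 * exp (- (l * t))\<close> the constant is
    \<open>24 * 64^2 = 98304\<close>.\<close>
  have cbound: "24 * real N / c^2 \<le> 98304 * exp (2 * (l * t)) / real N"
  proof -
    have "(real N / 64)^2 * exp (- (2 * (l * t))) \<le> M^2 * exp (- (2 * (l * t)))"
      using M N by (intro mult_right_mono power_mono) auto
    also have "\<dots> = c^2"
    proof -
      have "exp (- (2 * (l * t))) = exp (- (l * t)) * exp (- (l * t))" by (simp add: exp_add[symmetric])
      thus ?thesis by (simp add: c_def power2_eq_square)
    qed
    finally have "24 * real N / c^2 \<le> 24 * real N / ((real N / 64)^2 * exp (- (2 * (l * t))))"
      using N by (intro divide_left_mono mult_pos_pos) (use c0 in auto)
    also have "\<dots> = 98304 * exp (2 * (l * t)) / real N"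
      using N by (simp add: exp_minus field_simps power2_eq_square)
    finally show ?thesis .
  qed
  have "24 * real N / c^2 = 8 * real N / c^2 + 16 * real N / c^2" by (simp add: field_simps)
  with shuffle_tv_lower[OF N(4,3) t idd, of A] pA uA cbound show ?thesis by linarith
qed

section \<open>Mixing times\<close>

lemma tmix_le:
  assumes k: "2 \<le> k" "8 * k \<le> N" "16 * k ^ 3 \<le> N ^ 2" and \<epsilon>: "0 < \<epsilon>"
    and t: "0 \<le> t" "2 * real N ^ 3 * exp (- (real k * (real k ^ 2 - 1) / (96 * real N ^ 2) * t)) < \<epsilon>"
  shows "tmix N k \<epsilon> \<le> t"
proof -
  have k3: "k ^ 3 \<le> N ^ 2" using k(3) by linarith
  have "shuffle_tv N k t \<eta> < \<epsilon>" if "\<eta> \<in> decks N" for \<eta>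
    using shuffle_tv_upper[OF k(1,2) k3 t(1) that] t(2) by linarith
  thus ?thesis unfolding tmix_def using t(1) by (intro cInf_lower) (auto intro!: bdd_belowI[of _ 0])
qed

text \<open>The infimum of an empty set would say nothing, so the upper bound first supplies an
  admissible time. Then the lower bound on the distance, decreasing in \<open>t\<close>, excludes
  every time before \<open>T\<close>.\<close>

lemma tmix_ge:
  assumes k: "2 \<le> k" "8 * k \<le> N" "16 * k ^ 3 \<le> N ^ 2" and \<epsilon>: "0 < \<epsilon>"
    and l: "l = pi^2 * (real k * (real k ^ 2 - 1)) / (12 * (real N - 2 * real k)^2)"
    and T: "\<epsilon> \<le> 1 - 98304 * exp (2 * (l * T)) / real N - 4 * (exp (2 * (l * T) / real N) - 1)"
  shows "T \<le> tmix N k \<epsilon>"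
proof -
  define a where "a = real k * (real k ^ 2 - 1) / (96 * real N ^ 2)"
  have N: "0 < real N" using k by linarith
  have k2: "0 < real k ^ 2 - 1" "0 < real k"
    using k power_strict_mono[of 1 "real k" 2] by auto
  have a: "0 < a" unfolding a_def using k2 N by simp
  have l0: "0 \<le> l" unfolding l using k2 by simp
  have k3: "k ^ 3 \<le> N ^ 2" using k(3) by linarith
  \<comment> \<open>At \<open>t0\<close> the upper bound is at most \<open>\<epsilon> / 2\<close>;
    the maximum with 0 covers a negative logarithm.\<close>
  define t0 where "t0 = max 0 (ln (4 * real N ^ 3 / \<epsilon>) / a)"
  have "ln (4 * real N ^ 3 / \<epsilon>) / a \<le> t0" by (simp add: t0_def)
  hence "ln (4 * real N ^ 3 / \<epsilon>) \<le> a * t0" using a by (simp add: divide_le_eq mult.commute)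
  hence "exp (- (a * t0)) \<le> exp (- ln (4 * real N ^ 3 / \<epsilon>))" by simp
  also have "\<dots> = \<epsilon> / (4 * real N ^ 3)" using N \<epsilon> by (simp add: exp_minus)
  finally have "2 * real N ^ 3 * exp (- (a * t0)) \<le> 2 * real N ^ 3 * (\<epsilon> / (4 * real N ^ 3))"
    by (rule mult_left_mono) simp
  also have "\<dots> < \<epsilon>" using N \<epsilon> by simp
  finally have t0: "shuffle_tv N k t0 \<eta> < \<epsilon>" if "\<eta> \<in> decks N" for \<eta>
    using shuffle_tv_upper[OF k(1,2) k3 _ that, of t0] by (simp add: t0_def a_def)
  show ?thesis unfolding tmix_def
  proof (rule cInf_greatest)
    show "{t. 0 \<le> t \<and> (\<forall>\<eta>\<in>decks N. shuffle_tv N k t \<eta> < \<epsilon>)} \<noteq> {}" using t0 by (auto intro!: exI[of _ t0] simp: t0_def)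
  next
    fix t assume "t \<in> {t. 0 \<le> t \<and> (\<forall>\<eta>\<in>decks N. shuffle_tv N k t \<eta> < \<epsilon>)}"
    hence t: "0 \<le> t" "shuffle_tv N k t id < \<epsilon>" by (auto simp: decks_permutes permutes_id)
    show "T \<le> t"
    proof (rule ccontr)
      assume "\<not> T \<le> t"
      hence le: "2 * (l * t) \<le> 2 * (l * T)" using l0 by (intro mult_left_mono) auto
      have "98304 * exp (2 * (l * t)) / real N \<le> 98304 * exp (2 * (l * T)) / real N"
        using le by (intro divide_right_mono mult_left_mono) auto
      moreover have "exp (2 * (l * t) / real N) \<le> exp (2 * (l * T) / real N)"
        using le N by (simp add: divide_right_mono)
      moreover have False
        if "a \<le> a'" "b \<le> b'" "1 - a - 4 * (b - 1) \<le> v" "v < \<epsilon>" "\<epsilon> \<le> 1 - a' - 4 * (b' - 1)" for a a' b b' v :: real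
        using that unfolding right_diff_distrib by linarith
      ultimately show False using shuffle_tv_id_ge[OF k t(1) l] t(2) T by blast
    qed
  qed
qed

text \<open>At the time \<open>t\<close> with \<open>a * t = 3 * ln N + ln (4 / \<epsilon>)\<close>
  the upper bound equals \<open>\<epsilon> / 2\<close>. The ratio is then \<open>96 * 3\<close> plus
  a term that the assumption on \<open>N\<close> keeps below 12.\<close>

lemma tmix_ratio_le:
  assumes k: "2 \<le> k" "8 * k \<le> N" "16 * k ^ 3 \<le> N ^ 2" and \<epsilon>: "0 < \<epsilon>" "\<epsilon> < 1"
    and N: "96 * ln (4 / \<epsilon>) \<le> 12 * ln (real N)"
  shows "real k * (real k ^ 2 - 1) * tmix N k \<epsilon> / (real N ^ 2 * ln (real N)) \<le> 300"
proof -
  define a where "a = real k * (real k ^ 2 - 1) / (96 * real N ^ 2)"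
  define t where "t = ln (4 * real N ^ 3 / \<epsilon>) / a"
  have N0: "1 < real N" using k by linarith
  have k2: "0 < real k ^ 2 - 1" "0 < real k"
    using k power_strict_mono[of 1 "real k" 2] by auto
  have a: "0 < a" unfolding a_def using k2 N0 by simp
  have L: "ln (4 * real N ^ 3 / \<epsilon>) = 3 * ln (real N) + ln (4 / \<epsilon>)"
    using N0 \<epsilon> by (simp add: ln_mult ln_div ln_realpow)
  have l0: "0 < ln (real N)" using N0 by simp
  have "0 \<le> ln (4 / \<epsilon>)" using \<epsilon> by simp
  hence L0: "0 \<le> ln (4 * real N ^ 3 / \<epsilon>)" unfolding L using l0 by simp
  have "exp (- (a * t)) = \<epsilon> / (4 * real N ^ 3)"
    using a N0 \<epsilon> by (simp add: t_def exp_minus)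
  hence "2 * real N ^ 3 * exp (- (a * t)) < \<epsilon>" using N0 \<epsilon> by simp
  hence "tmix N k \<epsilon> \<le> t"
    unfolding a_def by (intro tmix_le[OF k \<epsilon>(1)]) (use L0 a in \<open>simp_all add: t_def\<close>)
  hence "real k * (real k ^ 2 - 1) * tmix N k \<epsilon> / (real N ^ 2 * ln (real N)) \<le> real k * (real k ^ 2 - 1) * t / (real N ^ 2 * ln (real N))"
    using k2 l0 N0 by (intro divide_right_mono mult_left_mono) auto
  also have "\<dots> = 96 * (a * t) / ln (real N)" using N0 by (simp add: a_def)
  also have "\<dots> = (288 * ln (real N) + 96 * ln (4 / \<epsilon>)) / ln (real N)" using a by (simp add: t_def L)
  also have "\<dots> \<le> 300" using N l0 by (simp add: divide_le_eq)
  finally show ?thesis .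
qed

text \<open>The time is chosen with \<open>2 * l * t = (1 - \<delta>) * ln N\<close>. Dividing by
  \<open>2 * l\<close> produces \<open>6 / pi^2\<close>, and the raised frequency survives as the
  factor \<open>(1 - 2 * k / N)^2\<close>.\<close>

lemma tmix_ratio_ge:
  assumes k: "2 \<le> k" "8 * k \<le> N" "16 * k ^ 3 \<le> N ^ 2" and \<epsilon>: "0 < \<epsilon>"
    and T: "\<epsilon> \<le> 1 - 98304 * exp ((1 - \<delta>) * ln (real N)) / real N - 4 * (exp ((1 - \<delta>) * ln (real N) / real N) - 1)"
  shows "(1 - \<delta>) * (6 / pi^2) * (1 - 2 * (real k / real N))^2
    \<le> real k * (real k ^ 2 - 1) * tmix N k \<epsilon> / (real N ^ 2 * ln (real N))"
proof -
  define l where "l = pi^2 * (real k * (real k ^ 2 - 1)) / (12 * (real N - 2 * real k)^2)"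
  define t where "t = (1 - \<delta>) * ln (real N) / (2 * l)"
  have N0: "1 < real N" "0 < real N - 2 * real k" using k by linarith+
  have k2: "0 < real k ^ 2 - 1" "0 < real k"
    using k power_strict_mono[of 1 "real k" 2] by auto
  have l: "0 < l" unfolding l_def using k2 N0 by simp
  have l0: "0 < ln (real N)" using N0 by simp
  have lt: "2 * (l * t) = (1 - \<delta>) * ln (real N)" using l by (simp add: t_def)
  have "t \<le> tmix N k \<epsilon>" by (rule tmix_ge[OF k \<epsilon> l_def]) (use T lt in simp)
  hence "real k * (real k ^ 2 - 1) * t / (real N ^ 2 * ln (real N)) \<le> real k * (real k ^ 2 - 1) * tmix N k \<epsilon> / (real N ^ 2 * ln (real N))"
    using k2 l0 N0 by (intro divide_right_mono mult_left_mono) auto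
  moreover have "real k * (real k ^ 2 - 1) * t / (real N ^ 2 * ln (real N)) = (1 - \<delta>) * (6 / pi^2) * (1 - 2 * (real k / real N))^2"
  proof -
    define K where "K = real k * (real k ^ 2 - 1)"
    have K: "0 < K" using k2 by (simp add: K_def)
    have "1 - 2 * (real k / real N) = (real N - 2 * real k) / real N" using N0 by (simp add: field_simps)
    thus ?thesis unfolding t_def l_def K_def[symmetric] using K N0 l0
      by (simp add: power_divide)
  qed
  ultimately show ?thesis by simp
qed

theorem theorem1p1:
  shows "\<exists>c::real. c > 0 \<and>
    (\<forall>k :: nat \<Rightarrow> nat. (\<forall>N. 2 \<le> k N) \<longrightarrow>
       (\<lambda>N. real (k N)) \<in> o(\<lambda>N. real N powr (2/3)) \<longrightarrow>
       (\<forall>\<epsilon>::real. 0 < \<epsilon> \<and> \<epsilon> < 1 \<longrightarrow>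
          (let r = (\<lambda>N. ereal (real (k N) * (real (k N) ^ 2 - 1) * tmix N (k N) \<epsilon>
                                   / (real N ^ 2 * ln (real N))))
           in ereal (6 / pi^2) \<le> liminf r \<and> liminf r \<le> limsup r \<and> limsup r \<le> ereal c)))"
proof (intro exI[of _ 300] conjI allI impI)
  show "(0::real) < 300" by simp
  fix k :: "nat \<Rightarrow> nat" and \<epsilon> :: real
  assume k2: "\<forall>N. 2 \<le> k N" and ko: "(\<lambda>N. real (k N)) \<in> o(\<lambda>N. real N powr (2/3))" and \<epsilon>: "0 < \<epsilon> \<and> \<epsilon> < 1"
  define \<rho> where "\<rho> = (\<lambda>N. real (k N) * (real (k N) ^ 2 - 1) * tmix N (k N) \<epsilon> / (real N ^ 2 * ln (real N)))"
  have small: "\<forall>\<^sub>F N in sequentially. 8 * k N \<le> N \<and> 16 * k N ^ 3 \<le> N ^ 2"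
  proof -
    \<comment> \<open>The constant 1/8 gives \<open>8 * k \<le> N\<close> directly, and its cube
      1/512 is well below the required 1/16.\<close>
    have "\<forall>\<^sub>F N in sequentially. norm (real (k N)) \<le> 1 / 8 * norm (real N powr (2/3))"
      by (rule landau_o.smallD[OF ko]) simp
    thus ?thesis using eventually_ge_at_top[of 1]
    proof eventually_elim
      case (elim N)
      have N: "1 \<le> real N" using elim by simp
      have le: "real (k N) \<le> 1 / 8 * real N powr (2/3)" using elim by simp
      have "real N powr (2/3) \<le> real N powr 1" by (rule powr_mono) (use N in auto)
      hence "8 * real (k N) \<le> real N" using le N by simp
      hence a: "8 * k N \<le> N" by linarith
      have "real (k N) ^ 3 \<le> (1 / 8 * real N powr (2/3)) ^ 3" using le by (rule power_mono) simp
      also have "\<dots> = 1 / 512 * (real N powr (2/3)) ^ 3" by (simp add: power_mult_distrib power_divide)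
      also have "(real N powr (2/3)) ^ 3 = (real N powr (2/3)) powr 3" using N by (simp add: powr_numeral)
      also have "\<dots> = real N powr 2" unfolding powr_powr by simp
      also have "\<dots> = real N ^ 2" using N by (simp add: powr_numeral)
      finally have "16 * real (k N) ^ 3 \<le> real N ^ 2" using zero_le_power2[of "real N"] by linarith
      hence "real (16 * k N ^ 3) \<le> real (N ^ 2)" by simp
      hence "16 * k N ^ 3 \<le> N ^ 2" by (simp only: of_nat_le_iff)
      with a show ?case by simp
    qed
  qed
  have kN: "(\<lambda>N. real (k N) / real N) \<longlonglongrightarrow> 0"
  proof (rule tendsto_sandwich[OF _ _ tendsto_const])
    show "(\<lambda>N. real (k N) / real N powr (2/3)) \<longlonglongrightarrow> 0" by (rule smalloD_tendsto[OF ko])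
    show "\<forall>\<^sub>F N in sequentially. 0 \<le> real (k N) / real N" by simp
    show "\<forall>\<^sub>F N in sequentially. real (k N) / real N \<le> real (k N) / real N powr (2/3)"
      using eventually_ge_at_top[of 1]
    proof eventually_elim
      case (elim N)
      have N: "1 \<le> real N" using elim by simp
      have "real N powr (2/3) \<le> real N powr 1" by (rule powr_mono) (use N in auto)
      thus ?case using N by (intro divide_left_mono) auto
    qed
  qed
  have upper: "\<forall>\<^sub>F N in sequentially. \<rho> N \<le> 300"
  proof -
    have "\<forall>\<^sub>F N in sequentially. 96 * ln (4 / \<epsilon>) \<le> 12 * ln (real N)" by real_asymp
    with small show ?thesis
    proof eventually_elim
      case (elim N)
      show ?case unfolding \<rho>_def by (rule tmix_ratio_le) (use elim k2 \<epsilon> in auto)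
    qed
  qed
  have lower: "\<forall>\<^sub>F N in sequentially. b \<le> \<rho> N" if b: "b < 6 / pi^2" for b
  proof -
    define e where "e = 1 - b * pi^2 / 6"
    \<comment> \<open>\<open>e\<close> measures how far \<open>b\<close> is below
      \<open>6 / pi^2\<close>; it exceeds 1 when \<open>b\<close> is negative, and the cap 1/2 keeps
      \<open>1 - \<delta>\<close> positive.\<close>
    define \<delta> where "\<delta> = min (1/2) (e / 2)"
    have "0 < e" using b by (simp add: e_def field_simps)
    hence "0 < \<delta>" "\<delta> \<le> 1/2" "\<delta> < e" by (auto simp: \<delta>_def)
    hence \<delta>: "0 < \<delta>" "\<delta> \<le> 1/2" "b * pi^2 / 6 < 1 - \<delta>" by (simp_all add: e_def)
    have "b < (1 - \<delta>) * (6 / pi^2) * (1 - 2 * 0)^2"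
      using \<delta>(3) by (simp add: field_simps)
    moreover have "(\<lambda>N. (1 - \<delta>) * (6 / pi^2) * (1 - 2 * (real (k N) / real N))^2) \<longlonglongrightarrow> (1 - \<delta>) * (6 / pi^2) * (1 - 2 * 0)^2"
      by (intro tendsto_intros kN)
    ultimately have ev: "\<forall>\<^sub>F N in sequentially. b < (1 - \<delta>) * (6 / pi^2) * (1 - 2 * (real (k N) / real N))^2"
      by (rule order_tendstoD(1)[rotated])
    \<comment> \<open>The first error term is a constant times \<open>N\<close> to the power
      \<open>- \<delta>\<close>, and the exponent in the second tends to 0: the distance tends to 1,
      whatever the threshold \<open>\<epsilon>\<close>.\<close>
    have "(\<lambda>N. 1 - 98304 * exp ((1 - \<delta>) * ln (real N)) / real N - 4 * (exp ((1 - \<delta>) * ln (real N) / real N) - 1)) \<longlonglongrightarrow> 1"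
      using \<delta>(1,2) by real_asymp
    hence "\<forall>\<^sub>F N in sequentially. \<epsilon> < 1 - 98304 * exp ((1 - \<delta>) * ln (real N)) / real N - 4 * (exp ((1 - \<delta>) * ln (real N) / real N) - 1)"
      by (rule order_tendstoD(1)) (use \<epsilon> in simp)
    with small ev show ?thesis
    proof eventually_elim
      case (elim N)
      have "(1 - \<delta>) * (6 / pi^2) * (1 - 2 * (real (k N) / real N))^2 \<le> \<rho> N"
        unfolding \<rho>_def by (rule tmix_ratio_ge) (use elim k2 \<epsilon> in auto)
      thus ?case using elim by linarith
    qed
  qed
  have "ereal (6 / pi^2) \<le> liminf (\<lambda>N. ereal (\<rho> N))"
  proof (rule dense_le)
    fix x assume x: "x < ereal (6 / pi^2)"
    show "x \<le> liminf (\<lambda>N. ereal (\<rho> N))"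
    proof (cases x)
      case (real b)
      thus ?thesis using lower[of b] x by (intro Liminf_bounded) auto
    qed (use x in auto)
  qed
  moreover have "liminf (\<lambda>N. ereal (\<rho> N)) \<le> limsup (\<lambda>N. ereal (\<rho> N))"
    by (rule Liminf_le_Limsup) simp
  moreover have "limsup (\<lambda>N. ereal (\<rho> N)) \<le> ereal 300"
    by (rule Limsup_bounded) (use upper in simp)
  ultimately show "let r = (\<lambda>N. ereal (real (k N) * (real (k N) ^ 2 - 1) * tmix N (k N) \<epsilon> / (real N ^ 2 * ln (real N))))
     in ereal (6 / pi^2) \<le> liminf r \<and> liminf r \<le> limsup r \<and> limsup r \<le> ereal 300"
    unfolding \<rho>_def Let_def by blast
qed

end
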